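(* There exists a polynomial-time randomized non-preemptive online algorithm for minimizing total flow time on a single machine ($m=1$) which is $O(\sqrt{n})$-competitive against the optimal offline preemptive schedule; that is, for every instance $J$ with $n$ jobs, $\mathbb{E}[F(\mathrm{ALG}(J))] \le O(\sqrt{n})\cdot \mathrm{OPT}(J)$.
   Context: Online scheduling of $n$ jobs on $m$ identical machines. Each job $j$ has a release time $r_j\ge 0$ and a processing time $p_j>0$; the job becomes known to the algorithm only at time $r_j$, and the number of jobs $n$ is known to the algorithm in advance. Each machine processes at most one job at a time. In the non-preemptive model, a job once started on a machine runs without interruption until it completes. The flow time of job $j$ is $C_j-r_j$ where $C_j$ is its completion time, and $F(\cdot)$ denotes the total flow time of a schedule. Here $\mathrm{OPT}(J)$ is the minimum total flow time over all offline preemptive schedules without migration (a job may be interrupted and later resumed on the same machine without losing processed work). A randomized algorithm is $\Gamma$-competitive if its expected total flow time is at most $\Gamma\cdot\mathrm{OPT}(J)$ for every instance $J$. *)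

theory Defs
  imports
    "HOL-Probability.Probability"
    "HOL-Computational_Algebra.Polynomial"
    "HOL-Library.Landau_Symbols"
begin

section \<open>Instances and schedules\<close>

text \<open>An instance lists, for each job, its release time and its processing time.
  The position in the list is only a name; release times need not be sorted.\<close>

type_synonym jobs = "(real \<times> real) list"

definition valid_jobs :: "jobs \<Rightarrow> bool" where
  "valid_jobs J \<longleftrightarrow> (\<forall>(r, p) \<in> set J. 0 \<le> r \<and> 0 < p)"

abbreviation rel :: "jobs \<Rightarrow> nat \<Rightarrow> real" where
  "rel J j \<equiv> fst (J ! j)"

abbreviation proc :: "jobs \<Rightarrow> nat \<Rightarrow> real" where
  "proc J j \<equiv> snd (J ! j)"

definition total_flow :: "jobs \<Rightarrow> (nat \<Rightarrow> real) \<Rightarrow> real" where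
  "total_flow J C = (\<Sum>j<length J. C j - rel J j)"

text \<open>A preemptive schedule on one machine is a finite set of pieces \<open>(j, a, b)\<close>:
  job \<open>j\<close> is processed without interruption during \<open>[a, b]\<close>.\<close>

type_synonym pieces = "(nat \<times> real \<times> real) set"

definition preemptive_schedule :: "jobs \<Rightarrow> pieces \<Rightarrow> bool" where
  "preemptive_schedule J P \<longleftrightarrow>
     finite P \<and>
     (\<forall>(j, a, b) \<in> P. j < length J \<and> rel J j \<le> a \<and> a < b) \<and>
     (\<forall>(j, a, b) \<in> P. \<forall>(j', a', b') \<in> P.
        (j, a, b) \<noteq> (j', a', b') \<longrightarrow> b \<le> a' \<or> b' \<le> a) \<and>
     (\<forall>j<length J. (\<Sum>(i, a, b) \<in> {x \<in> P. fst x = j}. b - a) = proc J j)"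

definition completion :: "pieces \<Rightarrow> nat \<Rightarrow> real" where
  "completion P j = Max {b. \<exists>a. (j, a, b) \<in> P}"

definition OPT :: "jobs \<Rightarrow> real" where
  "OPT J = Inf {total_flow J (completion P) | P. preemptive_schedule J P}"

text \<open>For valid instances the infimum is taken over a nonempty set that is bounded below.\<close>

lemma total_flow_completion_nonneg:
  assumes P: "preemptive_schedule J P" and "valid_jobs J"
  shows "0 \<le> total_flow J (completion P)"
  unfolding total_flow_def
proof (intro sum_nonneg)
  fix j assume "j \<in> {..<length J}"
  then have j: "j < length J" by simp
  have "0 < proc J j"
    using assms(2) j unfolding valid_jobs_def by (metis nth_mem case_prod_beta)
  moreover have "(\<Sum>(i, a, b) \<in> {x \<in> P. fst x = j}. b - a) = proc J j"
    using P j unfolding preemptive_schedule_def by blast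
  ultimately have "{x \<in> P. fst x = j} \<noteq> {}" by force
  then obtain a b where ab: "(j, a, b) \<in> P" by auto
  then have "rel J j \<le> a" "a < b" using P unfolding preemptive_schedule_def by fastforce+
  moreover have "b \<le> completion P j"
    unfolding completion_def
  proof (rule Max_ge)
    have "{b. \<exists>a. (j, a, b) \<in> P} \<subseteq> (\<lambda>x. snd (snd x)) ` P" by force
    then show "finite {b. \<exists>a. (j, a, b) \<in> P}"
      using P finite_surj unfolding preemptive_schedule_def by blast
  qed (use ab in auto)
  ultimately show "0 \<le> completion P j - rel J j" by linarith
qed

lemma preemptive_schedule_exists:
  assumes "valid_jobs J"
  shows "\<exists>P. preemptive_schedule J P"
proof -
  define R where "R = (\<Sum>j<length J. rel J j)"
  define B where "B j = R + (\<Sum>i<j. proc J i)" for j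
  define f where "f j = (j, B j, B (Suc j))" for j
  have r: "0 \<le> rel J j" and p: "0 < proc J j" if "j < length J" for j
    using assms that unfolding valid_jobs_def by (metis nth_mem case_prod_beta)+
  have R: "rel J j \<le> R" if "j < length J" for j
    unfolding R_def by (rule member_le_sum) (use r that in auto)
  have mono: "B i \<le> B j" if "i \<le> j" "j \<le> length J" for i j
    unfolding B_def
    by (intro add_left_mono sum_mono2) (use that p in \<open>auto simp: less_imp_le\<close>)
  have R_B: "R \<le> B j" if "j < length J" for j
    using mono[of 0 j] that by (simp add: B_def)
  have rel_B: "rel J j \<le> B j" if "j < length J" for j
    using R[OF that] R_B[OF that] by linarith
  have B_Suc: "B j < B (Suc j)" if "j < length J" for j
    using p[OF that] by (simp add: B_def)
  have one: "{x \<in> f ` {..<length J}. fst x = j} = {f j}" if "j < length J" for j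
    using that by (auto simp: f_def)
  have "preemptive_schedule J (f ` {..<length J})"
    unfolding preemptive_schedule_def
  proof (intro conjI)
    show "finite (f ` {..<length J})" by simp
    show "\<forall>(j, a, b) \<in> f ` {..<length J}. j < length J \<and> rel J j \<le> a \<and> a < b"
      using rel_B B_Suc by (auto simp: f_def)
    show "\<forall>(j, a, b) \<in> f ` {..<length J}. \<forall>(j', a', b') \<in> f ` {..<length J}.
        (j, a, b) \<noteq> (j', a', b') \<longrightarrow> b \<le> a' \<or> b' \<le> a"
    proof -
      have "B (Suc i) \<le> B j \<or> B (Suc j) \<le> B i"
        if "i < length J" "j < length J" "i \<noteq> j" for i j
        using mono[of "Suc i" j] mono[of "Suc j" i] that by linarith
      then show ?thesis by (fastforce simp: f_def)
    qed
    show "\<forall>j<length J. (\<Sum>(i, a, b) \<in> {x \<in> f ` {..<length J}. fst x = j}. b - a) = proc J j"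
      by (simp add: one) (simp add: f_def B_def)
  qed
  then show ?thesis by blast
qed

text \<open>A non-preemptive schedule is given by the start times of the jobs.\<close>

definition nonpreemptive_schedule :: "jobs \<Rightarrow> (nat \<rightharpoonup> real) \<Rightarrow> bool" where
  "nonpreemptive_schedule J S \<longleftrightarrow>
     dom S = {..<length J} \<and>
     (\<forall>j<length J. rel J j \<le> the (S j)) \<and>
     (\<forall>i<length J. \<forall>j<length J. i \<noteq> j \<longrightarrow>
        the (S i) + proc J i \<le> the (S j) \<or> the (S j) + proc J j \<le> the (S i))"

definition nonpreemptive_flow :: "jobs \<Rightarrow> (nat \<rightharpoonup> real) \<Rightarrow> real" where
  "nonpreemptive_flow J S = total_flow J (\<lambda>j. the (S j) + proc J j)"


section \<open>Machine model\<close>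

text \<open>Since release and processing times are real numbers, computations are those of a
  unit-cost real random access machine. All variables are arrays; a scalar is an array used
  at index 0 only. The arithmetic is linear with rational constants. There is no
  multiplication of two variables, so on rational inputs, written over a common denominator, every
  executed command lengthens the stored numbers by at most a constant number of bits. Hence a number
  of steps that is polynomial in the number of jobs also means polynomial bit complexity.\<close>

type_synonym name = string

record store =
  natv :: "name \<Rightarrow> nat \<Rightarrow> nat"
  realv :: "name \<Rightarrow> nat \<Rightarrow> real"

datatype nexp = NConst nat | NVar name nexp | NPlus nexp nexp | NMinus nexp nexp

datatype rexp = RConst rat | RVar name nexp | RPlus rexp rexp | RMinus rexp rexp
  | RScale rat rexp

datatype bexp = NLess nexp nexp | RLess rexp rexp | Not bexp | And bexp bexp

datatype com =
    Skip
  | NAssign name nexp nexp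
  | RAssign name nexp rexp
  | Seq com com
  | If bexp com com
  | While bexp com

fun nval :: "store \<Rightarrow> nexp \<Rightarrow> nat" where
  "nval s (NConst k) = k"
| "nval s (NVar x e) = natv s x (nval s e)"
| "nval s (NPlus e f) = nval s e + nval s f"
| "nval s (NMinus e f) = nval s e - nval s f"

fun rval :: "store \<Rightarrow> rexp \<Rightarrow> real" where
  "rval s (RConst q) = of_rat q"
| "rval s (RVar x e) = realv s x (nval s e)"
| "rval s (RPlus e f) = rval s e + rval s f"
| "rval s (RMinus e f) = rval s e - rval s f"
| "rval s (RScale q e) = of_rat q * rval s e"

fun bval :: "store \<Rightarrow> bexp \<Rightarrow> bool" where
  "bval s (NLess e f) = (nval s e < nval s f)"
| "bval s (RLess e f) = (rval s e < rval s f)"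
| "bval s (Not b) = (\<not> bval s b)"
| "bval s (And b b') = (bval s b \<and> bval s b')"

definition nat_update :: "name \<Rightarrow> nat \<Rightarrow> nat \<Rightarrow> store \<Rightarrow> store" where
  "nat_update x i v s = s\<lparr>natv := (natv s)(x := (natv s x)(i := v))\<rparr>"

definition real_update :: "name \<Rightarrow> nat \<Rightarrow> real \<Rightarrow> store \<Rightarrow> store" where
  "real_update x i v s = s\<lparr>realv := (realv s)(x := (realv s x)(i := v))\<rparr>"

text \<open>\<open>exec c s k s'\<close>: started in \<open>s\<close>, the command \<open>c\<close> halts in \<open>s'\<close> after \<open>k\<close> steps, where every
  assignment and every evaluation of a test is one step. Evaluating an expression takes constant
  time because its size is fixed by the program.\<close>

inductive exec :: "com \<Rightarrow> store \<Rightarrow> nat \<Rightarrow> store \<Rightarrow> bool" where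
  exec_Skip: "exec Skip s 1 s"
| exec_NAssign: "exec (NAssign x e f) s 1 (nat_update x (nval s e) (nval s f) s)"
| exec_RAssign: "exec (RAssign x e f) s 1 (real_update x (nval s e) (rval s f) s)"
| exec_Seq: "exec c s k s' \<Longrightarrow> exec d s' l s'' \<Longrightarrow> exec (Seq c d) s (k + l) s''"
| exec_IfTrue: "bval s b \<Longrightarrow> exec c s k s' \<Longrightarrow> exec (If b c d) s (Suc k) s'"
| exec_IfFalse: "\<not> bval s b \<Longrightarrow> exec d s k s' \<Longrightarrow> exec (If b c d) s (Suc k) s'"
| exec_WhileFalse: "\<not> bval s b \<Longrightarrow> exec (While b c) s 1 s"
| exec_WhileTrue: "bval s b \<Longrightarrow> exec c s k s' \<Longrightarrow> exec (While b c) s' l s'' \<Longrightarrow>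
    exec (While b c) s (Suc (k + l)) s''"


section \<open>Randomized non-preemptive online algorithms\<close>

text \<open>The coins are tossed once and for all: an algorithm consists of a program and a polynomial
  giving the number of fair coins as a function of the number of jobs.\<close>

record online_alg =
  program :: com
  coins :: "nat poly"

definition known_jobs :: "jobs \<Rightarrow> real \<Rightarrow> (nat \<rightharpoonup> real \<times> real)" where
  "known_jobs J t = (\<lambda>j. if j < length J \<and> rel J j \<le> t then Some (J ! j) else None)"

text \<open>The program is executed whenever a decision is due, that is, whenever the machine is idle and
  something has happened. Its input is everything the algorithm may know at the current time \<open>t\<close>:
  the number \<open>n\<close> of jobs, the coins \<open>\<omega>\<close>, the jobs \<open>K\<close> released so far, and the start times \<open>S\<close>
  of the jobs started so far. No further memory is carried from one decision to the next: earlier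
  computations can be repeated, because the coins remain the same.\<close>

definition input_store :: "nat \<Rightarrow> bool list \<Rightarrow> real \<Rightarrow> (nat \<rightharpoonup> real \<times> real) \<Rightarrow> (nat \<rightharpoonup> real) \<Rightarrow> store" where
  "input_store n \<omega> t K S =
     \<lparr> natv = (\<lambda>x i.
         if x = ''n'' \<and> i = 0 then n
         else if x = ''coin'' \<and> i < length \<omega> then of_bool (\<omega> ! i)
         else if x = ''known'' then of_bool (i \<in> dom K)
         else if x = ''started'' then of_bool (i \<in> dom S)
         else 0),
       realv = (\<lambda>x i.
         if x = ''now'' \<and> i = 0 then t
         else if x = ''rel'' \<and> i \<in> dom K then fst (the (K i))
         else if x = ''proc'' \<and> i \<in> dom K then snd (the (K i))
         else if x = ''start'' \<and> i \<in> dom S then the (S i)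
         else 0) \<rparr>"

text \<open>The idle machine either starts a job now, or waits for the next release, or waits for the
  next release but at most until a given time.\<close>

datatype decision = Start nat | Wait | WaitUntil real

definition decision_of :: "store \<Rightarrow> decision" where
  "decision_of s =
     (if natv s ''act'' 0 = 0 then Start (natv s ''job'' 0)
      else if natv s ''act'' 0 = 1 then Wait
      else WaitUntil (realv s ''until'' 0))"

definition later_releases :: "jobs \<Rightarrow> real \<Rightarrow> real set" where
  "later_releases J t = {rel J j | j. j < length J \<and> t < rel J j}"

text \<open>\<open>online_run c \<omega> J t S k S'\<close>: if a decision is due at time \<open>t\<close>, when the jobs in \<open>dom S\<close> have
  been started (and completed), then the program \<open>c\<close> eventually starts all jobs, the final start
  times are \<open>S'\<close>, and \<open>k\<close> steps of computation are made in total. A run that makes an inadmissible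
  decision, or waits for a release that never comes, gets stuck.\<close>

inductive online_run ::
  "com \<Rightarrow> bool list \<Rightarrow> jobs \<Rightarrow> real \<Rightarrow> (nat \<rightharpoonup> real) \<Rightarrow> nat \<Rightarrow> (nat \<rightharpoonup> real) \<Rightarrow> bool"
  for c \<omega> J where
  run_done: "dom S = {..<length J} \<Longrightarrow> online_run c \<omega> J t S 0 S"
| run_start:
    "dom S \<noteq> {..<length J} \<Longrightarrow>
     exec c (input_store (length J) \<omega> t (known_jobs J t) S) k s \<Longrightarrow> decision_of s = Start j \<Longrightarrow>
     j \<in> dom (known_jobs J t) - dom S \<Longrightarrow>
     online_run c \<omega> J (t + proc J j) (S(j \<mapsto> t)) l S' \<Longrightarrow>
     online_run c \<omega> J t S (k + l) S'"
| run_wait: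
    "dom S \<noteq> {..<length J} \<Longrightarrow>
     exec c (input_store (length J) \<omega> t (known_jobs J t) S) k s \<Longrightarrow> decision_of s = Wait \<Longrightarrow>
     later_releases J t \<noteq> {} \<Longrightarrow>
     online_run c \<omega> J (Min (later_releases J t)) S l S' \<Longrightarrow>
     online_run c \<omega> J t S (k + l) S'"
| run_wait_until:
    "dom S \<noteq> {..<length J} \<Longrightarrow>
     exec c (input_store (length J) \<omega> t (known_jobs J t) S) k s \<Longrightarrow> decision_of s = WaitUntil u \<Longrightarrow>
     t < u \<Longrightarrow>
     online_run c \<omega> J (Min (insert u (later_releases J t))) S l S' \<Longrightarrow>
     online_run c \<omega> J t S (k + l) S'"

definition schedule_of :: "com \<Rightarrow> bool list \<Rightarrow> jobs \<Rightarrow> (nat \<rightharpoonup> real)" where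
  "schedule_of c \<omega> J = (THE S. \<exists>k. online_run c \<omega> J 0 Map.empty k S)"

text \<open>Every run schedules all jobs, and the total computation time, over all decisions, is
  polynomial in the number of jobs.\<close>

definition polynomial_time :: "online_alg \<Rightarrow> bool" where
  "polynomial_time A \<longleftrightarrow>
     (\<exists>q :: nat poly. \<forall>J \<omega>.
        valid_jobs J \<and> length \<omega> = poly (coins A) (length J) \<longrightarrow>
        (\<exists>k S. online_run (program A) \<omega> J 0 Map.empty k S \<and> k \<le> poly q (length J)))"

definition expected_flow :: "online_alg \<Rightarrow> jobs \<Rightarrow> real" where
  "expected_flow A J =
     measure_pmf.expectation (pmf_of_set {\<omega> :: bool list. length \<omega> = poly (coins A) (length J)})
       (\<lambda>\<omega>. nonpreemptive_flow J (schedule_of (program A) \<omega> J))"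

text \<open>The competitive ratio may depend on the number of jobs.\<close>

definition competitive :: "online_alg \<Rightarrow> (nat \<Rightarrow> real) \<Rightarrow> bool" where
  "competitive A \<Gamma> \<longleftrightarrow>
     (\<forall>J. valid_jobs J \<longrightarrow> expected_flow A J \<le> \<Gamma> (length J) * OPT J)"


section \<open>Runs are deterministic and yield non-preemptive schedules\<close>

lemma exec_deterministic:
  "exec c s k s' \<Longrightarrow> exec c s l s'' \<Longrightarrow> k = l \<and> s' = s''"
proof (induction arbitrary: l s'' rule: exec.induct)
  case (exec_Seq c s k s' d l' t)
  from exec_Seq.prems show ?case
    by cases (use exec_Seq.IH in blast)
next
  case (exec_WhileTrue s b c k s' l' t)
  from exec_WhileTrue.prems show ?case
    by cases (use exec_WhileTrue.hyps exec_WhileTrue.IH in blast)+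
next
  case (exec_IfTrue s b c k s' d)
  from exec_IfTrue.prems show ?case
    by cases (use exec_IfTrue.hyps exec_IfTrue.IH in blast)+
next
  case (exec_IfFalse s b d k s' c)
  from exec_IfFalse.prems show ?case
    by cases (use exec_IfFalse.hyps exec_IfFalse.IH in blast)+
qed (auto elim: exec.cases)

lemma online_run_deterministic:
  "online_run c \<omega> J t S k S' \<Longrightarrow> online_run c \<omega> J t S l S'' \<Longrightarrow> k = l \<and> S' = S''"
proof (induction arbitrary: l S'' rule: online_run.induct)
  case (run_done S t)
  from run_done.prems run_done.hyps show ?case by cases auto
next
  case (run_start S t k s j l' S')
  note det = exec_deterministic[OF run_start.hyps(2)]
  from run_start.prems show ?case
    by cases (use run_start.hyps(1,3) run_start.IH in \<open>auto simp del: fun_upd_apply dest!: det\<close>)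
next
  case (run_wait S t k s l' S')
  note det = exec_deterministic[OF run_wait.hyps(2)]
  from run_wait.prems show ?case
    by cases (use run_wait.hyps(1,3) run_wait.IH in \<open>auto dest!: det\<close>)
next
  case (run_wait_until S t k s u l' S')
  note det = exec_deterministic[OF run_wait_until.hyps(2)]
  from run_wait_until.prems show ?case
    by cases (use run_wait_until.hyps(1,3) run_wait_until.IH in \<open>auto dest!: det\<close>)
qed

lemma schedule_of_eq:
  "online_run c \<omega> J 0 Map.empty k S \<Longrightarrow> schedule_of c \<omega> J = S"
  unfolding schedule_of_def by (blast intro: the_equality dest: online_run_deterministic)

lemma online_run_nonpreemptive_aux:
  assumes "online_run c \<omega> J t S k S'"
    and "dom S \<subseteq> {..<length J}"
    and "\<forall>j\<in>dom S. rel J j \<le> the (S j) \<and> the (S j) + proc J j \<le> t"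
    and "\<forall>i\<in>dom S. \<forall>j\<in>dom S. i \<noteq> j \<longrightarrow>
           the (S i) + proc J i \<le> the (S j) \<or> the (S j) + proc J j \<le> the (S i)"
    and "valid_jobs J"
  shows "nonpreemptive_schedule J S'"
  using assms
proof (induction rule: online_run.induct)
  case (run_done S t)
  then show ?case by (simp add: nonpreemptive_schedule_def)
next
  case (run_start S t k s j l S')
  have j: "j < length J" "rel J j \<le> t" "j \<notin> dom S"
    using run_start.hyps by (auto simp: known_jobs_def dom_def split: if_splits)
  have p: "0 < proc J j"
    using run_start.prems(4) j(1) unfolding valid_jobs_def by (metis nth_mem case_prod_beta)
  show ?case
  proof (rule run_start.IH)
    show "dom (S(j \<mapsto> t)) \<subseteq> {..<length J}" using run_start.prems j by auto
    show "\<forall>i\<in>dom (S(j \<mapsto> t)). rel J i \<le> the ((S(j \<mapsto> t)) i) \<and>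
        the ((S(j \<mapsto> t)) i) + proc J i \<le> t + proc J j"
    proof
      fix i assume "i \<in> dom (S(j \<mapsto> t))"
      then consider "i = j" | "i \<noteq> j" "i \<in> dom S" by (auto split: if_splits)
      then show "rel J i \<le> the ((S(j \<mapsto> t)) i) \<and> the ((S(j \<mapsto> t)) i) + proc J i \<le> t + proc J j"
      proof cases
        case 1
        then show ?thesis using j by simp
      next
        case 2
        then have "rel J i \<le> the (S i) \<and> the (S i) + proc J i \<le> t"
          using run_start.prems(2) by blast
        with 2 p show ?thesis by simp
      qed
    qed
    show "\<forall>i\<in>dom (S(j \<mapsto> t)). \<forall>i'\<in>dom (S(j \<mapsto> t)). i \<noteq> i' \<longrightarrow>
        the ((S(j \<mapsto> t)) i) + proc J i \<le> the ((S(j \<mapsto> t)) i') \<or>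
        the ((S(j \<mapsto> t)) i') + proc J i' \<le> the ((S(j \<mapsto> t)) i)"
    proof (intro ballI impI)
      fix i i' assume "i \<in> dom (S(j \<mapsto> t))" "i' \<in> dom (S(j \<mapsto> t))" and ne: "i \<noteq> i'"
      then have i: "i = j \<or> i \<in> dom S" "i' = j \<or> i' \<in> dom S" by (auto split: if_splits)
      consider "i = j" "i' \<noteq> j" "i' \<in> dom S" | "i' = j" "i \<noteq> j" "i \<in> dom S"
        | "i \<noteq> j" "i \<in> dom S" "i' \<noteq> j" "i' \<in> dom S"
        using i ne by blast
      then show "the ((S(j \<mapsto> t)) i) + proc J i \<le> the ((S(j \<mapsto> t)) i') \<or>
          the ((S(j \<mapsto> t)) i') + proc J i' \<le> the ((S(j \<mapsto> t)) i)"
      proof cases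
        case 1
        then show ?thesis using run_start.prems(2) by simp
      next
        case 2
        then show ?thesis using run_start.prems(2) by simp
      next
        case 3
        then have "the (S i) + proc J i \<le> the (S i') \<or> the (S i') + proc J i' \<le> the (S i)"
          using run_start.prems(3) ne by blast
        with 3 show ?thesis by simp
      qed
    qed
    show "valid_jobs J" by fact
  qed
next
  case (run_wait S t k s l S')
  have fin: "finite (later_releases J t)" by (simp add: later_releases_def)
  have "Min (later_releases J t) \<in> later_releases J t"
    by (rule Min_in) (use fin run_wait.hyps in auto)
  then have "t \<le> Min (later_releases J t)" by (auto simp: later_releases_def)
  then show ?case
    using run_wait.prems by (intro run_wait.IH) (blast intro: order_trans)+
next
  case (run_wait_until S t k s u l S')
  have fin: "finite (later_releases J t)" by (simp add: later_releases_def)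
  have "Min (insert u (later_releases J t)) \<in> insert u (later_releases J t)"
    by (rule Min_in) (use fin in auto)
  then have "t \<le> Min (insert u (later_releases J t))"
    using run_wait_until.hyps by (auto simp: later_releases_def)
  then show ?case
    using run_wait_until.prems by (intro run_wait_until.IH) (blast intro: order_trans)+
qed

lemma online_run_nonpreemptive:
  assumes "valid_jobs J" and "online_run c \<omega> J 0 Map.empty k S"
  shows "nonpreemptive_schedule J S"
  using online_run_nonpreemptive_aux[OF assms(2)] assms(1) by simp

end

theory Submission
  imports Defs
begin

text \<open>Let \<open>K\<close> be about \<open>sqrt n\<close>. An idle machine with more than \<open>K\<close> pending jobs starts the
  shortest one (a forced start). Otherwise a pending job \<open>j\<close> is started as soon as the machine has been
  idle, since the release of \<open>j\<close>, for \<open>U j\<close> times the processing time of \<open>j\<close>, where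
  \<open>U j\<close> is uniform in \<open>{0..<K}\<close>.

  While the machine idles, the pending jobs pay at most \<open>K\<close> times their total volume; while it is busy
  with at most \<open>K\<close> jobs pending, they pay \<open>K\<close> per unit of work. When more than \<open>K\<close> jobs are
  pending, always starting the shortest one keeps up with any preemptive schedule, except for \<open>K\<close> old
  jobs and a lag of one processing time: that of a forced job, which is at most a fraction
  \<open>1/K\<close> of the total volume, or that of an unforced job \<open>j\<close> from which the busy period originates.
  A given job suffers from the latter for at most two values of \<open>U j\<close>: the run with the larger value
  has idled for a time \<open>p j\<close> before it starts \<open>j\<close>, and by then the run with the smaller value
  has made up for its lag. So this happens with probability at most \<open>2/K\<close>.\<close>

section \<open>Volumes and cardinalities\<close>

text \<open>The flow of any preemptive schedule is at least the total volume, so delays of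
  \<open>K\<close> or of \<open>n / K\<close> times the volume are affordable; balancing the two
  gives \<open>sqrt n\<close>. The obstacle is a long job \<open>j\<close> started just before up to
  \<open>n\<close> short jobs arrive, each of which may be held up for \<open>p j\<close>. The start
  under a deterministic rule is predictable, so an instance can always release the short jobs right
  after it. Spreading the start over \<open>K\<close> multiples of \<open>p j\<close> lowers the
  expected damage to the order of \<open>n * p j / K\<close>.

  The wait is measured in idle time, not in elapsed time: what one run leaves idle is exactly what a
  run with a smaller threshold can use to catch up. Choosing \<open>K\<close> as a power of two
  makes thresholds built from fair coins exactly uniform. In the final constant 33, a part of 17
  comes from charges valid for every outcome of the coins, and 16 from the random starts.\<close>

lemma sum_disjoint_intervals_le:
  fixes a b :: "'a \<Rightarrow> real"
  assumes "finite X" "\<sigma> \<le> t"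
    and "\<And>i. i \<in> X \<Longrightarrow> \<sigma> \<le> a i \<and> a i < b i \<and> b i \<le> t"
    and "\<And>i j. i \<in> X \<Longrightarrow> j \<in> X \<Longrightarrow> i \<noteq> j \<Longrightarrow> b i \<le> a j \<or> b j \<le> a i"
  shows "(\<Sum>i\<in>X. b i - a i) \<le> t - \<sigma>"
  using assms
proof (induction "card X" arbitrary: X t)
  case 0
  then show ?case by simp
next
  case (Suc m)
  then have ne: "X \<noteq> {}" by auto
  obtain k where k: "k \<in> X" "\<And>i. i \<in> X \<Longrightarrow> a i \<le> a k"
    using Max_in[of "a ` X"] Max_ge[of "a ` X"] Suc.prems(1) ne by fastforce
  \<comment> \<open>Since \<open>k\<close> starts last, disjointness makes every other interval end
    by \<open>a k\<close>, and the induction applies with \<open>t\<close> lowered to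
    \<open>a k\<close>.\<close>
  have "(\<Sum>i\<in>X - {k}. b i - a i) \<le> a k - \<sigma>"
  proof (rule Suc.hyps(1))
    show "m = card (X - {k})" using Suc.hyps(2) k(1) Suc.prems(1) by simp
    show "\<sigma> \<le> a i \<and> a i < b i \<and> b i \<le> a k" if "i \<in> X - {k}" for i
      using Suc.prems(3)[of i] Suc.prems(3)[of k] Suc.prems(4)[of i k] k that by force
  qed (use Suc.prems k in auto)
  then show ?case
    using Suc.prems(3)[of k] k(1) by (simp add: sum.remove[OF Suc.prems(1) k(1)])
qed

context
  fixes J :: jobs and P :: pieces
  assumes valid: "valid_jobs J" and sched: "preemptive_schedule J P"
begin

lemma pieces_finite: "finite P"
  and pieces_rel: "(j, a, b) \<in> P \<Longrightarrow> j < length J \<and> rel J j \<le> a \<and> a < b"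
  and pieces_disjoint: "(j, a, b) \<in> P \<Longrightarrow> (j', a', b') \<in> P \<Longrightarrow> (j, a, b) \<noteq> (j', a', b') \<Longrightarrow> b \<le> a' \<or> b' \<le> a"
  and pieces_sum: "j < length J \<Longrightarrow> (\<Sum>(i, a, b) \<in> {x \<in> P. fst x = j}. b - a) = proc J j"
  using sched unfolding preemptive_schedule_def by fast+

lemma piece_le_completion: "(j, a, b) \<in> P \<Longrightarrow> b \<le> completion P j"
  unfolding completion_def
proof (rule Max_ge)
  have "{b. \<exists>a. (j, a, b) \<in> P} \<subseteq> (\<lambda>x. snd (snd x)) ` P" by force
  then show "finite {b. \<exists>a. (j, a, b) \<in> P}"
    using pieces_finite finite_surj by blast
qed auto

lemma proc_pos: "j < length J \<Longrightarrow> 0 < proc J j"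
  using valid unfolding valid_jobs_def by (metis nth_mem case_prod_beta)+

text \<open>All pieces of these jobs lie between \<sigma> and \<open>t\<close> and are disjoint.
  This is the form in which the feasibility of \<open>P\<close> enters the comparison with the
  algorithm.\<close>

lemma preemptive_volume_le:
  assumes "X \<subseteq> {..<length J}" "\<sigma> \<le> t" "\<And>i. i \<in> X \<Longrightarrow> \<sigma> \<le> rel J i \<and> completion P i \<le> t"
  shows "(\<Sum>i\<in>X. proc J i) \<le> t - \<sigma>"
proof -
  have finX: "finite X" using assms(1) finite_subset by blast
  have "(\<Sum>i\<in>X. proc J i) = (\<Sum>j\<in>X. \<Sum>x\<in>{x \<in> P. fst x = j}. snd (snd x) - fst (snd x))"
    by (rule sum.cong[OF refl], subst pieces_sum[symmetric])
       (use assms(1) in \<open>auto simp: case_prod_beta\<close>)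
  also have "\<dots> = (\<Sum>x\<in>(\<Union>j\<in>X. {x \<in> P. fst x = j}). snd (snd x) - fst (snd x))"
    by (rule sum.UNION_disjoint[symmetric]) (use finX pieces_finite in auto)
  also have "\<dots> \<le> t - \<sigma>"
  proof (rule sum_disjoint_intervals_le)
    fix x assume "x \<in> (\<Union>j\<in>X. {x \<in> P. fst x = j})"
    then obtain j a b where "x = (j, a, b)" "j \<in> X" "(j, a, b) \<in> P" by (cases x) auto
    then show "\<sigma> \<le> fst (snd x) \<and> fst (snd x) < snd (snd x) \<and> snd (snd x) \<le> t"
      using pieces_rel piece_le_completion assms(3) by fastforce
  next
    fix x y assume *: "x \<in> (\<Union>j\<in>X. {x \<in> P. fst x = j})" "y \<in> (\<Union>j\<in>X. {x \<in> P. fst x = j})" "x \<noteq> y"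
    obtain j a b j' a' b' where xy: "x = (j, a, b)" "y = (j', a', b')" by (cases x, cases y)
    show "snd (snd x) \<le> fst (snd y) \<or> snd (snd y) \<le> fst (snd x)"
      using * pieces_disjoint[of j a b j' a' b'] unfolding xy by simp
  qed (use finX pieces_finite assms(2) in auto)
  finally show ?thesis .
qed

text \<open>Summed over all jobs, this bounds the volume by the flow of \<open>P\<close>; charges of
  \<open>K\<close> times the volume are paid with it.\<close>

lemma proc_le_completion:
  assumes "j < length J"
  shows "proc J j \<le> completion P j - rel J j"
proof (cases "rel J j \<le> completion P j")
  case True
  then show ?thesis using preemptive_volume_le[of "{j}" "rel J j" "completion P j"] assms by simp
next
  case False
  have "{x \<in> P. fst x = j} \<noteq> {}" using pieces_sum[OF assms] proc_pos[OF assms] by force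
  then obtain a b where "(j, a, b) \<in> P" by auto
  with False pieces_rel piece_le_completion show ?thesis by fastforce
qed

end

text \<open>Abel summation against the decreasing weight \<open>1 / p\<close>: bounds on all prefix volumes give a
  bound on cardinalities.\<close>

lemma count_le_of_volume_le:
  fixes p c :: "'a \<Rightarrow> real"
  assumes fin: "finite I" and pos: "\<And>i. i \<in> I \<Longrightarrow> 0 < p i"
    and vol: "\<And>x. (\<Sum>i\<in>{i\<in>I. p i \<le> x}. p i * c i) \<le> D"
    and q: "0 < q" "\<And>i. i \<in> I \<Longrightarrow> p i < q \<Longrightarrow> c i \<le> 0" and D: "0 \<le> D"
  shows "(\<Sum>i\<in>I. c i) \<le> D / q"
proof -
  \<comment> \<open>The weight \<open>1 / p i - 1 / Y\<close> vanishes at size \<open>Y\<close>, so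
    \<open>Y\<close> can be lowered to the next occurring size without a boundary term.\<close>
  have G: "(\<Sum>i\<in>{i\<in>I. p i < Y}. p i * c i * (1 / p i - 1 / Y)) \<le> D * (1 / q - 1 / Y)"
    if "q \<le> Y" for Y
    using that
  proof (induction "card {i\<in>I. p i < Y}" arbitrary: Y rule: less_induct)
    case less
    show ?case
    proof (cases "\<exists>i\<in>I. q \<le> p i \<and> p i < Y")
      case False
      have "(\<Sum>i\<in>{i\<in>I. p i < Y}. p i * c i * (1 / p i - 1 / Y)) \<le> 0"
      proof (rule sum_nonpos)
        fix i assume i: "i \<in> {i\<in>I. p i < Y}"
        then have "c i \<le> 0" using False q(2)[of i] by force
        moreover have "0 \<le> 1 / p i - 1 / Y" using i pos[of i] by (auto intro!: divide_left_mono)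
        moreover have "p i * c i \<le> 0" using \<open>c i \<le> 0\<close> pos[of i] i by (simp add: mult_nonneg_nonpos)
        ultimately show "p i * c i * (1 / p i - 1 / Y) \<le> 0" by (simp add: mult_nonpos_nonneg)
      qed
      also have "\<dots> \<le> D * (1 / q - 1 / Y)"
        using less.prems q(1) D by (intro mult_nonneg_nonneg) (auto intro!: divide_left_mono)
      finally show ?thesis .
    next
      case True
      define X where "X = Max (p ` {i\<in>I. p i < Y})"
      have finS: "finite {i\<in>I. p i < Y}" using fin by simp
      have "X \<in> p ` {i\<in>I. p i < Y}"
        unfolding X_def by (rule Max_in) (use finS True in auto)
      then obtain i0 where i0: "i0 \<in> I" "p i0 < Y" "X = p i0" by auto
      have X_ge: "p i \<le> X" if "i \<in> I" "p i < Y" for i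
        unfolding X_def by (rule Max_ge) (use finS that in auto)
      have qX: "q \<le> X" using True X_ge by force
      have "X < Y" "0 < X" using i0 pos by auto
      have eq: "{i\<in>I. p i < Y} = {i\<in>I. p i \<le> X}" using X_ge i0 by auto
      have "card {i\<in>I. p i < X} < card {i\<in>I. p i < Y}"
        by (rule psubset_card_mono[OF finS]) (use i0 in auto)
      from less.hyps[OF this qX]
      have IH: "(\<Sum>i\<in>{i\<in>I. p i < X}. p i * c i * (1 / p i - 1 / X)) \<le> D * (1 / q - 1 / X)" .
      \<comment> \<open>The weight splits into \<open>1 / p i - 1 / X\<close>, left to the
        induction, and the constant \<open>1 / X - 1 / Y\<close>, which multiplies a prefix
        volume.\<close>
      have "(\<Sum>i\<in>{i\<in>I. p i < Y}. p i * c i * (1 / p i - 1 / Y))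
          = (\<Sum>i\<in>{i\<in>I. p i \<le> X}. p i * c i * (1 / p i - 1 / X))
            + (\<Sum>i\<in>{i\<in>I. p i \<le> X}. p i * c i) * (1 / X - 1 / Y)"
        unfolding eq sum_distrib_right sum.distrib[symmetric]
        by (rule sum.cong) (simp_all add: algebra_simps)
      also have "(\<Sum>i\<in>{i\<in>I. p i \<le> X}. p i * c i * (1 / p i - 1 / X))
          = (\<Sum>i\<in>{i\<in>I. p i < X}. p i * c i * (1 / p i - 1 / X))"
        by (rule sum.mono_neutral_right) (use fin in auto)
      also have "\<dots> + (\<Sum>i\<in>{i\<in>I. p i \<le> X}. p i * c i) * (1 / X - 1 / Y)
          \<le> D * (1 / q - 1 / X) + D * (1 / X - 1 / Y)"
        by (intro add_mono IH mult_right_mono vol)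
           (use \<open>X < Y\<close> \<open>0 < X\<close> in \<open>auto intro!: divide_left_mono\<close>)
      also have "\<dots> = D * (1 / q - 1 / Y)" by (simp add: algebra_simps)
      finally show ?thesis .
    qed
  qed
  define Y where "Y = Max (insert q (p ` I)) + 1"
  have Y: "q < Y" "\<And>i. i \<in> I \<Longrightarrow> p i < Y"
  proof -
    have le: "y \<le> Max (insert q (p ` I))" if "y \<in> insert q (p ` I)" for y
      by (rule Max_ge) (use fin that in auto)
    show "q < Y" using le[of q] unfolding Y_def by auto
    show "p i < Y" if "i \<in> I" for i using le[of "p i"] that unfolding Y_def by auto
  qed
  have eq: "{i\<in>I. p i < Y} = I" "{i\<in>I. p i \<le> Y} = I" using Y by (auto intro: less_imp_le)
  \<comment> \<open>Here 1 is written as \<open>p i * (1 / p i - 1 / Y) + p i / Y\<close>; the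
    second part adds up to a prefix volume, because \<open>Y\<close> exceeds all sizes.\<close>
  have "(\<Sum>i\<in>I. c i) = (\<Sum>i\<in>I. p i * c i * (1 / p i - 1 / Y)) + (\<Sum>i\<in>I. p i * c i) / Y"
    unfolding sum_divide_distrib sum.distrib[symmetric]
    by (rule sum.cong, simp, drule pos) (simp add: divide_simps, simp add: algebra_simps)
  also have "\<dots> \<le> D * (1 / q - 1 / Y) + D / Y"
    using G[of Y] vol[of Y] Y q(1) unfolding eq by (intro add_mono divide_right_mono) auto
  also have "\<dots> = D / q" by (simp add: algebra_simps)
  finally show ?thesis .
qed

section \<open>Decisions and runs\<close>

definition pend :: "jobs \<Rightarrow> real \<Rightarrow> (nat \<rightharpoonup> real) \<Rightarrow> nat set" where
  "pend J t S = {j. j < length J \<and> rel J j \<le> t \<and> j \<notin> dom S}"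

text \<open>Length of the part of the processing interval of \<open>i\<close> that lies after the
  release of \<open>j\<close>.\<close>

definition overlap :: "jobs \<Rightarrow> (nat \<rightharpoonup> real) \<Rightarrow> nat \<Rightarrow> nat \<Rightarrow> real" where
  "overlap J S j i = max 0 (the (S i) + proc J i - max (the (S i)) (rel J j))"

text \<open>Idle machine time since the release of \<open>j\<close>. Decisions are due only when all
  started jobs are completed, so each overlap lies entirely before \<open>t\<close>.\<close>

definition idle :: "jobs \<Rightarrow> real \<Rightarrow> (nat \<rightharpoonup> real) \<Rightarrow> nat \<Rightarrow> real" where
  "idle J t S j = t - rel J j - (\<Sum>i\<in>dom S. overlap J S j i)"

definition ripe :: "jobs \<Rightarrow> (nat \<Rightarrow> nat) \<Rightarrow> real \<Rightarrow> (nat \<rightharpoonup> real) \<Rightarrow> nat set" where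
  "ripe J U t S = {j \<in> pend J t S. real (U j) * proc J j \<le> idle J t S j}"

text \<open>Ties go to the smallest index, a choice that a left-to-right scan reproduces.\<close>

definition shortest :: "jobs \<Rightarrow> nat set \<Rightarrow> nat" where
  "shortest J A = (LEAST j. j \<in> A \<and> (\<forall>i\<in>A. proc J j \<le> proc J i))"

text \<open>While nothing is ripe, the waiting time does not depend on the thresholds \<open>U\<close>. Hence two runs
  whose thresholds differ only at a job \<open>j\<close> coincide until one of them starts \<open>j\<close>.\<close>

definition decide :: "jobs \<Rightarrow> nat \<Rightarrow> (nat \<Rightarrow> nat) \<Rightarrow> real \<Rightarrow> (nat \<rightharpoonup> real) \<Rightarrow> decision" where
  "decide J K U t S =
     (if K < card (pend J t S) then Start (shortest J (pend J t S))
      else if ripe J U t S \<noteq> {} then Start (LEAST j. j \<in> ripe J U t S)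
      else if pend J t S \<noteq> {} then WaitUntil (t + proc J (shortest J (pend J t S)))
      else Wait)"

lemma finite_pend [simp]: "finite (pend J t S)"
  by (simp add: pend_def)

lemma ripe_subset: "ripe J U t S \<subseteq> pend J t S"
  by (auto simp: ripe_def)

lemma Least_ripe: "ripe J U t S \<noteq> {} \<Longrightarrow> (LEAST j. j \<in> ripe J U t S) \<in> ripe J U t S"
  by (rule LeastI_ex) auto

lemma shortest:
  assumes "finite A" "A \<noteq> {}"
  shows "shortest J A \<in> A" "\<And>i. i \<in> A \<Longrightarrow> proc J (shortest J A) \<le> proc J i"
proof -
  have "\<exists>j. j \<in> A \<and> (\<forall>i\<in>A. proc J j \<le> proc J i)"
    using Min_in[of "proc J ` A"] Min_le[of "proc J ` A"] assms by fastforce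
  from LeastI_ex[OF this]
  show "shortest J A \<in> A" "\<And>i. i \<in> A \<Longrightarrow> proc J (shortest J A) \<le> proc J i"
    unfolding shortest_def by blast+
qed

section \<open>The run as an iterated map on pairs of time and start times\<close>

locale algorithm =
  fixes J :: jobs and K :: nat
  assumes valid: "valid_jobs J" and K_pos: "1 \<le> K"
begin

abbreviation "n \<equiv> length J"
abbreviation "r \<equiv> rel J"
abbreviation "p \<equiv> proc J"

lemma p_pos: "j < n \<Longrightarrow> 0 < p j"
  and r_nonneg: "j < n \<Longrightarrow> 0 \<le> r j"
  using valid unfolding valid_jobs_def by (metis nth_mem case_prod_beta)+

lemma pendD: "j \<in> pend J t S \<Longrightarrow> j < n \<and> r j \<le> t \<and> j \<notin> dom S"
  by (simp add: pend_def)

text \<open>One step of \<open>online_run\<close> as a total function, with finished states as fixed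
  points. Runs with different thresholds become sequences over the same step numbers and can be
  compared index by index.\<close>

definition advance :: "(nat \<Rightarrow> nat) \<Rightarrow> real \<times> (nat \<rightharpoonup> real) \<Rightarrow> real \<times> (nat \<rightharpoonup> real)" where
  "advance U = (\<lambda>(t, S). if dom S = {..<n} then (t, S) else
     (case decide J K U t S of
        Start j \<Rightarrow> (t + p j, S(j \<mapsto> t))
      | Wait \<Rightarrow> (Min (later_releases J t), S)
      | WaitUntil u \<Rightarrow> (Min (insert u (later_releases J t)), S)))"

definition state :: "(nat \<Rightarrow> nat) \<Rightarrow> nat \<Rightarrow> real \<times> (nat \<rightharpoonup> real)" where
  "state U m = (advance U ^^ m) (0, Map.empty)"

abbreviation "T U m \<equiv> fst (state U m)"
abbreviation "begun U m \<equiv> snd (state U m)"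
abbreviation "pending U m \<equiv> pend J (T U m) (begun U m)"
abbreviation "idling U m \<equiv> idle J (T U m) (begun U m)"

definition finished :: "(nat \<Rightarrow> nat) \<Rightarrow> nat \<Rightarrow> bool" where
  "finished U m \<longleftrightarrow> dom (begun U m) = {..<n}"

definition starts :: "(nat \<Rightarrow> nat) \<Rightarrow> nat \<Rightarrow> nat \<Rightarrow> bool" where
  "starts U m j \<longleftrightarrow> \<not> finished U m \<and> decide J K U (T U m) (begun U m) = Start j"

definition crowded :: "(nat \<Rightarrow> nat) \<Rightarrow> nat \<Rightarrow> bool" where
  "crowded U m \<longleftrightarrow> K < card (pending U m)"

lemma state_0 [simp]: "state U 0 = (0, Map.empty)"
  by (simp add: state_def)

lemma state_Suc: "state U (Suc m) = advance U (state U m)"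
  by (simp add: state_def)

lemma starts_pending: "starts U m j \<Longrightarrow> j \<in> pending U m"
  unfolding starts_def decide_def
  using shortest(1)[of "pending U m"] Least_ripe[of J U "T U m" "begun U m"] ripe_subset
  by (fastforce split: if_splits)

lemma starts_ripe: "starts U m j \<Longrightarrow> \<not> crowded U m \<Longrightarrow> real (U j) * p j \<le> idling U m j"
  unfolding starts_def crowded_def decide_def
  using Least_ripe[of J U "T U m" "begun U m"]
  by (auto split: if_splits simp: ripe_def)

lemma starts_shortest: "starts U m j \<Longrightarrow> crowded U m \<Longrightarrow> i \<in> pending U m \<Longrightarrow> p j \<le> p i"
  unfolding starts_def crowded_def decide_def
  using shortest(2)[of "pending U m"] by (auto split: if_splits)

lemma starts_Suc:
  assumes "starts U m j"
  shows "T U (Suc m) = T U m + p j" "begun U (Suc m) = (begun U m)(j \<mapsto> T U m)"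
  using assms unfolding starts_def finished_def state_Suc advance_def by (simp_all add: case_prod_beta)

lemma finished_Suc: "finished U m \<Longrightarrow> state U (Suc m) = state U m"
  unfolding finished_def state_Suc advance_def by (simp add: case_prod_beta)

lemma finite_later [simp]: "finite (later_releases J t)"
  by (simp add: later_releases_def)

text \<open>The case \<open>release\<close> merges \<open>Wait\<close> with a
  \<open>WaitUntil\<close> that is cut short by a release; for \<open>Wait\<close> its last fact is
  vacuous. The first two assumptions follow from the invariant \<open>consistent\<close>, whose
  preservation is proved with this lemma; \<open>transition\<close> then discharges them.\<close>

lemma transition_cases:
  assumes "dom (begun U m) \<subseteq> {..<n}" "\<forall>i\<in>dom (begun U m). r i \<le> T U m" "\<not> finished U m"
  obtains (start) j where "starts U m j"
  | (release) "\<nexists>j. starts U m j" "ripe J U (T U m) (begun U m) = {}" "\<not> crowded U m"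
      "begun U (Suc m) = begun U m"
      "T U (Suc m) = Min (later_releases J (T U m))" "later_releases J (T U m) \<noteq> {}"
      "\<And>j. j \<in> pending U m \<Longrightarrow> T U (Suc m) - T U m \<le> p j"
  | (wait) j where "\<nexists>j. starts U m j" "ripe J U (T U m) (begun U m) = {}" "\<not> crowded U m"
      "begun U (Suc m) = begun U m" "j \<in> pending U m"
      "T U (Suc m) = T U m + p j" "\<And>i. i \<in> pending U m \<Longrightarrow> p j \<le> p i"
      "\<And>i. i < n \<Longrightarrow> T U m < r i \<Longrightarrow> T U (Suc m) \<le> r i"
proof (cases "\<exists>j. starts U m j")
  case True
  then show ?thesis using start by blast
next
  case False
  let ?t = "T U m" and ?S = "begun U m"
  have ndone: "dom ?S \<noteq> {..<n}" using assms(3) by (simp add: finished_def)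
  from False assms(3) have nr: "ripe J U ?t ?S = {}" "\<not> crowded U m"
    unfolding starts_def crowded_def decide_def by (auto split: if_splits)
  show ?thesis
  proof (cases "pending U m = {}")
    case True
    have "decide J K U ?t ?S = Wait" using nr True by (simp add: decide_def)
    then have eq: "state U (Suc m) = (Min (later_releases J ?t), ?S)"
      using ndone by (simp add: state_Suc advance_def case_prod_beta)
    obtain i where "i < n" "i \<notin> dom ?S" using ndone assms(1) by blast
    then have "later_releases J ?t \<noteq> {}" using True by (force simp: pend_def later_releases_def)
    then show ?thesis using release False nr eq True by simp
  next
    case ne: False
    define j where "j = shortest J (pending U m)"
    have j: "j \<in> pending U m" "\<And>i. i \<in> pending U m \<Longrightarrow> p j \<le> p i"
      unfolding j_def using shortest[OF finite_pend ne] by auto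
    have "decide J K U ?t ?S = WaitUntil (?t + p j)"
      using nr ne by (simp add: decide_def crowded_def j_def)
    then have eq: "state U (Suc m) = (Min (insert (?t + p j) (later_releases J ?t)), ?S)"
      using ndone by (simp add: state_Suc advance_def case_prod_beta)
    show ?thesis
    proof (cases "\<exists>x\<in>later_releases J ?t. x < ?t + p j")
      case True
      then have "Min (later_releases J ?t) \<le> ?t + p j"
        by (meson Min_le finite_later less_imp_le order_trans)
      moreover have "later_releases J ?t \<noteq> {}" using True by auto
      ultimately have "T U (Suc m) = Min (later_releases J ?t)" "T U (Suc m) \<le> ?t + p j"
        using eq Min_insert[of "later_releases J ?t" "?t + p j"] by (simp_all add: min_absorb2)
      then show ?thesis using release False nr eq \<open>later_releases J ?t \<noteq> {}\<close> j(2) by fastforce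
    next
      case no: False
      then have "Min (insert (?t + p j) (later_releases J ?t)) = ?t + p j"
        by (intro Min_eqI) (auto simp: not_less)
      then have "T U (Suc m) = ?t + p j" "begun U (Suc m) = ?S" using eq by simp_all
      moreover have "?t + p j \<le> r i" if "i < n" "?t < r i" for i
      proof -
        have "r i \<in> later_releases J ?t" using that by (auto simp: later_releases_def)
        then show ?thesis using no by (simp add: not_less)
      qed
      ultimately show ?thesis using wait[of j] False nr j by simp
    qed
  qed
qed

text \<open>The last clause is the volume form of disjointness: everything begun from \<sigma> on is
  completed by \<open>t\<close>. It allows a run of the algorithm itself to act as the competing
  schedule in \<open>coupling\<close>.\<close>

definition consistent :: "real \<Rightarrow> (nat \<rightharpoonup> real) \<Rightarrow> bool" where
  "consistent t S \<longleftrightarrow> dom S \<subseteq> {..<n} \<and> 0 \<le> t \<and>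
     (\<forall>i\<in>dom S. r i \<le> the (S i) \<and> the (S i) + p i \<le> t) \<and>
     (\<forall>\<sigma>\<le>t. (\<Sum>i\<in>{i\<in>dom S. \<sigma> \<le> the (S i)}. p i) \<le> t - \<sigma>)"

lemma consistent_later:
  assumes "consistent t S" "t \<le> t'"
  shows "consistent t' S"
  unfolding consistent_def
proof (intro conjI allI impI)
  show "(\<Sum>i\<in>{i\<in>dom S. \<sigma> \<le> the (S i)}. p i) \<le> t' - \<sigma>" if "\<sigma> \<le> t'" for \<sigma>
  proof (cases "\<sigma> \<le> t")
    case True
    then have "(\<Sum>i\<in>{i\<in>dom S. \<sigma> \<le> the (S i)}. p i) \<le> t - \<sigma>"
      using assms(1) unfolding consistent_def by blast
    then show ?thesis using assms(2) by linarith
  next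
    case False
    have "the (S i) < \<sigma>" if "i \<in> dom S" for i
    proof -
      have "the (S i) + p i \<le> t" "i < n" using assms(1) that unfolding consistent_def by blast+
      then show ?thesis using p_pos[of i] False by linarith
    qed
    then have e: "{i\<in>dom S. \<sigma> \<le> the (S i)} = {}" by (auto simp: not_le)
    show ?thesis using that unfolding e by simp
  qed
next
  show "dom S \<subseteq> {..<n}" "0 \<le> t'" using assms by (auto simp: consistent_def)
  show "\<forall>i\<in>dom S. r i \<le> the (S i) \<and> the (S i) + p i \<le> t'"
    using assms unfolding consistent_def by (meson order_trans)
qed

lemma consistent_start:
  assumes "consistent t S" "j \<in> pend J t S"
  shows "consistent (t + p j) (S(j \<mapsto> t))"
proof -
  have j: "j < n" "r j \<le> t" "j \<notin> dom S" using pendD[OF assms(2)] by auto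
  have c: "dom S \<subseteq> {..<n}" "0 \<le> t" "\<And>i. i \<in> dom S \<Longrightarrow> r i \<le> the (S i) \<and> the (S i) + p i \<le> t"
    "\<And>\<sigma>. \<sigma> \<le> t \<Longrightarrow> (\<Sum>i\<in>{i\<in>dom S. \<sigma> \<le> the (S i)}. p i) \<le> t - \<sigma>"
    using assms(1) unfolding consistent_def by auto
  have pj: "0 < p j" using j p_pos by blast
  have fin: "finite (dom S)" using c(1) finite_subset by blast
  show ?thesis
    unfolding consistent_def
  proof (intro conjI allI impI ballI)
    fix i assume "i \<in> dom (S(j \<mapsto> t))"
    then show "r i \<le> the ((S(j \<mapsto> t)) i)" "the ((S(j \<mapsto> t)) i) + p i \<le> t + p j"
      using c(3)[of i] j pj by (force split: if_splits)+
  next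
    fix \<sigma> assume "\<sigma> \<le> t + p j"
    show "(\<Sum>i\<in>{i\<in>dom (S(j \<mapsto> t)). \<sigma> \<le> the ((S(j \<mapsto> t)) i)}. p i) \<le> t + p j - \<sigma>"
    proof (cases "\<sigma> \<le> t")
      case True
      have "{i\<in>dom (S(j \<mapsto> t)). \<sigma> \<le> the ((S(j \<mapsto> t)) i)} = insert j {i\<in>dom S. \<sigma> \<le> the (S i)}"
        using True j(3) by auto
      then show ?thesis using c(4)[OF True] j(3) fin by simp
    next
      case False
      have "the (S i) < \<sigma>" if "i \<in> dom S" for i
        using c(3)[OF that] p_pos[of i] c(1) that False by fastforce
      then have e: "{i\<in>dom (S(j \<mapsto> t)). \<sigma> \<le> the ((S(j \<mapsto> t)) i)} = {}"
        using False by (auto simp: not_le)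
      show ?thesis using \<open>\<sigma> \<le> t + p j\<close> unfolding e by simp
    qed
  qed (use c j pj in auto)
qed

lemma later_releases_Min: "later_releases J t \<noteq> {} \<Longrightarrow> t < Min (later_releases J t)"
  using Min_in[of "later_releases J t"] by (auto simp: later_releases_def)

lemma consistent_state: "consistent (T U m) (begun U m)"
proof (induction m)
  case 0
  show ?case by (simp add: consistent_def)
next
  case (Suc m)
  show ?case
  proof (cases "finished U m")
    case True
    then show ?thesis using Suc by (simp add: finished_Suc)
  next
    case False
    have c: "dom (begun U m) \<subseteq> {..<n}" "\<forall>i\<in>dom (begun U m). r i \<le> T U m"
    proof -
      show "dom (begun U m) \<subseteq> {..<n}" using Suc unfolding consistent_def by blast
      show "\<forall>i\<in>dom (begun U m). r i \<le> T U m"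
      proof
        fix i assume i: "i \<in> dom (begun U m)"
        then have "r i \<le> the (begun U m i) \<and> the (begun U m i) + p i \<le> T U m" "i < n"
          using Suc unfolding consistent_def by blast+
        then show "r i \<le> T U m" using p_pos[of i] by linarith
      qed
    qed
    from c False show ?thesis
    proof (cases rule: transition_cases)
      case (start j)
      show ?thesis using consistent_start[OF Suc starts_pending[OF start]]
        unfolding starts_Suc[OF start] .
    next
      case release
      have "T U m \<le> T U (Suc m)" using later_releases_Min[OF release(6)] release(5) by simp
      then show ?thesis using consistent_later[OF Suc] release(4) by simp
    next
      case (wait j)
      have "T U m \<le> T U (Suc m)" using p_pos[of j] pendD[OF wait(5)] wait(6) by simp
      then show ?thesis using consistent_later[OF Suc] wait(4) by simp
    qed
  qed
qed

lemma dom_begun: "dom (begun U m) \<subseteq> {..<n}"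
  and r_le_start: "i \<in> dom (begun U m) \<Longrightarrow> r i \<le> the (begun U m i)"
  and completed: "i \<in> dom (begun U m) \<Longrightarrow> the (begun U m i) + p i \<le> T U m"
  and started_volume_le: "\<sigma> \<le> T U m \<Longrightarrow> (\<Sum>i\<in>{i\<in>dom (begun U m). \<sigma> \<le> the (begun U m i)}. p i) \<le> T U m - \<sigma>"
  using consistent_state[of U m] unfolding consistent_def by blast+

lemma finite_dom [simp]: "finite (dom (begun U m))"
  using dom_begun finite_subset by blast

lemma started_before: "i \<in> dom (begun U m) \<Longrightarrow> the (begun U m i) < T U m"
proof -
  assume i: "i \<in> dom (begun U m)"
  then have "i < n" using dom_begun by blast
  then show ?thesis using completed[OF i] p_pos[of i] by linarith
qed

lemma started_released: "i \<in> dom (begun U m) \<Longrightarrow> r i \<le> T U m"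
  using started_before[of i U m] r_le_start[of i U m] by linarith

lemma transition:
  assumes "\<not> finished U m"
  obtains (start) j where "starts U m j"
  | (release) "\<nexists>j. starts U m j" "ripe J U (T U m) (begun U m) = {}" "\<not> crowded U m"
      "begun U (Suc m) = begun U m"
      "T U (Suc m) = Min (later_releases J (T U m))" "later_releases J (T U m) \<noteq> {}"
      "\<And>j. j \<in> pending U m \<Longrightarrow> T U (Suc m) - T U m \<le> p j"
  | (wait) j where "\<nexists>j. starts U m j" "ripe J U (T U m) (begun U m) = {}" "\<not> crowded U m"
      "begun U (Suc m) = begun U m" "j \<in> pending U m"
      "T U (Suc m) = T U m + p j" "\<And>i. i \<in> pending U m \<Longrightarrow> p j \<le> p i"
      "\<And>i. i < n \<Longrightarrow> T U m < r i \<Longrightarrow> T U (Suc m) \<le> r i"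
proof (rule transition_cases[OF dom_begun _ assms], goal_cases)
  case 1
  show ?case using started_released by blast
next
  case (2 j)
  show ?case by (rule start[OF 2(4)])
next
  case 3
  show ?case by (rule release[OF 3(4-10)])
next
  case (4 j)
  show ?case by (rule wait[OF 4(4-11)])
qed

lemma T_Suc_less: assumes "\<not> finished U m" shows "T U m < T U (Suc m)"
  using assms
proof (cases rule: transition)
  case (start j)
  then show ?thesis using starts_Suc(1)[OF start] p_pos[of j] pendD[OF starts_pending[OF start]] by simp
next
  case release
  then show ?thesis using later_releases_Min by simp
next
  case (wait j)
  then show ?thesis using p_pos[of j] pendD[of j] by simp
qed

lemma T_mono: "l \<le> m \<Longrightarrow> T U l \<le> T U m"
proof (induction m rule: dec_induct)
  case (step m)
  have "T U m \<le> T U (Suc m)"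
  proof (cases "finished U m")
    case True
    show ?thesis by (simp add: finished_Suc[OF True])
  next
    case False
    show ?thesis using T_Suc_less[OF False] by (rule less_imp_le)
  qed
  with step.IH show ?case by (rule order_trans)
qed simp

text \<open>Thus jobs that arrive in a waiting step arrive at its very end, and a forced run that
  begins after a wait begins without lag.\<close>

lemma no_release_while_waiting:
  assumes "\<nexists>j. starts U m j" "i < n" "T U m < r i"
  shows "T U (Suc m) \<le> r i"
proof (cases "finished U m")
  case True
  then show ?thesis using assms finished_Suc by simp
next
  case False
  then show ?thesis
  proof (cases rule: transition)
    case release
    have "r i \<in> later_releases J (T U m)" using assms by (auto simp: later_releases_def)
    then show ?thesis using Min_le[OF finite_later] release(5) by simp
  next
    case (start j)
    then show ?thesis using assms by blast
  next
    case (wait j)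
    then show ?thesis using assms by blast
  qed
qed

lemma begun_Suc_cases:
  obtains j where "starts U m j" | "\<nexists>j. starts U m j" "begun U (Suc m) = begun U m"
proof (cases "finished U m")
  case True
  then have "\<nexists>j. starts U m j" by (simp add: starts_def)
  then show ?thesis by (rule that(2)) (simp add: finished_Suc[OF True])
next
  case False
  then show ?thesis
  proof (cases rule: transition)
    case (start j)
    then show ?thesis by (rule that(1))
  next
    case release
    show ?thesis by (rule that(2)) fact+
  next
    case (wait j)
    show ?thesis by (rule that(2)) fact+
  qed
qed

lemma begun_extends_Suc: "i \<in> dom (begun U m) \<Longrightarrow> begun U (Suc m) i = begun U m i"
proof (cases rule: begun_Suc_cases[of U m])
  case (1 j)
  moreover assume "i \<in> dom (begun U m)"
  moreover have "j \<notin> dom (begun U m)" using starts_pending[OF 1] pendD by blast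
  ultimately show ?thesis by (auto simp: starts_Suc(2))
qed simp

lemma begun_extends: "l \<le> m \<Longrightarrow> i \<in> dom (begun U l) \<Longrightarrow> begun U m i = begun U l i"
proof (induction m rule: dec_induct)
  case (step m)
  then have "begun U m i = begun U l i" by blast
  moreover from this step.prems have "i \<in> dom (begun U m)" by (simp add: domIff)
  ultimately show ?case using begun_extends_Suc[of i U m] by simp
qed auto

lemma dom_mono: "l \<le> m \<Longrightarrow> dom (begun U l) \<subseteq> dom (begun U m)"
  using begun_extends by fastforce

lemma started_index:
  assumes "i \<in> dom (begun U m) - dom (begun U l)"
  shows "\<exists>k. l \<le> k \<and> k < m \<and> starts U k i"
  using assms
proof (induction m)
  case (Suc m)
  show ?case
  proof (cases "i \<in> dom (begun U m)")
    case True
    then obtain k where "l \<le> k" "k < m" "starts U k i" using Suc by blast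
    then show ?thesis using less_SucI by blast
  next
    case False
    then have "starts U m i"
    proof (cases rule: begun_Suc_cases[of U m])
      case (1 j)
      then show ?thesis using Suc.prems False by (auto simp: starts_Suc(2) split: if_splits)
    qed (use Suc.prems False in auto)
    moreover have "l \<le> m"
    proof (rule ccontr)
      assume "\<not> l \<le> m"
      then have "dom (begun U (Suc m)) \<subseteq> dom (begun U l)" by (intro dom_mono) simp
      then show False using Suc.prems by blast
    qed
    ultimately show ?thesis by blast
  qed
qed simp

lemma starts_start_time:
  assumes "starts U l j" "l < m"
  shows "begun U m j = Some (T U l)"
proof -
  have "begun U (Suc l) j = Some (T U l)" by (simp add: starts_Suc(2)[OF assms(1)])
  then show ?thesis using begun_extends[of "Suc l" m j U] assms(2) by (simp add: domI)
qed

lemma starts_pendingD: "starts U m j \<Longrightarrow> j < n \<and> j \<notin> dom (begun U m) \<and> r j \<le> T U m"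
  using starts_pending pendD by blast

lemma starts_unique: "starts U l j \<Longrightarrow> starts U m j \<Longrightarrow> l = m"
proof (induction l m rule: linorder_wlog)
  case (le l m)
  show ?case
  proof (rule ccontr)
    assume "l \<noteq> m"
    then have "begun U m j = Some (T U l)" using starts_start_time le by simp
    then show False using starts_pendingD[OF le(3)] by auto
  qed
qed simp

lemma starts_inj: "starts U m i \<Longrightarrow> starts U m j \<Longrightarrow> i = j"
  by (simp add: starts_def)

end

section \<open>Idle times, termination, and dependence on a single threshold\<close>

context algorithm
begin

lemma overlap_old:
  assumes "k \<in> dom (begun U m)" "T U m \<le> r j"
  shows "overlap J (begun U m) j k = 0"
  using completed[OF assms(1)] started_before[OF assms(1)] assms(2) unfolding overlap_def by linarith

lemma overlap_same_start:
  "S k = S' k \<Longrightarrow> overlap J S j k = overlap J S' j k"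
  by (simp add: overlap_def)

lemma idling_Suc_start:
  assumes "starts U m i"
  shows "idling U (Suc m) j = idling U m j + p i - max 0 (T U m + p i - max (T U m) (r j))"
proof -
  have i: "i \<notin> dom (begun U m)" using starts_pendingD[OF assms] by blast
  have "(\<Sum>k\<in>dom (begun U m). overlap J ((begun U m)(i \<mapsto> T U m)) j k)
      = (\<Sum>k\<in>dom (begun U m). overlap J (begun U m) j k)"
    by (rule sum.cong[OF refl], rule overlap_same_start) (use i in auto)
  moreover have "overlap J ((begun U m)(i \<mapsto> T U m)) j i = max 0 (T U m + p i - max (T U m) (r j))"
    by (simp add: overlap_def)
  ultimately show ?thesis
    unfolding starts_Suc[OF assms] idle_def using i by (simp add: algebra_simps)
qed

lemma idling_Suc_wait:
  "\<nexists>i. starts U m i \<Longrightarrow> idling U (Suc m) j = idling U m j + (T U (Suc m) - T U m)"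
  by (cases rule: begun_Suc_cases[of U m]) (auto simp: idle_def)

lemma idling_Suc_pending:
  assumes "r j \<le> T U m" "starts U m i"
  shows "idling U (Suc m) j = idling U m j"
proof -
  have "0 < p i" using starts_pendingD[OF assms(2)] p_pos by blast
  then show ?thesis unfolding idling_Suc_start[OF assms(2)] using assms(1) by (simp add: max_def)
qed

lemma idling_unreleased:
  "T U m \<le> r j \<Longrightarrow> idling U m j = T U m - r j"
  by (simp add: idle_def overlap_old)

text \<open>A release inside a step falls either into a busy interval, the rest of which does not
  count as idle, or on the end of a wait.\<close>

lemma idling_new:
  assumes "j < n" "T U m < r j" "r j \<le> T U (Suc m)"
  shows "idling U (Suc m) j = 0"
proof (cases rule: begun_Suc_cases[of U m])
  case (1 i)
  then show ?thesis
    using assms(2) assms(3)[unfolded starts_Suc(1)[OF 1]] idling_unreleased[of U m j]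
    unfolding idling_Suc_start[OF 1] by simp
next
  case 2
  then have "T U (Suc m) = r j" using no_release_while_waiting[OF 2(1) assms(1,2)] assms(3) by simp
  then show ?thesis using idling_unreleased[of U "Suc m" j] by simp
qed

lemma wait_le_proc:
  assumes "\<nexists>i. starts U m i" "j \<in> pending U m" "\<not> finished U m"
  shows "idling U m j < real (U j) * p j" "T U (Suc m) - T U m \<le> p j"
proof -
  have *: "ripe J U (T U m) (begun U m) = {} \<and> T U (Suc m) - T U m \<le> p j"
    using assms(3)
  proof (cases rule: transition)
    case (start i)
    then show ?thesis using assms by blast
  next
    case release
    then show ?thesis using assms by blast
  next
    case (wait i)
    show ?thesis using wait(2,6) wait(7)[OF assms(2)] by simp
  qed
  then show "T U (Suc m) - T U m \<le> p j" by blast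
  show "idling U m j < real (U j) * p j" using * assms(2) by (force simp: ripe_def not_le)
qed

lemma pending_finished: "finished U m \<Longrightarrow> pending U m = {}"
  by (auto simp: finished_def pend_def)

lemma pending_back: "j \<in> pending U (Suc m) \<Longrightarrow> r j \<le> T U m \<Longrightarrow> j \<in> pending U m"
  using dom_mono[of m "Suc m" U] by (auto simp: pend_def)

text \<open>Idle time grows only in waiting steps. Before such a step nothing is ripe, so the idle
  time of \<open>j\<close> is below its threshold, and the step lasts at most \<open>p j\<close>.
  Hence the overshoot is less than \<open>p j\<close>, even for a ripe job that is kept back by
  other starts.\<close>

lemma idling_bounds:
  "j \<in> pending U m \<Longrightarrow> 0 \<le> idling U m j \<and> idling U m j < (real (U j) + 1) * p j"
proof (induction m)
  case 0
  then have "r j = 0" "0 < p j" using pendD[OF 0] r_nonneg[of j] p_pos[of j] by auto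
  then show ?case by (simp add: idle_def)
next
  case (Suc m)
  have nf: "\<not> finished U m" using Suc.prems pending_finished[of U m] finished_Suc[of U m] by auto
  have j: "j < n" "r j \<le> T U (Suc m)" "0 < p j" using pendD[OF Suc.prems] p_pos by auto
  show ?case
  proof (cases "r j \<le> T U m")
    case True
    with Suc have jm: "j \<in> pending U m" and IH: "0 \<le> idling U m j" "idling U m j < (real (U j) + 1) * p j"
      using pending_back by blast+
    show ?thesis
    proof (cases "\<exists>i. starts U m i")
      case True
      then show ?thesis using IH idling_Suc_pending[OF \<open>r j \<le> T U m\<close>] by auto
    next
      case False
      have "idling U m j < real (U j) * p j" "T U (Suc m) - T U m \<le> p j"
        using wait_le_proc[OF False jm nf] by auto
      then show ?thesis using IH T_Suc_less[OF nf] idling_Suc_wait[OF False, of j]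
        by (simp add: algebra_simps)
    qed
  next
    case False
    then show ?thesis using idling_new[of j U m] j by simp
  qed
qed

text \<open>Number of full multiples of \<open>p j\<close> idled away since the release of
  \<open>j\<close>; starting \<open>j\<close> moves the gauge to its ceiling
  \<open>K\<close>.\<close>

definition gauge :: "(nat \<Rightarrow> nat) \<Rightarrow> nat \<Rightarrow> nat \<Rightarrow> nat" where
  "gauge U m j = (if j \<in> dom (begun U m) then K else if r j \<le> T U m then nat \<lfloor>idling U m j / p j\<rfloor> else 0)"

lemma idling_floor_less:
  assumes "U j < K" "j \<in> pending U m"
  shows "nat \<lfloor>idling U m j / p j\<rfloor> < K"
proof -
  have "0 < p j" using pendD[OF assms(2)] p_pos by blast
  have "idling U m j < real K * p j"
    using idling_bounds[OF assms(2)] assms(1) \<open>0 < p j\<close>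
    by (smt (verit) mult_right_mono of_nat_Suc of_nat_mono Suc_leI)
  then have "idling U m j / p j < real K" using \<open>0 < p j\<close> by (simp add: divide_less_eq)
  then show ?thesis using idling_bounds[OF assms(2)] \<open>0 < p j\<close> by (simp add: nat_less_iff floor_less_iff)
qed

lemma gauge_le: "U j < K \<Longrightarrow> j < n \<Longrightarrow> gauge U m j \<le> K"
  using idling_floor_less[of U j m] by (auto simp: gauge_def pend_def intro: less_imp_le)

lemma gauge_mono:
  assumes "U j < K" "j < n"
  shows "gauge U m j \<le> gauge U (Suc m) j"
proof (cases "j \<in> dom (begun U (Suc m)) \<or> finished U m \<or> \<not> r j \<le> T U m")
  case True
  then show ?thesis
    using gauge_le[of U j m, OF assms] dom_mono[of m "Suc m" U] finished_Suc[of U m]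
    by (auto simp: gauge_def)
next
  case False
  then have nd: "j \<notin> dom (begun U (Suc m))" "j \<notin> dom (begun U m)" and r: "r j \<le> T U m" "r j \<le> T U (Suc m)"
    using dom_mono[of m "Suc m" U] T_mono[of m "Suc m" U] by force+
  have "idling U m j \<le> idling U (Suc m) j"
    using idling_Suc_pending[OF r(1)] idling_Suc_wait[of U m j] T_mono[of m "Suc m" U]
    by (cases "\<exists>i. starts U m i") auto
  then have "idling U m j / p j \<le> idling U (Suc m) j / p j"
    using p_pos[OF assms(2)] by (simp add: divide_right_mono)
  then show ?thesis using nd r unfolding gauge_def by (simp add: nat_mono floor_mono)
qed

text \<open>Potential for termination: a step starts a job, passes a release, or waits out the full
  size of a pending job and so raises its gauge by one. The value is at most
  \<open>n * K + n\<close>, hence the choice of \<open>horizon\<close>.\<close>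

definition progress :: "(nat \<Rightarrow> nat) \<Rightarrow> nat \<Rightarrow> nat" where
  "progress U m = (\<Sum>j<n. gauge U m j) + (n - card (later_releases J (T U m)))"

lemma card_later_le: "card (later_releases J t) \<le> n"
proof -
  have "later_releases J t \<subseteq> r ` {..<n}" by (auto simp: later_releases_def)
  then have "card (later_releases J t) \<le> card (r ` {..<n})" by (intro card_mono) auto
  also have "\<dots> \<le> n" using card_image_le[of "{..<n}" r] by simp
  finally show ?thesis .
qed

lemma progress_less:
  assumes U: "\<And>j. U j < K" and nf: "\<not> finished U m"
  shows "progress U m < progress U (Suc m)"
proof -
  have sub: "later_releases J (T U (Suc m)) \<subseteq> later_releases J (T U m)"
    using T_Suc_less[OF nf] by (auto simp: later_releases_def)
  then have le: "card (later_releases J (T U (Suc m))) \<le> card (later_releases J (T U m))"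
    by (intro card_mono) auto
  have mono: "(\<Sum>j<n. gauge U m j) \<le> (\<Sum>j<n. gauge U (Suc m) j)"
    by (intro sum_mono gauge_mono U) simp
  have strict: "(\<Sum>j<n. gauge U m j) < (\<Sum>j<n. gauge U (Suc m) j)"
    if "j < n" "gauge U m j < gauge U (Suc m) j" for j
    by (rule sum_strict_mono_ex1) (use that U gauge_mono in auto)
  from nf show ?thesis
  proof (cases rule: transition)
    case (start j)
    have j: "j < n" "j \<in> pending U m" using starts_pending[OF start] pendD by blast+
    have "gauge U m j < K" using idling_floor_less[OF U j(2)] pendD[OF j(2)] by (simp add: gauge_def)
    moreover have "gauge U (Suc m) j = K" by (simp add: gauge_def starts_Suc(2)[OF start])
    ultimately have "(\<Sum>j<n. gauge U m j) < (\<Sum>j<n. gauge U (Suc m) j)" using strict j(1) by metis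
    then show ?thesis using le unfolding progress_def by linarith
  next
    case release
    have "Min (later_releases J (T U m)) \<in> later_releases J (T U m)"
      by (rule Min_in) (use release in auto)
    moreover have "Min (later_releases J (T U m)) \<notin> later_releases J (T U (Suc m))"
      using release(5) by (auto simp: later_releases_def)
    ultimately have "card (later_releases J (T U (Suc m))) < card (later_releases J (T U m))"
      using sub by (intro psubset_card_mono) auto
    then show ?thesis using mono card_later_le[of "T U m"] unfolding progress_def by linarith
  next
    case (wait j)
    have j: "j < n" "r j \<le> T U m" "j \<notin> dom (begun U m)" using pendD[OF wait(5)] by auto
    have pj: "0 < p j" using p_pos j by blast
    have "idling U (Suc m) j = idling U m j + p j" using idling_Suc_wait[OF wait(1)] wait(6) by simp
    then have "idling U (Suc m) j / p j = idling U m j / p j + 1" using pj by (simp add: field_simps)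
    moreover have "0 \<le> idling U m j / p j" using idling_bounds[OF wait(5)] pj by simp
    ultimately have "gauge U m j < gauge U (Suc m) j"
      using j T_Suc_less[OF nf] unfolding gauge_def wait(4) by (simp add: nat_add_distrib)
    then have "(\<Sum>j<n. gauge U m j) < (\<Sum>j<n. gauge U (Suc m) j)" using strict j(1) by metis
    then show ?thesis using le unfolding progress_def by linarith
  qed
qed

lemma finished_later: "finished U l \<Longrightarrow> l \<le> m \<Longrightarrow> finished U m"
  using dom_mono[of l m U] dom_begun[of U m] by (auto simp: finished_def)

abbreviation "horizon \<equiv> n * K + n + 1"

lemma finished_horizon:
  assumes U: "\<And>j. U j < K"
  shows "finished U horizon"
proof (rule ccontr)
  assume nf: "\<not> finished U horizon"
  have "m \<le> progress U m" if "m \<le> horizon" for m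
    using that
  proof (induction m)
    case (Suc m)
    then have "\<not> finished U m" using nf finished_later[of U m horizon] by auto
    from progress_less[OF U this] Suc show ?case by simp
  qed simp
  then have "horizon \<le> progress U horizon" by blast
  moreover have "(\<Sum>j<n. gauge U horizon j) \<le> (\<Sum>j<n. K)" by (intro sum_mono gauge_le U) simp
  ultimately show False unfolding progress_def by simp
qed

text \<open>Raising the threshold of \<open>j\<close> can remove only \<open>j\<close> from the ripe
  set. A least ripe job other than \<open>j\<close> therefore stays the least, and an empty ripe set
  stays empty.\<close>

lemma decide_coupled:
  assumes "\<And>i. i \<noteq> j \<Longrightarrow> U' i = U i" "U j \<le> U' j" "decide J K U t S \<noteq> Start j"
  shows "decide J K U' t S = decide J K U t S"
proof (cases "K < card (pend J t S)")
  case True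
  then show ?thesis by (simp add: decide_def)
next
  case False
  let ?R = "ripe J U t S" and ?R' = "ripe J U' t S"
  have sub: "?R' \<subseteq> ?R" and sup: "?R - {j} \<subseteq> ?R'"
  proof -
    show "?R' \<subseteq> ?R"
    proof
      fix i assume i: "i \<in> ?R'"
      then have "0 < p i" "real (U i) \<le> real (U' i)"
        using p_pos[of i] assms(1)[of i] assms(2) by (cases "i = j"; simp add: ripe_def pend_def)+
      then have "real (U i) * p i \<le> real (U' i) * p i" by (intro mult_right_mono) auto
      then show "i \<in> ?R" using i by (auto simp: ripe_def)
    qed
    show "?R - {j} \<subseteq> ?R'" using assms(1) by (auto simp: ripe_def)
  qed
  show ?thesis
  proof (cases "?R = {}")
    case True
    then show ?thesis using sub False by (simp add: decide_def)
  next
    case ne: False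
    define l where "l = (LEAST i. i \<in> ?R)"
    have "l \<in> ?R" unfolding l_def using ne by (intro Least_ripe)
    moreover have "l \<noteq> j" using assms(3) False ne by (simp add: decide_def l_def)
    ultimately have l: "l \<in> ?R'" using sup by blast
    have "(LEAST i. i \<in> ?R') = l"
      by (rule Least_equality) (use l sub in \<open>auto simp: l_def intro: Least_le\<close>)
    then show ?thesis using False ne l by (auto simp: decide_def l_def)
  qed
qed

lemma state_coupled:
  assumes "\<And>i. i \<noteq> j \<Longrightarrow> U' i = U i" "U j \<le> U' j" "\<And>l. l < b \<Longrightarrow> \<not> starts U l j"
  shows "state U' b = state U b"
  using assms(3)
proof (induction b)
  case (Suc b)
  then have IH: "state U' b = state U b" by simp
  have "\<not> starts U b j" using Suc.prems by simp
  then have "finished U b \<or> decide J K U' (T U b) (begun U b) = decide J K U (T U b) (begun U b)"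
    using decide_coupled[where j = j and U = U and U' = U', OF assms(1,2)] unfolding starts_def by blast
  then show ?case using IH unfolding finished_def state_Suc advance_def by (auto simp: case_prod_beta)
qed simp

end

section \<open>Comparison with a preemptive schedule\<close>

definition volume :: "jobs \<Rightarrow> nat set \<Rightarrow> real \<Rightarrow> real" where
  "volume J A x = (\<Sum>i\<in>{i\<in>A. proc J i \<le> x}. proc J i)"

section \<open>The lag of a forced run on jobs of bounded size\<close>

context algorithm
begin

abbreviation "vol \<equiv> volume J"

lemma vol_nonneg: "A \<subseteq> {..<n} \<Longrightarrow> 0 \<le> vol A x"
  unfolding volume_def by (rule sum_nonneg) (use p_pos in \<open>force intro: less_imp_le\<close>)

lemma sum_le_vol:
  assumes "A \<subseteq> {..<n}" "X \<subseteq> A" "\<And>i. i \<in> X \<Longrightarrow> p i \<le> x"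
  shows "sum p X \<le> vol A x"
  unfolding volume_def
proof (rule sum_mono2)
  show "finite {i \<in> A. p i \<le> x}" 
    by (rule finite_subset[of _ "{..<n}"]) (use assms(1) in auto)
  show "0 \<le> p i" if "i \<in> {i \<in> A. p i \<le> x} - X" for i using that assms(1) p_pos[of i] by force
qed (use assms in auto)

text \<open>The steps from \<open>a\<close> up to but excluding \<open>m\<close>; for
  \<open>a = m\<close> the run is empty.\<close>

definition forced_run :: "(nat \<Rightarrow> nat) \<Rightarrow> nat \<Rightarrow> nat \<Rightarrow> bool" where
  "forced_run U a m \<longleftrightarrow> a \<le> m \<and> (\<forall>l. a \<le> l \<longrightarrow> l < m \<longrightarrow> crowded U l \<and> (\<exists>j. starts U l j))"

lemma started_volume_eq:
  assumes "a \<le> m" "\<And>l. a \<le> l \<Longrightarrow> l < m \<Longrightarrow> \<exists>j. starts U l j"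
  shows "sum p (dom (begun U m) - dom (begun U a)) = T U m - T U a"
  using assms
proof (induction m rule: dec_induct)
  case (step m)
  then obtain j where j: "starts U m j" by auto
  have "j \<notin> dom (begun U m)" "dom (begun U a) \<subseteq> dom (begun U m)"
    using starts_pendingD[OF j] dom_mono step.hyps by blast+
  then have "dom (begun U (Suc m)) - dom (begun U a) = insert j (dom (begun U m) - dom (begun U a))"
    "j \<notin> dom (begun U m) - dom (begun U a)"
    unfolding starts_Suc(2)[OF j] by auto
  then show ?case using step starts_Suc(1)[OF j] by simp
qed simp

text \<open>The set \<open>C\<close> consists of the jobs that a competing schedule completes by time \<open>\<theta>\<close>. The lag behind
  it on jobs of size at most \<open>x\<close> grows only while a job larger than \<open>x\<close> is processed, and when such
  a job is started, no job of size at most \<open>x\<close> is pending.\<close>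

lemma forced_run_volume:
  assumes run: "forced_run U a m"
    and D: "\<And>l j. a \<le> l \<Longrightarrow> l < m \<Longrightarrow> starts U l j \<Longrightarrow> p j \<le> D"
    and \<theta>: "\<And>l. a \<le> l \<Longrightarrow> l < m \<Longrightarrow> T U l \<le> \<theta>"
    and C: "\<And>\<sigma> X. \<sigma> \<le> \<theta> \<Longrightarrow> X \<subseteq> C \<Longrightarrow> X \<subseteq> {..<n} \<Longrightarrow> (\<And>i. i \<in> X \<Longrightarrow> \<sigma> \<le> r i) \<Longrightarrow> sum p X \<le> \<theta> - \<sigma>"
    and R: "R \<subseteq> {..<n}" "\<And>i. i < n \<Longrightarrow> r i \<le> \<theta> \<Longrightarrow> i \<notin> C \<Longrightarrow> i \<in> R"
    and R_le: "vol R x + D \<le> B"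
    and base: "\<And>X. X \<subseteq> {..<n} - dom (begun U a) \<Longrightarrow> (\<And>i. i \<in> X \<Longrightarrow> r i \<le> \<theta> \<and> p i \<le> x) \<Longrightarrow>
      sum p X \<le> B + \<theta> - T U a"
  shows "vol {i. i < n \<and> r i \<le> \<theta> \<and> i \<notin> dom (begun U m)} x + (T U m - \<theta>) \<le> B"
proof -
  \<comment> \<open>Both uses of this lemma need a different \<theta>: it is either
    \<open>T U m\<close> or, in \<open>coupling\<close>, a time during the last job of the run. In
    the latter case \<open>T U m - \<theta>\<close> is what remains of that job.\<close>
  let ?H = "{i. i < n \<and> r i \<le> \<theta> \<and> i \<notin> dom (begun U m)}"
  have am: "a \<le> m" and st: "\<And>l. a \<le> l \<Longrightarrow> l < m \<Longrightarrow> \<exists>j. starts U l j"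
    and cr: "\<And>l. a \<le> l \<Longrightarrow> l < m \<Longrightarrow> crowded U l"
    using run unfolding forced_run_def by blast+
  have rel: "r i \<le> \<theta>" if i: "i \<in> dom (begun U m) - dom (begun U b)" and b: "a \<le> b" for i b
  proof -
    obtain k where "b \<le> k" "k < m" "starts U k i" using started_index[OF i] by blast
    then show ?thesis using starts_pendingD[of U k i] \<theta>[of k] b by auto
  qed
  define L where "L = {l. a \<le> l \<and> l < m \<and> (\<exists>g. starts U l g \<and> x < p g)}"
  have split: "vol ?H x + sum p St = sum p ({i\<in>?H. p i \<le> x} \<union> St)"
    if "St \<subseteq> dom (begun U m)" for St
    unfolding volume_def
    by (rule sum.union_disjoint[symmetric]) (use that finite_subset[OF that] in auto)
  show ?thesis
  proof (cases "L = {}")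
    case True
    \<comment> \<open>No job larger than \<open>x\<close> is started here, so no new lag arises: the
      work done and the work left are bounded together by \<open>base\<close>.\<close>
    define St where "St = dom (begun U m) - dom (begun U a)"
    have small: "p i \<le> x" if i: "i \<in> St" for i
    proof -
      obtain k where "a \<le> k" "k < m" "starts U k i" using started_index i unfolding St_def by blast
      then show ?thesis using True unfolding L_def by force
    qed
    have "sum p St = T U m - T U a"
      unfolding St_def by (rule started_volume_eq[OF am st])
    then have "vol ?H x + (T U m - T U a) = sum p ({i\<in>?H. p i \<le> x} \<union> St)"
      using split[of St] by (auto simp: St_def)
    also have "\<dots> \<le> B + \<theta> - T U a"
    proof (rule base)
      show "{i\<in>?H. p i \<le> x} \<union> St \<subseteq> {..<n} - dom (begun U a)"
        using dom_begun[of U m] dom_mono[OF am, of U] unfolding St_def by auto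
      show "r i \<le> \<theta> \<and> p i \<le> x" if "i \<in> {i\<in>?H. p i \<le> x} \<union> St" for i
        using that small[of i] rel[of i a] unfolding St_def by auto
    qed
    finally show ?thesis by simp
  next
    case False
    define l where "l = Max L"
    have finL: "finite L" unfolding L_def by auto
    have "l \<in> L" unfolding l_def by (rule Max_in[OF finL False])
    then obtain g where l: "a \<le> l" "l < m" and g: "starts U l g" "x < p g" unfolding L_def by blast
    have after: "p i \<le> x" if k: "l < k" "k < m" "starts U k i" for k i
    proof (rule ccontr)
      assume "\<not> p i \<le> x"
      then have "k \<in> L" using k l unfolding L_def by auto
      then have "k \<le> l" unfolding l_def by (rule Max_ge[OF finL])
      then show False using k by simp
    qed
    have late: "T U l \<le> r i" if "i < n" "p i \<le> x" "i \<notin> dom (begun U l)" for i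
    proof (rule ccontr)
      assume "\<not> T U l \<le> r i"
      then have "i \<in> pending U l" using that by (simp add: pend_def)
      then have "p g \<le> p i" using starts_shortest[OF g(1) cr[OF l]] by blast
      then show False using that g by simp
    qed
    define St where "St = dom (begun U m) - dom (begun U (Suc l))"
    have small: "p i \<le> x" if i: "i \<in> St" for i
    proof -
      obtain k where "Suc l \<le> k" "k < m" "starts U k i" using started_index i unfolding St_def by blast
      then show ?thesis using after[of k i] by simp
    qed
    \<comment> \<open>The small jobs that are left or were begun after step \<open>l\<close>. All
      are released from \<open>T U l\<close> on, so those in \<open>C\<close> fit into
      \<open>\<theta> - T U l\<close>. Of the time since \<open>T U l\<close>, the algorithm
      withheld only \<open>p g \<le> D\<close> from small jobs.\<close>
    define Z where "Z = {i\<in>?H. p i \<le> x} \<union> St"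
    have Z: "i < n \<and> p i \<le> x \<and> r i \<le> \<theta> \<and> T U l \<le> r i" if i: "i \<in> Z" for i
    proof -
      have "dom (begun U l) \<subseteq> dom (begun U (Suc l))" "dom (begun U (Suc l)) \<subseteq> dom (begun U m)"
        using l by (intro dom_mono; simp)+
      then have nd: "i \<notin> dom (begun U l)" using i unfolding Z_def St_def by blast
      have "i < n \<and> p i \<le> x \<and> r i \<le> \<theta>"
        using i small[of i] rel[of i "Suc l"] l dom_begun[of U m] unfolding Z_def St_def by auto
      then show ?thesis using late[OF _ _ nd] by blast
    qed
    have "sum p St = T U m - T U (Suc l)"
      unfolding St_def by (rule started_volume_eq) (use l st in auto)
    then have "vol ?H x + (T U m - T U (Suc l)) = sum p Z"
      using split[of St] by (auto simp: Z_def St_def)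
    also have "sum p Z = sum p (Z \<inter> C) + sum p (Z - C)"
      by (rule sum.Int_Diff) (use Z in \<open>auto intro: finite_subset[of _ "{..<n}"]\<close>)
    also have "\<dots> \<le> (\<theta> - T U l) + vol R x"
      by (intro add_mono C sum_le_vol) (use Z R \<theta>[OF l] in auto)
    finally show ?thesis
      using R_le D[OF l g(1)] unfolding starts_Suc(1)[OF g(1)] by linarith
  qed
qed

text \<open>\<open>count_le_of_volume_le\<close> for the signed indicator of pending jobs minus
  those of \<open>Q\<close> and \<open>R\<close>. The cut-off size is \<open>p k\<close>: a crowded
  start takes the shortest job, so nothing smaller is pending.\<close>

lemma crowded_count_le:
  assumes "starts U m k" "crowded U m" "0 \<le> D" "Q \<subseteq> {..<n}" "R \<subseteq> {..<n}"
    and vol: "\<And>x. vol (pending U m) x \<le> vol Q x + vol R x + D"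
  shows "real (card (pending U m)) \<le> card Q + card R + D / p k"
proof -
  define c where "c i = (if i \<in> pending U m then 1 else 0) - (if i \<in> Q then 1 else 0)
    - (if i \<in> R then 1 else 0 :: real)" for i
  have sub: "pending U m \<subseteq> {..<n}" using pendD by blast
  have card: "(\<Sum>i<n. if i \<in> A then 1 else 0 :: real) = card A" if "A \<subseteq> {..<n}" for A
    using that by (simp add: sum.If_cases Int_absorb1)
  have volc: "(\<Sum>i\<in>{i\<in>{..<n}. p i \<le> x}. if i \<in> A then p i else 0) = vol A x" if "A \<subseteq> {..<n}" for A x
    unfolding volume_def
    by (subst sum.inter_filter[symmetric]) (use that in \<open>auto intro!: sum.cong\<close>)
  have "(\<Sum>i<n. c i) \<le> D / p k"
  proof (rule count_le_of_volume_le)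
    fix x
    have "(\<Sum>i\<in>{i\<in>{..<n}. p i \<le> x}. p i * c i)
      = (\<Sum>i\<in>{i\<in>{..<n}. p i \<le> x}. (if i \<in> pending U m then p i else 0)
          - (if i \<in> Q then p i else 0) - (if i \<in> R then p i else 0))"
      by (rule sum.cong) (auto simp: c_def)
    also have "\<dots> = vol (pending U m) x - vol Q x - vol R x"
      by (simp only: sum_subtractf volc sub assms(4,5))
    also have "\<dots> \<le> D" using vol[of x] by linarith
    finally show "(\<Sum>i\<in>{i\<in>{..<n}. p i \<le> x}. p i * c i) \<le> D" .
  next
    show "0 < p k" using starts_pendingD[OF assms(1)] p_pos by blast
    show "c i \<le> 0" if "i \<in> {..<n}" "p i < p k" for i
      using starts_shortest[OF assms(1,2), of i] that by (auto simp: c_def)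
  qed (use p_pos assms(3) in auto)
  moreover have "(\<Sum>i<n. c i) = real (card (pending U m)) - real (card Q) - real (card R)"
    unfolding c_def sum_subtractf by (simp only: card sub assms(4,5))
  ultimately show ?thesis by linarith
qed

end

section \<open>The number of pending jobs at a forced start, against \<open>P\<close>\<close>

locale comparison = algorithm +
  fixes P :: pieces
  assumes sched: "preemptive_schedule J P"
begin

abbreviation "compl \<equiv> completion P"

definition open_jobs :: "real \<Rightarrow> nat set" where
  "open_jobs t = {i. i < n \<and> r i \<le> t \<and> t < compl i}"

lemma open_jobs_subset: "open_jobs t \<subseteq> {..<n}"
  by (auto simp: open_jobs_def)

text \<open>The set \<open>Q\<close> stands for jobs that are ignored in the comparison: the pending jobs are
  compared with those of \<open>P\<close> from time \<open>\<tau>\<close> on, starting from a deficit of \<open>Q\<close> and lag \<open>D\<close>.\<close>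

lemma forced_run_count:
  assumes run: "forced_run U a m" and k: "starts U m k" "crowded U m"
    and D: "\<And>l j. a \<le> l \<Longrightarrow> l < m \<Longrightarrow> starts U l j \<Longrightarrow> p j \<le> D" "0 \<le> D"
    and \<tau>: "\<tau> \<le> T U a" and H: "H \<subseteq> {..<n}"
    and old: "\<And>i. i < n \<Longrightarrow> i \<notin> dom (begun U a) \<Longrightarrow> i \<in> H \<or> \<tau> \<le> r i"
    and Q: "Q \<subseteq> {..<n}" "\<And>x. vol H x + (T U a - \<tau>) \<le> vol Q x + D"
  shows "real (card (pending U m)) \<le> card Q + card (open_jobs (T U m)) + D / p k"
proof (rule crowded_count_le[OF k D(2) Q(1) open_jobs_subset])
  fix x
  let ?R = "open_jobs (T U m)" and ?C = "{i. i < n \<and> compl i \<le> T U m}"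
  have am: "a \<le> m" using run by (simp add: forced_run_def)
  have C: "sum p X \<le> T U m - \<sigma>" if "\<sigma> \<le> T U m" "X \<subseteq> ?C" "\<And>i. i \<in> X \<Longrightarrow> \<sigma> \<le> r i" for \<sigma> X
    by (rule preemptive_volume_le[OF valid sched]) (use that in auto)
  have "vol {i. i < n \<and> r i \<le> T U m \<and> i \<notin> dom (begun U m)} x + (T U m - T U m)
      \<le> vol Q x + vol ?R x + D"
  proof (rule forced_run_volume[OF run D(1)])
    show "T U l \<le> T U m" if "a \<le> l" "l < m" for l using T_mono that by simp
    show "i \<in> ?R" if "i < n" "r i \<le> T U m" "i \<notin> ?C" for i using that by (auto simp: open_jobs_def)
    show "vol ?R x + D \<le> vol Q x + vol ?R x + D" using vol_nonneg[OF Q(1), of x] by simp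
  next
    fix X assume X: "X \<subseteq> {..<n} - dom (begun U a)" "\<And>i. i \<in> X \<Longrightarrow> r i \<le> T U m \<and> p i \<le> x"
    have fin: "finite X" using X(1) finite_subset by blast
    have "sum p X = sum p (X \<inter> H) + (sum p ((X - H) \<inter> ?C) + sum p (X - H - ?C))"
      using sum.Int_Diff[OF fin, of p H] sum.Int_Diff[of "X - H" p ?C] fin by simp
    \<comment> \<open>Jobs of \<open>H\<close> are conceded; of the others, released from \<tau> on,
      those that \<open>P\<close> has completed fit into the window from \<tau>, and the rest are
      open in \<open>P\<close>.\<close>
    also have "\<dots> \<le> vol H x + ((T U m - \<tau>) + vol ?R x)"
    proof (intro add_mono sum_le_vol C)
      show "\<tau> \<le> T U m" using \<tau> T_mono[OF am, of U] by linarith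
      show "\<tau> \<le> r i" if "i \<in> (X - H) \<inter> ?C" for i using that old[of i] X(1) by auto
    qed (use X H in \<open>auto simp: open_jobs_def\<close>)
    also have "\<dots> \<le> vol Q x + vol ?R x + D + T U m - T U a" using Q(2)[of x] by linarith
    finally show "sum p X \<le> vol Q x + vol ?R x + D + T U m - T U a" .
  qed (use C open_jobs_subset in auto)
  then show "vol (pending U m) x \<le> vol Q x + vol ?R x + D" unfolding pend_def by simp
qed

definition longest :: "(nat \<Rightarrow> nat) \<Rightarrow> real" where
  "longest U = Max (insert 0 (p ` {k. k < n \<and> (\<exists>m. starts U m k \<and> crowded U m)}))"

lemma longest_nonneg: "0 \<le> longest U"
  and le_longest: "starts U m k \<Longrightarrow> crowded U m \<Longrightarrow> p k \<le> longest U"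
proof -
  have fin: "finite (insert 0 (p ` {k. k < n \<and> (\<exists>m. starts U m k \<and> crowded U m)}))" by simp
  show "0 \<le> longest U" unfolding longest_def by (rule Max_ge[OF fin]) simp
  show "p k \<le> longest U" if "starts U m k" "crowded U m" unfolding longest_def
    by (rule Max_ge[OF fin]) (use that starts_pendingD in blast)
qed

text \<open>At the start of a forced job more than \<open>K\<close> jobs, none shorter than it, are
  pending.\<close>

lemma longest_volume: "real K * longest U \<le> (\<Sum>i<n. p i)"
proof -
  have "longest U \<in> insert 0 (p ` {k. k < n \<and> (\<exists>m. starts U m k \<and> crowded U m)})"
    unfolding longest_def by (rule Max_in) auto
  then consider "longest U = 0" | k m where "longest U = p k" "starts U m k" "crowded U m" by blast
  then show ?thesis
  proof cases
    case 1
    have "0 \<le> (\<Sum>i<n. p i)" by (intro sum_nonneg) (use p_pos in \<open>auto intro: less_imp_le\<close>)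
    then show ?thesis using 1 by simp
  next
    case 2
    have "p k \<ge> 0" using starts_pendingD[OF 2(2)] p_pos by (simp add: less_imp_le)
    have "real K * p k \<le> real (card (pending U m)) * p k"
      using 2(3) \<open>p k \<ge> 0\<close> by (intro mult_right_mono) (auto simp: crowded_def)
    also have "\<dots> = (\<Sum>i\<in>pending U m. p k)" by simp
    also have "\<dots> \<le> (\<Sum>i\<in>pending U m. p i)" by (intro sum_mono starts_shortest[OF 2(2,3)])
    also have "\<dots> \<le> (\<Sum>i<n. p i)"
      by (intro sum_mono2) (use pendD p_pos in \<open>auto intro: less_imp_le\<close>)
    finally show ?thesis using 2(1) by simp
  qed
qed

text \<open>The forced start of \<open>k\<close> belongs to a busy stretch that goes back to the
  unforced start of \<open>j\<close>. These are the cases in which a lag of \<open>p j\<close> has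
  to be added to \<open>longest U\<close>.\<close>

definition follows :: "(nat \<Rightarrow> nat) \<Rightarrow> nat \<Rightarrow> nat \<Rightarrow> nat \<Rightarrow> nat \<Rightarrow> bool" where
  "follows U b j m k \<longleftrightarrow> starts U b j \<and> \<not> crowded U b \<and> b < m \<and> forced_run U (Suc b) m \<and>
     starts U m k \<and> crowded U m"

text \<open>The maximal forced run ending at \<open>m\<close> is considered together with the step
  before it: there is none, or it is a wait, or it is an unforced start. Only the last leaves an
  additional lag. In every case at most \<open>K\<close> jobs are older than the comparison.\<close>

lemma crowded_start_cases:
  assumes k: "starts U m k" "crowded U m"
  obtains "real (card (pending U m)) \<le> K + card (open_jobs (T U m)) + longest U / p k"
  | b j where "follows U b j m k"
      "real (card (pending U m)) \<le> K + card (open_jobs (T U m)) + (longest U + p j) / p k"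
proof -
  define a where "a = (LEAST a. forced_run U a m)"
  have "forced_run U m m" by (simp add: forced_run_def)
  then have run: "forced_run U a m" unfolding a_def by (rule LeastI)
  have long: "p j \<le> longest U" if "a \<le> l" "l < m" "starts U l j" for l j
    using run that unfolding forced_run_def by (blast intro: le_longest)
  have pk: "0 < p k" using starts_pendingD[OF k(1)] p_pos by blast
  show ?thesis
  proof (cases a)
    case 0
    have "real (card (pending U m)) \<le> card ({} :: nat set) + card (open_jobs (T U m)) + longest U / p k"
      by (rule forced_run_count[OF run k, where \<tau> = 0 and H = "{}"])
        (use 0 long longest_nonneg r_nonneg in \<open>auto simp: volume_def\<close>)
    then show ?thesis using that(1) by simp
  next
    case (Suc b)
    have bm: "b < m" using run Suc by (simp add: forced_run_def)
    have "\<not> forced_run U b m" using not_less_Least[of b "\<lambda>a. forced_run U a m"] Suc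
      unfolding a_def by simp
    then have nb: "\<not> (crowded U b \<and> (\<exists>j. starts U b j))"
      using run bm unfolding forced_run_def Suc by (metis Suc_leI le_neq_implies_less less_imp_le)
    have nf: "\<not> finished U b" using finished_later[of U b m] bm k(1) by (auto simp: starts_def)
    have sub: "pending U b \<subseteq> {..<n}" using pendD by blast
    have old: "i \<in> pending U b \<or> T U b < r i" if "i < n" "i \<notin> dom (begun U b)" for i
      using that by (auto simp: pend_def)
    show ?thesis
    proof (cases "\<exists>j. starts U b j")
      case False
      have nc: "\<not> crowded U b" using nf by (cases rule: transition) (use False in auto)
      have "begun U (Suc b) = begun U b" by (cases rule: begun_Suc_cases[of U b]) (use False in auto)
      \<comment> \<open>The wait does not cross a release: an unstarted job is pending at step
        \<open>b\<close> or released from \<open>T U a\<close> on, so the initial lag is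
        zero.\<close>
      then have "real (card (pending U m)) \<le> card (pending U b) + card (open_jobs (T U m)) + longest U / p k"
        using no_release_while_waiting[OF False] old sub
        by (intro forced_run_count[OF run k, where \<tau> = "T U a" and H = "pending U b"])
          (use long longest_nonneg Suc in auto)
      then show ?thesis using that(1) nc by (simp add: crowded_def)
    next
      case True
      then obtain j where j: "starts U b j" by blast
      have nc: "\<not> crowded U b" using nb True by blast
      have fol: "follows U b j m k" using j nc bm run k unfolding follows_def Suc by blast
      have pj: "0 < p j" using starts_pendingD[OF j] p_pos by blast
      \<comment> \<open>While \<open>j\<close> runs, \<open>P\<close> may work on jobs released in
        the meantime. The comparison therefore begins at \<open>T U b\<close>, with the lag
        \<open>p j\<close>.\<close>
      have "real (card (pending U m))
          \<le> card (pending U b - {j}) + card (open_jobs (T U m)) + (longest U + p j) / p k"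
      proof (rule forced_run_count[OF run k, where \<tau> = "T U b" and H = "pending U b - {j}"])
        show "p i \<le> longest U + p j" if "a \<le> l" "l < m" "starts U l i" for l i
          using long[OF that] pj by simp
        show "i \<in> pending U b - {j} \<or> T U b \<le> r i" if "i < n" "i \<notin> dom (begun U a)" for i
          using that old[of i] unfolding Suc starts_Suc(2)[OF j] by (auto split: if_splits)
      qed (use sub pj longest_nonneg[of U] Suc starts_Suc(1)[OF j] in auto)
      moreover have "card (pending U b - {j}) \<le> K"
        using card_Diff1_le[of "pending U b" j] nc unfolding crowded_def by linarith
      ultimately show ?thesis using that(2)[OF fol] by linarith
    qed
  qed
qed

end

section \<open>Two runs that differ in one threshold; start times and delays\<close>

context algorithm
begin

lemma sum_p_nonneg: "X \<subseteq> {..<n} \<Longrightarrow> 0 \<le> sum p X"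
  by (rule sum_nonneg) (auto intro: less_imp_le p_pos)

lemma sum_p_mono:
  assumes "X \<subseteq> Y" "Y \<subseteq> {..<n}"
  shows "sum p X \<le> sum p Y"
proof (rule sum_mono2)
  show "finite Y" using assms(2) finite_subset by blast
  show "0 \<le> p i" if "i \<in> Y - X" for i
  proof -
    have "i < n" using that assms(2) by blast
    then show ?thesis using p_pos less_imp_le by blast
  qed
qed (rule assms(1))

lemma idling_diff:
  assumes "b \<le> m" "r j \<le> T U b"
  shows "idling U m j = idling U b j + (T U m - T U b) - sum p (dom (begun U m) - dom (begun U b))"
  using assms(1)
proof (induction m rule: dec_induct)
  case (step m)
  have rj: "r j \<le> T U m" using assms(2) T_mono[OF step.hyps(1), of U] by linarith
  show ?case
  proof (cases rule: begun_Suc_cases[of U m])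
    case (1 i)
    have "i \<notin> dom (begun U m)" "dom (begun U b) \<subseteq> dom (begun U m)"
      using starts_pendingD[OF 1] dom_mono[OF step.hyps(1)] by blast+
    then have "dom (begun U (Suc m)) - dom (begun U b) = insert i (dom (begun U m) - dom (begun U b))"
      "i \<notin> dom (begun U m) - dom (begun U b)"
      unfolding starts_Suc(2)[OF 1] by auto
    then show ?thesis using step.IH idling_Suc_pending[OF rj 1] starts_Suc(1)[OF 1] by simp
  next
    case 2
    then show ?thesis using step.IH idling_Suc_wait[OF 2(1), of j] by simp
  qed
qed simp

text \<open>The runs agree up to step \<open>b\<close>, where \<open>j\<close> has idled for less
  than \<open>(U j + 1) * p j\<close>. The second run starts \<open>j\<close> unforced, hence only
  after \<open>(U j + 2) * p j\<close> of idle time, so it idles for more than \<open>p j\<close> in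
  between. The gap of two absorbs the possible overshoot of the first threshold.\<close>

lemma coupled_idle:
  assumes other: "\<And>i. i \<noteq> j \<Longrightarrow> U' i = U i" and two: "U j + 2 \<le> U' j"
    and b: "starts U b j" and b': "starts U' b' j" "\<not> crowded U' b'"
  shows "state U' b = state U b" "b \<le> b'"
    and "sum p (dom (begun U' b') - dom (begun U b)) \<le> T U' b' - T U b - p j"
proof -
  have nst: "\<not> starts U l j" if "l < b" for l using starts_unique[OF b, of l] that by auto
  have eq: "state U' l = state U l" if "l \<le> b" for l
    by (rule state_coupled[where j = j]) (use other two nst that in auto)
  show e: "state U' b = state U b" using eq by simp
  have pj: "0 < p j" and rj: "r j \<le> T U b" using starts_pendingD[OF b] p_pos by auto
  show le: "b \<le> b'"
  proof (rule ccontr)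
    assume "\<not> b \<le> b'"
    then have "state U' b = state U b" "begun U' b j \<noteq> None"
      using eq starts_start_time[OF b'(1), of b] by auto
    then show False using starts_pendingD[OF b] by auto
  qed
  have "(real (U j) + 2) * p j \<le> real (U' j) * p j"
    using two pj by (intro mult_right_mono) auto
  also have "\<dots> \<le> idling U' b' j" by (rule starts_ripe[OF b'])
  also have "\<dots> = idling U' b j + (T U' b' - T U' b) - sum p (dom (begun U' b') - dom (begun U' b))"
    by (rule idling_diff[OF le]) (simp add: e rj)
  finally show "sum p (dom (begun U' b') - dom (begun U b)) \<le> T U' b' - T U b - p j"
    using idling_bounds[OF starts_pending[OF b]] unfolding e by (simp add: algebra_simps)
qed

definition start_index :: "(nat \<Rightarrow> nat) \<Rightarrow> nat \<Rightarrow> nat" where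
  "start_index U k = (THE m. starts U m k)"

definition start_time :: "(nat \<Rightarrow> nat) \<Rightarrow> nat \<Rightarrow> real" where
  "start_time U k = T U (start_index U k)"

lemma start_index_eq: "starts U m k \<Longrightarrow> start_index U k = m"
  unfolding start_index_def by (blast intro: the_equality dest: starts_unique)

context
  fixes U :: "nat \<Rightarrow> nat"
  assumes U_less: "\<And>j. U j < K"
begin

lemma starts_start_index:
  assumes "k < n"
  shows "starts U (start_index U k) k" "start_index U k < horizon"
proof -
  have "k \<in> dom (begun U horizon) - dom (begun U 0)"
    using finished_horizon[OF U_less] assms by (simp add: finished_def)
  from started_index[OF this] obtain m where "starts U m k" "m < horizon" by blast
  then show "starts U (start_index U k) k" "start_index U k < horizon"
    by (simp_all add: start_index_eq)
qed

lemma begun_start_time: "k < n \<Longrightarrow> start_index U k < m \<Longrightarrow> begun U m k = Some (start_time U k)"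
  unfolding start_time_def using starts_start_time starts_start_index by blast

lemma start_time_order:
  assumes "i < n" "k < n" "i \<noteq> k"
  shows "start_time U i + p i \<le> start_time U k \<or> start_time U k + p k \<le> start_time U i"
proof -
  have *: "start_time U i + p i \<le> start_time U k"
    if "i < n" "k < n" "start_index U i < start_index U k" for i k
    using completed[of i U "start_index U k"] begun_start_time[OF that(1,3)]
    by (auto simp: start_time_def)
  have "start_index U i \<noteq> start_index U k"
    using starts_start_index(1)[OF assms(1)] starts_start_index(1)[OF assms(2)] starts_inj assms(3) by metis
  then show ?thesis using *[of i k] *[of k i] assms by linarith
qed

lemma begun_iff:
  assumes "k < n" "i < n"
  shows "i \<in> dom (begun U (start_index U k)) \<longleftrightarrow> start_time U i < start_time U k"
proof
  assume "i \<in> dom (begun U (start_index U k))"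
  then obtain l where "l < start_index U k" "starts U l i"
    using started_index[of i U "start_index U k" 0] by auto
  then have "start_index U i < start_index U k" using start_index_eq by blast
  from begun_start_time[OF assms(2) this]
  show "start_time U i < start_time U k"
    using started_before[of i U "start_index U k"] by (auto simp: start_time_def)
next
  assume *: "start_time U i < start_time U k"
  have "start_index U i < start_index U k"
  proof (rule ccontr)
    assume "\<not> start_index U i < start_index U k"
    then show False using * T_mono[of "start_index U k" "start_index U i" U] by (simp add: start_time_def)
  qed
  then show "i \<in> dom (begun U (start_index U k))" using begun_start_time[OF assms(2)] by blast
qed

text \<open>All jobs except the one started last are completed by its start and so fit into the
  window; only that last job can stick out, by at most \<open>L\<close>.\<close>

lemma forced_window_le:
  assumes "X \<subseteq> {..<n}" "\<And>k. k \<in> X \<Longrightarrow> \<sigma> \<le> start_time U k \<and> start_time U k < t \<and> p k \<le> L"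
    "0 \<le> L" "\<sigma> \<le> t"
  shows "sum p X \<le> t - \<sigma> + L"
proof (cases "X = {}")
  case False
  have fin: "finite X" using assms(1) finite_subset by blast
  have "\<exists>k\<in>X. \<forall>i\<in>X. start_time U i \<le> start_time U k"
    using Max_in[of "start_time U ` X"] Max_ge[of "start_time U ` X"] fin False by fastforce
  then obtain l where l: "l \<in> X" "\<And>i. i \<in> X \<Longrightarrow> start_time U i \<le> start_time U l" by blast
  let ?m = "start_index U l"
  have ln: "l < n" using l assms(1) by auto
  have "sum p (X - {l}) \<le> (\<Sum>i\<in>{i\<in>dom (begun U ?m). \<sigma> \<le> the (begun U ?m i)}. p i)"
  proof (rule sum_p_mono)
    show "X - {l} \<subseteq> {i\<in>dom (begun U ?m). \<sigma> \<le> the (begun U ?m i)}"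
    proof
      fix i assume i: "i \<in> X - {l}"
      then have "i < n" using assms(1) by auto
      have "start_time U i < start_time U l"
        using start_time_order[OF \<open>i < n\<close> ln] l(2)[of i] i p_pos[of i] p_pos[of l] \<open>i < n\<close> ln
        by force
      then have d: "i \<in> dom (begun U ?m)" using begun_iff[OF ln \<open>i < n\<close>] by blast
      then obtain k where "k < ?m" "starts U k i" using started_index[of i U ?m 0] by auto
      then have "begun U ?m i = Some (start_time U i)"
        using begun_start_time[OF \<open>i < n\<close>] start_index_eq by blast
      then show "i \<in> {i\<in>dom (begun U ?m). \<sigma> \<le> the (begun U ?m i)}" using assms(2) i by auto
    qed
  qed (use dom_begun[of U ?m] in blast)
  also have "\<dots> \<le> start_time U l - \<sigma>"
    unfolding start_time_def by (rule started_volume_le) (use assms(2) l(1) in \<open>auto simp: start_time_def\<close>)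
  finally show ?thesis using assms(2)[OF l(1)] fin l(1) by (simp add: sum.remove)
qed (use assms in simp)

text \<open>The delay consists of idle time, below \<open>(U i + 1) * p i\<close>, and of busy time.
  The latter comes from jobs started during the delay and from the job running at the release of
  \<open>i\<close>, which is charged in full.\<close>

lemma start_delay_le:
  assumes i: "i < n"
  shows "start_time U i - r i \<le> real K * p i
    + (\<Sum>k<n. p k * (of_bool (r i \<le> start_time U k \<and> start_time U k < start_time U i)
        + of_bool (start_time U k < r i \<and> r i < start_time U k + p k)))"
    (is "_ \<le> _ + (\<Sum>k<n. ?g k)")
proof -
  let ?m = "start_index U i"
  have g: "0 \<le> ?g k" if "k < n" for k using p_pos[OF that] by simp
  have "(\<Sum>k\<in>dom (begun U ?m). overlap J (begun U ?m) i k) \<le> (\<Sum>k\<in>dom (begun U ?m). ?g k)"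
  proof (rule sum_mono)
    fix k assume k: "k \<in> dom (begun U ?m)"
    then have kn: "k < n" using dom_begun by blast
    obtain l where "l < ?m" "starts U l k" using started_index[of k U ?m 0] k by auto
    then have "begun U ?m k = Some (start_time U k)"
      using begun_start_time[OF kn] start_index_eq by blast
    moreover have "start_time U k < start_time U i" using begun_iff[OF i kn] k by blast
    ultimately show "overlap J (begun U ?m) i k \<le> ?g k"
      using p_pos[OF kn] unfolding overlap_def by (auto simp: max_def not_le)
  qed
  also have "\<dots> \<le> (\<Sum>k<n. ?g k)"
    by (rule sum_mono2) (use dom_begun g in auto)
  finally have "start_time U i - r i \<le> idling U ?m i + (\<Sum>k<n. ?g k)"
    unfolding idle_def start_time_def by simp
  moreover have "idling U ?m i \<le> real K * p i"
  proof -
    have "idling U ?m i \<le> (real (U i) + 1) * p i"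
      using idling_bounds[OF starts_pending[OF starts_start_index(1)[OF i]]] by simp
    also have "\<dots> \<le> real K * p i"
      using p_pos[OF i] U_less[of i] by (intro mult_right_mono) auto
    finally show ?thesis .
  qed
  ultimately show ?thesis by linarith
qed

end

end

section \<open>Few thresholds of \<open>j\<close> are harmful to a given job\<close>

context comparison
begin

text \<open>Let \<open>s < s'\<close> be the times at which \<open>j\<close> is started with thresholds \<open>U\<close> and \<open>U'\<close>. With \<open>U'\<close> the
  machine idles during \<open>[s, s']\<close> for at least \<open>p j\<close>, so at time \<open>s'\<close> the run with thresholds \<open>U\<close> has
  made up for the time lost on \<open>j\<close>.\<close>

lemma coupling:
  assumes other: "\<And>i. i \<noteq> j \<Longrightarrow> U' i = U i" and two: "U j + 2 \<le> U' j"
    and fol: "follows U b j m k"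
    and b': "starts U' b' j" "\<not> crowded U' b'" "T U' b' < r k"
  shows "real (card (pending U m)) \<le> K + card (open_jobs (T U m)) + longest U / p k"
proof -
  have b: "starts U b j" "b < m" and run: "forced_run U (Suc b) m" and k: "starts U m k" "crowded U m"
    using fol by (auto simp: follows_def)
  define s' where "s' = T U' b'"
  let ?Q = "pending U' b'"
  have Q: "?Q \<subseteq> {..<n}" using pendD by blast
  have eq: "state U' b = state U b" and bb': "b \<le> b'"
    and idle: "sum p (dom (begun U' b') - dom (begun U b)) \<le> s' - T U b - p j"
    using coupled_idle[OF other two b(1) b'(1,2)] unfolding s'_def by auto
  have "0 \<le> sum p (dom (begun U' b') - dom (begun U b))"
    by (rule sum_p_nonneg) (use dom_begun in blast)
  then have s'_ge: "T U (Suc b) \<le> s'" using idle starts_Suc(1)[OF b(1)] by linarith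
  have s'_less: "s' < T U m" using b'(3) starts_pendingD[OF k(1)] unfolding s'_def by linarith
  \<comment> \<open>The first decision after \<open>s'\<close> in the run with \<open>U\<close>. Up
    to \<open>s'\<close> the competitor is the run with \<open>U'\<close>, afterwards it is
    \<open>P\<close>.\<close>
  define a where "a = (LEAST a. s' < T U a)"
  have a: "s' < T U a" unfolding a_def by (rule LeastI) (rule s'_less)
  have am: "a \<le> m" unfolding a_def by (rule Least_le) (rule s'_less)
  have before: "T U l \<le> s'" if "l < a" for l
    using not_less_Least[of l "\<lambda>a. s' < T U a"] that unfolding a_def by simp
  have ba: "Suc b < a"
  proof (rule ccontr)
    assume "\<not> Suc b < a"
    then have "T U a \<le> T U (Suc b)" by (intro T_mono) simp
    then show False using a s'_ge by linarith
  qed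
  have run1: "forced_run U (Suc b) a" and run2: "forced_run U a m"
    using run am ba unfolding forced_run_def by auto
  have long: "p j \<le> longest U" if "Suc b \<le> l" "l < m" "starts U l j" for l j
    using run that unfolding forced_run_def by (blast intro: le_longest)
  define H where "H = {i. i < n \<and> r i \<le> s' \<and> i \<notin> dom (begun U a)}"
  have volH: "vol H x + (T U a - s') \<le> vol ?Q x + longest U" for x
    unfolding H_def
  \<comment> \<open>Step \<open>b'\<close> is a decision, so every job begun by then with
    \<open>U'\<close> is completed: these jobs form \<open>C\<close>, and the pending ones form
    \<open>R\<close>.\<close>
  proof (rule forced_run_volume[OF run1, where C = "dom (begun U' b')" and R = ?Q])
    fix \<sigma> X assume "\<sigma> \<le> s'" and X: "X \<subseteq> dom (begun U' b')" "\<And>i. i \<in> X \<Longrightarrow> \<sigma> \<le> r i"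
    have "sum p X \<le> (\<Sum>i\<in>{i\<in>dom (begun U' b'). \<sigma> \<le> the (begun U' b' i)}. p i)"
    proof (rule sum_p_mono)
      show "X \<subseteq> {i\<in>dom (begun U' b'). \<sigma> \<le> the (begun U' b' i)}"
        using X(1) order_trans[OF X(2) r_le_start[of _ U' b']] by blast
    qed (use dom_begun[of U' b'] in blast)
    also have "\<dots> \<le> s' - \<sigma>" using started_volume_le \<open>\<sigma> \<le> s'\<close> unfolding s'_def .
    finally show "sum p X \<le> s' - \<sigma>" .
  next
    fix X assume X: "X \<subseteq> {..<n} - dom (begun U (Suc b))" "\<And>i. i \<in> X \<Longrightarrow> r i \<le> s' \<and> p i \<le> x"
    have fin: "finite X" using X(1) finite_subset by blast
    have "sum p X = sum p (X \<inter> dom (begun U' b')) + sum p (X - dom (begun U' b'))"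
      by (rule sum.Int_Diff[OF fin])
    \<comment> \<open>The run with \<open>U'\<close> leaves at least \<open>p j\<close> of the time
      since \<open>T U b\<close> idle, which cancels the time that the run with \<open>U\<close>
      spends on \<open>j\<close>.\<close>
    also have "\<dots> \<le> sum p (dom (begun U' b') - dom (begun U b)) + vol ?Q x"
    proof (rule add_mono)
      show "sum p (X \<inter> dom (begun U' b')) \<le> sum p (dom (begun U' b') - dom (begun U b))"
      proof (rule sum_p_mono)
        show "X \<inter> dom (begun U' b') \<subseteq> dom (begun U' b') - dom (begun U b)"
          using X(1) dom_mono[of b "Suc b" U] by auto
      qed (use dom_begun[of U' b'] in blast)
      show "sum p (X - dom (begun U' b')) \<le> vol ?Q x"
        by (rule sum_le_vol[OF Q]) (use X in \<open>auto simp: pend_def s'_def\<close>)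
    qed
    also have "\<dots> \<le> vol ?Q x + longest U + s' - T U (Suc b)"
      using idle longest_nonneg[of U] starts_Suc(1)[OF b(1)] by linarith
    finally show "sum p X \<le> vol ?Q x + longest U + s' - T U (Suc b)" .
  next
    show "p i \<le> longest U" if "Suc b \<le> l" "l < a" "starts U l i" for l i
      using long[of l i] that am by simp
  qed (use before Q in \<open>auto simp: pend_def s'_def\<close>)
  \<comment> \<open>The jobs left at \<open>s'\<close> are measured by \<open>?Q\<close>, which has
    at most \<open>K\<close> elements because \<open>j\<close> is started unforced with
    \<open>U'\<close>.\<close>
  have "real (card (pending U m)) \<le> card ?Q + card (open_jobs (T U m)) + longest U / p k"
  proof (rule forced_run_count[OF run2 k, where H = H and \<tau> = s'])
    show "p i \<le> longest U" if "a \<le> l" "l < m" "starts U l i" for l i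
      using long[of l i] that ba by simp
  qed (use longest_nonneg a Q volH in \<open>auto simp: H_def\<close>)
  then show ?thesis using b'(2) unfolding crowded_def by linarith
qed

text \<open>Two ways in which an unforced start of \<open>j\<close> harms a job \<open>k\<close>
  released later: \<open>k\<close> arrives while \<open>j\<close> runs, or \<open>k\<close> is
  forced when the queue exceeds the bound without the lag \<open>p j\<close>. Jobs released by the
  start of \<open>j\<close> are left to \<open>unforced_pending\<close>.\<close>

definition bad :: "(nat \<Rightarrow> nat) \<Rightarrow> nat \<Rightarrow> nat \<Rightarrow> bool" where
  "bad U j k \<longleftrightarrow> (\<exists>b. starts U b j \<and> \<not> crowded U b \<and> T U b < r k \<and>
     (r k < T U b + p j \<or>
      (\<exists>m. follows U b j m k \<and>
        K + card (open_jobs (T U m)) + longest U / p k < real (card (pending U m)))))"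

text \<open>If both were bad, the run with \<open>U'\<close> would start \<open>j\<close> before the
  release of \<open>k\<close>. By that time the run with \<open>U\<close> has completed
  \<open>j\<close>, so \<open>k\<close> does not arrive during \<open>j\<close>, and
  \<open>coupling\<close> rules out an excessive queue.\<close>

lemma bad_coupled:
  assumes "\<And>i. i \<noteq> j \<Longrightarrow> U' i = U i" "U j + 2 \<le> U' j" "bad U j k"
  shows "\<not> bad U' j k"
proof
  assume "bad U' j k"
  then obtain b' where b': "starts U' b' j" "\<not> crowded U' b'" "T U' b' < r k" by (auto simp: bad_def)
  obtain b where b: "starts U b j"
    and cases: "r k < T U b + p j \<or> (\<exists>m. follows U b j m k \<and>
        K + card (open_jobs (T U m)) + longest U / p k < real (card (pending U m)))"
    using assms(3) by (auto simp: bad_def)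
  have "0 \<le> sum p (dom (begun U' b') - dom (begun U b))"
    by (rule sum_p_nonneg) (use dom_begun in blast)
  then have "T U b + p j \<le> T U' b'" using coupled_idle(3)[OF assms(1,2) b b'(1,2)] by linarith
  then obtain m where "follows U b j m k"
    "K + card (open_jobs (T U m)) + longest U / p k < real (card (pending U m))"
    using cases b'(3) by auto
  then show False using coupling[OF assms(1,2) _ b', of b m] by simp
qed

end

section \<open>Charging the delays of one run\<close>

context comparison
begin

context
  fixes U :: "nat \<Rightarrow> nat"
  assumes U_less: "\<And>j. U j < K"
begin

lemmas starts_start_index_U = starts_start_index[where U = U, OF U_less]
lemmas start_time_order_U = start_time_order[where U = U, OF U_less]
lemmas begun_start_time_U = begun_start_time[where U = U, OF U_less]
lemmas begun_iff_U = begun_iff[where U = U, OF U_less]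
lemmas forced_window_le_U = forced_window_le[where U = U, OF U_less]
lemmas start_delay_le_U = start_delay_le[where U = U, OF U_less]

abbreviation "s \<equiv> start_time U"
abbreviation "V \<equiv> sum p {..<n}"
abbreviation "L \<equiv> longest U"
abbreviation "F \<equiv> total_flow J compl"

definition waiting :: "nat \<Rightarrow> nat set" where
  "waiting k = {i. i < n \<and> r i \<le> s k \<and> s k < s i}"

definition arriving :: "nat \<Rightarrow> nat set" where
  "arriving k = {i. i < n \<and> s k < r i \<and> r i < s k + p k}"

definition forced :: "nat \<Rightarrow> bool" where
  "forced k \<longleftrightarrow> crowded U (start_index U k)"

lemma card_waiting_le: "k < n \<Longrightarrow> card (waiting k) \<le> card (pending U (start_index U k))"
proof (rule card_mono)
  assume k: "k < n"
  show "waiting k \<subseteq> pending U (start_index U k)"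
  proof
    fix i assume i: "i \<in> waiting k"
    then have "i \<notin> dom (begun U (start_index U k))"
      using begun_iff_U[OF k, of i] by (auto simp: waiting_def)
    then show "i \<in> pending U (start_index U k)"
      using i unfolding waiting_def pend_def start_time_def by simp
  qed
qed simp

lemma card_sum_of_bool: "(\<Sum>i<n. of_bool (Q i)) = real (card {i. i < n \<and> Q i})"
  by (simp add: of_bool_def sum.If_cases Int_def)

lemma forced_p_le: "k < n \<Longrightarrow> forced k \<Longrightarrow> p k \<le> L"
  using le_longest starts_start_index_U(1) unfolding forced_def by blast

text \<open>An unforced job starts with at most \<open>K\<close> jobs pending, and each arrival
  during its processing is bad by the first alternative.\<close>

lemma unforced_cost:
  assumes "k < n" "\<not> forced k"
  shows "p k * (real (card (waiting k)) + real (card (arriving k)))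
    \<le> real K * p k + (\<Sum>i<n. p k * of_bool (bad U k i))"
proof -
  have st: "starts U (start_index U k) k" using starts_start_index_U(1)[OF assms(1)] .
  have pk: "0 < p k" using p_pos assms(1) by blast
  have "real (card (waiting k)) \<le> K"
    using card_waiting_le[OF assms(1)] assms(2) unfolding forced_def crowded_def by linarith
  moreover have "arriving k \<subseteq> {i. i < n \<and> bad U k i}"
    using st assms(2) unfolding arriving_def bad_def forced_def start_time_def by blast
  then have "real (card (arriving k)) \<le> (\<Sum>i<n. of_bool (bad U k i))"
    unfolding card_sum_of_bool by (intro of_nat_mono card_mono) auto
  ultimately have "p k * (real (card (waiting k)) + real (card (arriving k)))
      \<le> p k * (K + (\<Sum>i<n. of_bool (bad U k i)))"
    using pk by (intro mult_left_mono add_mono) auto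
  then show ?thesis by (simp add: algebra_simps sum_distrib_left)
qed

text \<open>After exchanging the sums: a job arrives in the interior of at most one processing
  interval, and a forced one has length at most \<open>L\<close>.\<close>

lemma forced_arriving_cost:
  "(\<Sum>k\<in>{k\<in>{..<n}. forced k}. p k * real (card (arriving k))) \<le> real n * L"
proof -
  have "(\<Sum>k\<in>{k\<in>{..<n}. forced k}. p k * real (card (arriving k)))
      = (\<Sum>k\<in>{k\<in>{..<n}. forced k}. \<Sum>i<n. if i \<in> arriving k then p k else 0)"
    by (rule sum.cong[OF refl]) (simp add: sum.If_cases arriving_def Int_def mult.commute)
  also have "\<dots> = (\<Sum>i<n. \<Sum>k\<in>{k\<in>{..<n}. forced k}. if i \<in> arriving k then p k else 0)"
    by (rule sum.swap)
  also have "\<dots> \<le> (\<Sum>i<n. L)"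
  proof (rule sum_mono)
    fix i
    define X where "X = {k. k < n \<and> forced k \<and> i \<in> arriving k}"
    have unique: "k = l" if "k \<in> X" "l \<in> X" for k l
      using start_time_order_U[ of k l] that unfolding X_def arriving_def by force
    have "(\<Sum>k\<in>{k\<in>{..<n}. forced k}. if i \<in> arriving k then p k else 0) = sum p X"
      unfolding X_def by (subst sum.inter_filter[symmetric]) (auto intro!: sum.cong)
    also have "\<dots> \<le> L"
    proof (cases "X = {}")
      case False
      then obtain k where "k \<in> X" by blast
      then have "X = {k}" using unique by blast
      then show ?thesis using forced_p_le \<open>k \<in> X\<close> unfolding X_def by auto
    qed (simp add: longest_nonneg)
    finally show "(\<Sum>k\<in>{k\<in>{..<n}. forced k}. if i \<in> arriving k then p k else 0) \<le> L" .
  qed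
  finally show ?thesis by simp
qed

text \<open>After exchanging the sums: the forced jobs started while \<open>i\<close> is open in
  \<open>P\<close> fill at most its flow interval, plus \<open>L\<close> for the last of
  them.\<close>

lemma forced_open_cost:
  "(\<Sum>k\<in>{k\<in>{..<n}. forced k}. p k * real (card (open_jobs (s k)))) \<le> F + real n * L"
proof -
  have "(\<Sum>k\<in>{k\<in>{..<n}. forced k}. p k * real (card (open_jobs (s k))))
      = (\<Sum>k\<in>{k\<in>{..<n}. forced k}. \<Sum>i<n. if i \<in> open_jobs (s k) then p k else 0)"
    by (rule sum.cong[OF refl]) (simp add: sum.If_cases open_jobs_def Int_def mult.commute)
  also have "\<dots> = (\<Sum>i<n. \<Sum>k\<in>{k\<in>{..<n}. forced k}. if i \<in> open_jobs (s k) then p k else 0)"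
    by (rule sum.swap)
  also have "\<dots> \<le> (\<Sum>i<n. (compl i - r i) + L)"
  proof (rule sum_mono)
    fix i assume i: "i \<in> {..<n}"
    define X where "X = {k. k < n \<and> forced k \<and> i \<in> open_jobs (s k)}"
    have "(\<Sum>k\<in>{k\<in>{..<n}. forced k}. if i \<in> open_jobs (s k) then p k else 0) = sum p X"
      unfolding X_def by (subst sum.inter_filter[symmetric]) (auto intro!: sum.cong)
    also have "\<dots> \<le> compl i - r i + L"
    proof (rule forced_window_le_U)
      show "r i \<le> s k \<and> s k < compl i \<and> p k \<le> L" if "k \<in> X" for k
        using that forced_p_le unfolding X_def open_jobs_def by auto
      show "r i \<le> compl i"
        using proc_le_completion[OF valid sched, of i] p_pos[of i] i by auto
    qed (auto simp: X_def longest_nonneg)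
    finally show "(\<Sum>k\<in>{k\<in>{..<n}. forced k}. if i \<in> open_jobs (s k) then p k else 0)
      \<le> compl i - r i + L" .
  qed
  also have "\<dots> = F + real n * L" by (simp add: sum.distrib total_flow_def)
  finally show ?thesis .
qed

definition unforced_pending :: "nat \<Rightarrow> nat set" where
  "unforced_pending j = (if forced j then {} else pending U (start_index U j))"

lemma card_unforced_pending: "card (unforced_pending j) \<le> K"
  unfolding unforced_pending_def forced_def crowded_def by simp

text \<open>The factor \<open>p k\<close> turns the terms \<open>L / p k\<close> and
  \<open>p j / p k\<close> into \<open>L\<close> and \<open>p j\<close>. The amount
  \<open>p j\<close> is charged to the pair of \<open>j\<close> and \<open>k\<close>: it is bad if
  \<open>k\<close> is released after the start of \<open>j\<close>; otherwise \<open>k\<close> was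
  pending at that start, which happens for at most \<open>K\<close> jobs \<open>k\<close> per
  \<open>j\<close>.\<close>

lemma forced_waiting_cost:
  assumes "k < n" "forced k"
  shows "p k * real (card (waiting k)) \<le> real K * p k + p k * real (card (open_jobs (s k))) + L
    + (\<Sum>j<n. p j * (of_bool (bad U j k) + of_bool (k \<in> unforced_pending j)))"
    (is "_ \<le> _ + ?S")
proof -
  define m where "m = start_index U k"
  have k: "starts U m k" "crowded U m"
    using starts_start_index_U(1)[OF assms(1)] assms(2) unfolding m_def forced_def by auto
  have pk: "0 < p k" using p_pos assms(1) by blast
  have sk: "s k = T U m" unfolding start_time_def m_def ..
  have S: "0 \<le> ?S" by (intro sum_nonneg) (use p_pos in \<open>auto intro: less_imp_le\<close>)
  let ?N = "real (card (pending U m))" and ?O = "real (card (open_jobs (T U m)))"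
  have "p k * real (card (waiting k)) \<le> p k * ?N"
    using card_waiting_le[OF assms(1)] pk unfolding m_def by simp
  also have "\<dots> \<le> real K * p k + p k * ?O + L + ?S"
  proof (cases "?N \<le> K + ?O + L / p k")
    case True
    then have "p k * ?N \<le> p k * (K + ?O + L / p k)" using pk by simp
    also have "\<dots> = real K * p k + p k * ?O + L" using pk by (simp add: field_simps)
    finally show ?thesis using S by linarith
  next
    case False
    from k show ?thesis
    proof (cases rule: crowded_start_cases)
      case 1
      then show ?thesis using False by simp
    next
      case (2 b j)
      then have b: "starts U b j" "\<not> crowded U b" "b < m" by (auto simp: follows_def)
      have j: "j < n" "start_index U j = b" using starts_pendingD[OF b(1)] start_index_eq[OF b(1)] by auto
      have "bad U j k \<or> k \<in> unforced_pending j"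
      proof (cases "T U b < r k")
        case True
        have "bad U j k"
          unfolding bad_def using b True 2(1) False by (auto simp: not_le)
        then show ?thesis ..
      next
        case f: False
        have "k \<notin> dom (begun U b)"
          using dom_mono[of b m U] b(3) starts_pendingD[OF k(1)] by auto
        then have "k \<in> pending U b" using f assms(1) by (simp add: pend_def)
        then show ?thesis using b(2) j(2) by (simp add: unforced_pending_def forced_def)
      qed
      then have "p j \<le> p j * (of_bool (bad U j k) + of_bool (k \<in> unforced_pending j))"
        using p_pos[OF j(1)] by auto
      also have "\<dots> \<le> ?S"
        by (rule member_le_sum[where f = "\<lambda>j. p j * (of_bool (bad U j k) + of_bool (k \<in> unforced_pending j))"])
          (use j(1) p_pos in \<open>auto intro: less_imp_le\<close>)
      finally have pj: "p j \<le> ?S" .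
      have "p k * ?N \<le> p k * (K + ?O + (L + p j) / p k)" using 2(2) pk by simp
      also have "\<dots> = real K * p k + p k * ?O + L + p j" using pk by (simp add: field_simps)
      finally show ?thesis using pj by linarith
    qed
  qed
  finally show ?thesis unfolding sk .
qed

text \<open>The three terms \<open>K * V\<close> come from idle time, from queues of
  \<open>K\<close> jobs at the starts, and from \<open>unforced_pending\<close>. The three terms
  \<open>n * L\<close> come from open jobs, from arrivals during forced jobs, and from the lag at
  forced starts. The bad pairs count twice: for arrivals during unforced jobs and for the lag they
  cause.\<close>

lemma total_delay_le:
  "(\<Sum>i<n. s i - r i) \<le> 3 * real K * V + F + 3 * real n * L
     + 2 * (\<Sum>j<n. \<Sum>k<n. p j * of_bool (bad U j k))"
proof -
  let ?Fd = "{k\<in>{..<n}. forced k}" and ?Ud = "{k\<in>{..<n}. \<not> forced k}"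
  let ?B = "\<Sum>j<n. \<Sum>k<n. p j * of_bool (bad U j k)"
  have split: "sum f {..<n} = sum f ?Fd + sum f ?Ud" for f :: "nat \<Rightarrow> real"
    by (subst sum.union_disjoint[symmetric]) (auto intro: sum.cong)
  have p0: "0 \<le> p k" if "k < n" for k using p_pos[OF that] by simp
  have "(\<Sum>i<n. s i - r i) \<le> (\<Sum>i<n. real K * p i + (\<Sum>k<n. p k * (of_bool (i \<in> waiting k) + of_bool (i \<in> arriving k))))"
  proof (rule sum_mono)
    fix i assume "i \<in> {..<n}"
    then show "s i - r i \<le> real K * p i + (\<Sum>k<n. p k * (of_bool (i \<in> waiting k) + of_bool (i \<in> arriving k)))"
      using start_delay_le_U[ of i] by (simp add: waiting_def arriving_def)
  qed
  \<comment> \<open>The sums are exchanged, from the jobs that delay \<open>i\<close> to the jobs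
    that \<open>k\<close> delays.\<close>
  also have "\<dots> = real K * V + (\<Sum>k<n. \<Sum>i<n. p k * (of_bool (i \<in> waiting k) + of_bool (i \<in> arriving k)))"
    unfolding sum.distrib by (subst sum.swap) (simp add: sum_distrib_left)
  also have "(\<Sum>k<n. \<Sum>i<n. p k * (of_bool (i \<in> waiting k) + of_bool (i \<in> arriving k)))
      = (\<Sum>k<n. p k * (real (card (waiting k)) + real (card (arriving k))))"
  proof (rule sum.cong[OF refl])
    fix k
    have "{i. i < n \<and> i \<in> waiting k} = waiting k" "{i. i < n \<and> i \<in> arriving k} = arriving k"
      by (auto simp: waiting_def arriving_def)
    then show "(\<Sum>i<n. p k * (of_bool (i \<in> waiting k) + of_bool (i \<in> arriving k)))
      = p k * (real (card (waiting k)) + real (card (arriving k)))"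
      by (simp only: sum_distrib_left[symmetric] sum.distrib card_sum_of_bool)
  qed
  also have "\<dots> = (\<Sum>k\<in>?Fd. p k * real (card (waiting k))) + (\<Sum>k\<in>?Fd. p k * real (card (arriving k)))
      + (\<Sum>k\<in>?Ud. p k * (real (card (waiting k)) + real (card (arriving k))))"
    unfolding split by (simp add: sum.distrib distrib_left)
  also have "(\<Sum>k\<in>?Ud. p k * (real (card (waiting k)) + real (card (arriving k))))
      \<le> (\<Sum>k\<in>?Ud. real K * p k) + (\<Sum>k\<in>?Ud. \<Sum>i<n. p k * of_bool (bad U k i))"
    unfolding sum.distrib[symmetric] by (rule sum_mono) (use unforced_cost in auto)
  also have "(\<Sum>k\<in>?Ud. \<Sum>i<n. p k * of_bool (bad U k i)) \<le> ?B"
    by (rule sum_mono2) (use p0 in \<open>auto intro!: sum_nonneg\<close>)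
  also have "(\<Sum>k\<in>?Fd. p k * real (card (waiting k)))
      \<le> (\<Sum>k\<in>?Fd. real K * p k) + (\<Sum>k\<in>?Fd. p k * real (card (open_jobs (s k)))) + (\<Sum>k\<in>?Fd. L)
        + (\<Sum>k\<in>?Fd. \<Sum>j<n. p j * (of_bool (bad U j k) + of_bool (k \<in> unforced_pending j)))"
    unfolding sum.distrib[symmetric] by (rule sum_mono) (use forced_waiting_cost in auto)
  also have "(\<Sum>k\<in>?Fd. \<Sum>j<n. p j * (of_bool (bad U j k) + of_bool (k \<in> unforced_pending j)))
      \<le> (\<Sum>k<n. \<Sum>j<n. p j * (of_bool (bad U j k) + of_bool (k \<in> unforced_pending j)))"
    by (rule sum_mono2) (use p0 in \<open>auto intro!: sum_nonneg mult_nonneg_nonneg\<close>)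
  also have "\<dots> = ?B + (\<Sum>j<n. \<Sum>k<n. p j * of_bool (k \<in> unforced_pending j))"
    by (subst sum.swap) (simp add: distrib_left sum.distrib)
  also have "(\<Sum>j<n. \<Sum>k<n. p j * of_bool (k \<in> unforced_pending j)) \<le> (\<Sum>j<n. p j * real K)"
  proof (rule sum_mono)
    fix j assume j: "j \<in> {..<n}"
    have "card {k. k < n \<and> k \<in> unforced_pending j} \<le> card (unforced_pending j)"
      by (rule card_mono) (auto simp: unforced_pending_def)
    then have "card {k. k < n \<and> k \<in> unforced_pending j} \<le> K"
      using card_unforced_pending[of j] by linarith
    then show "(\<Sum>k<n. p j * of_bool (k \<in> unforced_pending j)) \<le> p j * real K"
      unfolding sum_distrib_left[symmetric] card_sum_of_bool
      using p0 j by (intro mult_left_mono) auto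
  qed
  also have "(\<Sum>j<n. p j * real K) = real K * V" by (simp add: sum_distrib_left mult.commute)
  also note forced_open_cost
  also note forced_arriving_cost
  also have "(\<Sum>k\<in>?Fd. L) \<le> real n * L"
  proof -
    have "card ?Fd \<le> card {..<n}" by (rule card_mono) auto
    then show ?thesis using longest_nonneg by (simp add: mult_right_mono)
  qed
  finally have "(\<Sum>i<n. s i - r i) \<le> real K * V
      + ((\<Sum>k\<in>?Fd. real K * p k) + (F + real n * L) + real n * L + (?B + real K * V) + real n * L
      + ((\<Sum>k\<in>?Ud. real K * p k) + ?B))" by simp
  moreover have "(\<Sum>k\<in>?Fd. real K * p k) + (\<Sum>k\<in>?Ud. real K * p k) = real K * V"
    unfolding split[symmetric] by (simp add: sum_distrib_left)
  moreover have "3 * real K * V = 3 * (real K * V)" "3 * real n * L = 3 * (real n * L)" by simp_all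
  ultimately show ?thesis by linarith
qed

text \<open>With \<open>n \<le> 4 * K * K\<close> and \<open>K * L \<le> V\<close>, the term
  \<open>3 * n * L\<close> becomes \<open>12 * K * V\<close>. Together with \<open>V\<close>,
  \<open>3 * K * V\<close> and \<open>F\<close>, this gives 17, as
  \<open>V \<le> F \<le> K * F\<close>.\<close>

lemma flow_le:
  assumes "n \<le> 4 * K * K"
  shows "nonpreemptive_flow J (begun U horizon) \<le> 17 * real K * F
     + 2 * (\<Sum>j<n. \<Sum>k<n. p j * of_bool (bad U j k))"
proof -
  have VF: "V \<le> F"
    unfolding total_flow_def by (intro sum_mono proc_le_completion[OF valid sched]) auto
  have V0: "0 \<le> V" by (rule sum_p_nonneg) simp
  have "real n * L \<le> real (4 * K * K) * L"
    using assms longest_nonneg by (intro mult_right_mono of_nat_mono)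
  also have "\<dots> = 4 * real K * (real K * L)" by simp
  also have "\<dots> \<le> 4 * real K * V" using longest_volume[of U] by (intro mult_left_mono) auto
  finally have nL: "real n * L \<le> 4 * real K * V" .
  have "nonpreemptive_flow J (begun U horizon) = (\<Sum>i<n. p i + (s i - r i))"
    unfolding nonpreemptive_flow_def total_flow_def
    using begun_start_time_U starts_start_index_U(2) by (intro sum.cong) auto
  also have "\<dots> = V + (\<Sum>i<n. s i - r i)" by (simp add: sum.distrib)
  finally have "nonpreemptive_flow J (begun U horizon) = V + (\<Sum>i<n. s i - r i)" .
  also have "\<dots> \<le> V + (3 * real K * V + F + 3 * (4 * real K * V)
      + 2 * (\<Sum>j<n. \<Sum>k<n. p j * of_bool (bad U j k)))"
    using total_delay_le nL by linarith
  finally have "nonpreemptive_flow J (begun U horizon) \<le> V + (3 * real K * V + F + 3 * (4 * real K * V)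
      + 2 * (\<Sum>j<n. \<Sum>k<n. p j * of_bool (bad U j k)))" .
  moreover have "F \<le> real K * F"
    using VF V0 K_pos mult_right_mono[of 1 "real K" F] by simp
  moreover have "real K * V \<le> real K * F" using VF by (intro mult_left_mono) auto
  ultimately show ?thesis using VF by linarith
qed

end

end

section \<open>The program\<close>

definition halts :: "com \<Rightarrow> store \<Rightarrow> nat \<Rightarrow> (store \<Rightarrow> bool) \<Rightarrow> bool" where
  "halts c s B Q \<longleftrightarrow> (\<exists>k s'. exec c s k s' \<and> k \<le> B \<and> Q s')"

lemma halts_Skip: "Q s \<Longrightarrow> 1 \<le> B \<Longrightarrow> halts Skip s B Q"
  unfolding halts_def using exec_Skip by blast

lemma halts_NAssign: "Q (nat_update x (nval s e) (nval s f) s) \<Longrightarrow> 1 \<le> B \<Longrightarrow> halts (NAssign x e f) s B Q"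
  unfolding halts_def using exec_NAssign by blast

lemma halts_RAssign: "Q (real_update x (nval s e) (rval s f) s) \<Longrightarrow> 1 \<le> B \<Longrightarrow> halts (RAssign x e f) s B Q"
  unfolding halts_def using exec_RAssign by blast

lemma halts_Seq:
  assumes "halts c s B R" "\<And>s'. R s' \<Longrightarrow> halts d s' C Q" "B + C \<le> D"
  shows "halts (Seq c d) s D Q"
proof -
  obtain k s' where 1: "exec c s k s'" "k \<le> B" "R s'" using assms(1) unfolding halts_def by blast
  obtain l s'' where 2: "exec d s' l s''" "l \<le> C" "Q s''" using assms(2)[OF 1(3)] unfolding halts_def by blast
  show ?thesis unfolding halts_def using exec_Seq[OF 1(1) 2(1)] 1 2 assms(3) by (meson add_mono order_trans)
qed

lemma halts_If:
  assumes "bval s b \<Longrightarrow> halts c s B Q" "\<not> bval s b \<Longrightarrow> halts d s B Q" "Suc B \<le> C"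
  shows "halts (If b c d) s C Q"
  using assms unfolding halts_def
  by (cases "bval s b") (meson exec_IfTrue exec_IfFalse Suc_le_mono order_trans)+

lemma halts_mono: "halts c s B Q \<Longrightarrow> (\<And>s'. Q s' \<Longrightarrow> R s') \<Longrightarrow> B \<le> C \<Longrightarrow> halts c s C R"
  unfolding halts_def using order_trans by blast

text \<open>The index of the invariant bounds the number of remaining iterations; at index 0 the
  guard must fail.\<close>

lemma halts_While:
  assumes "I N s" "\<And>m s. I m s \<Longrightarrow> bval s b \<Longrightarrow> 0 < m \<and> halts c s B (I (m - 1))"
    "\<And>m s. I m s \<Longrightarrow> \<not> bval s b \<Longrightarrow> Q s" "N * Suc B + 1 \<le> D"
  shows "halts (While b c) s D Q"
proof -
  have "halts (While b c) s (N * Suc B + 1) Q"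
    using assms(1)
  proof (induction N arbitrary: s)
    case 0
    then show ?case using assms(2,3) exec_WhileFalse unfolding halts_def by fastforce
  next
    case (Suc N)
    show ?case
    proof (cases "bval s b")
      case True
      then obtain k s' where 1: "exec c s k s'" "k \<le> B" "I N s'"
        using assms(2)[OF Suc.prems] unfolding halts_def by auto
      obtain l s'' where 2: "exec (While b c) s' l s''" "l \<le> N * Suc B + 1" "Q s''"
        using Suc.IH[OF 1(3)] unfolding halts_def by blast
      show ?thesis unfolding halts_def using exec_WhileTrue[OF True 1(1) 2(1)] 1(2) 2(2,3) by force
    next
      case False
      then show ?thesis using assms(3)[OF Suc.prems] exec_WhileFalse unfolding halts_def by fastforce
    qed
  qed
  then show ?thesis by (rule halts_mono) (use assms(4) in auto)
qed

abbreviation N where "N x \<equiv> NVar x (NConst 0)"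
abbreviation R where "R x \<equiv> RVar x (NConst 0)"
abbreviation set_nat (infix "::=" 60) where "x ::= e \<equiv> NAssign x (NConst 0) e"
abbreviation set_real (infix ":==" 60) where "x :== e \<equiv> RAssign x (NConst 0) e"
abbreviation seq (infixr ";;" 55) where "c ;; d \<equiv> Seq c d"

definition for_loop :: "name \<Rightarrow> name \<Rightarrow> com \<Rightarrow> com" where
  "for_loop x y c = (x ::= NConst 0 ;; While (NLess (N x) (N y)) (c ;; x ::= NPlus (N x) (NConst 1)))"

lemma natv_nat_update [simp]:
  "natv (nat_update x i v s) y j = (if y = x \<and> j = i then v else natv s y j)"
  by (simp add: nat_update_def)

lemma realv_nat_update [simp]: "realv (nat_update x i v s) = realv s"
  by (simp add: nat_update_def)

lemma realv_real_update [simp]: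
  "realv (real_update x i v s) y j = (if y = x \<and> j = i then v else realv s y j)"
  by (simp add: real_update_def)

lemma natv_real_update [simp]: "natv (real_update x i v s) = natv s"
  by (simp add: real_update_def)

text \<open>A round costs the body, the test and the increment; the two further steps are the
  initialization and the final test. The invariant is required of the store whose counter has
  already been advanced.\<close>

lemma halts_for:
  assumes "I 0 (nat_update x 0 0 s)" "x \<noteq> y" "natv s y 0 = m"
    and "\<And>k s. k < m \<Longrightarrow> I k s \<Longrightarrow> natv s x 0 = k \<Longrightarrow> natv s y 0 = m \<Longrightarrow>
      halts c s B (\<lambda>s'. I (Suc k) (nat_update x 0 (Suc k) s') \<and> natv s' x 0 = k \<and> natv s' y 0 = m)"
    and "\<And>s. I m s \<Longrightarrow> Q s" "m * (B + 2) + 2 \<le> D"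
  shows "halts (for_loop x y c) s D Q"
  unfolding for_loop_def
proof (rule halts_Seq)
  let ?I = "\<lambda>l s. l \<le> m \<and> I (m - l) s \<and> natv s x 0 = m - l \<and> natv s y 0 = m"
  show "halts (x ::= NConst 0) s 1 (?I m)"
    by (rule halts_NAssign) (use assms in auto)
  show "halts (While (NLess (N x) (N y)) (c ;; x ::= NPlus (N x) (NConst 1))) s' (m * Suc (B + 1) + 1) Q"
    if "?I m s'" for s'
  proof (rule halts_While[where I = ?I, OF that])
    fix l s assume I: "?I l s" and b: "bval s (NLess (N x) (N y))"
    then have l: "m - l < m" "0 < l" by auto
    have "halts (c ;; x ::= NPlus (N x) (NConst 1)) s (B + 1) (?I (l - 1))"
    proof (rule halts_Seq[OF assms(4)[OF l(1)]])
      fix s' assume *: "I (Suc (m - l)) (nat_update x 0 (Suc (m - l)) s') \<and> natv s' x 0 = m - l \<and> natv s' y 0 = m"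
      have "m - (l - 1) = Suc (m - l)" using l I by auto
      with * show "halts (x ::= NPlus (N x) (NConst 1)) s' 1 (?I (l - 1))"
        by (intro halts_NAssign) (use assms(2) I in auto)
    qed (use I in auto)
    then show "0 < l \<and> halts (c ;; x ::= NPlus (N x) (NConst 1)) s (B + 1) (?I (l - 1))"
      using l by simp
  next
    fix l s assume I: "?I l s" and b: "\<not> bval s (NLess (N x) (N y))"
    then have "l = 0" by auto
    then show "Q s" using I assms(5) by simp
  qed simp
qed (use assms(6) in simp)

definition agree :: "name set \<Rightarrow> store \<Rightarrow> store \<Rightarrow> bool" where
  "agree X s s' \<longleftrightarrow> (\<forall>x. x \<notin> X \<longrightarrow> natv s' x = natv s x \<and> realv s' x = realv s x)"

lemma agree_refl: "agree X s s"
  by (simp add: agree_def)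

lemma agree_nat_update: "agree X s s' \<Longrightarrow> x \<in> X \<Longrightarrow> agree X s (nat_update x i v s')"
  by (auto simp: agree_def nat_update_def)

lemma agree_real_update: "agree X s s' \<Longrightarrow> x \<in> X \<Longrightarrow> agree X s (real_update x i v s')"
  by (auto simp: agree_def real_update_def)

lemma agree_natv: "agree X s s' \<Longrightarrow> x \<notin> X \<Longrightarrow> natv s' x = natv s x"
  and agree_realv: "agree X s s' \<Longrightarrow> x \<notin> X \<Longrightarrow> realv s' x = realv s x"
  by (auto simp: agree_def)

text \<open>For positive \<open>n\<close>, the largest \<open>b\<close> with
  \<open>4 ^ b \<le> n\<close>. Hence \<open>bound n\<close> is at most \<open>sqrt n\<close> and
  more than half of it.\<close>

definition log_bound :: "nat \<Rightarrow> nat" where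
  "log_bound n = (LEAST b. n < 4 ^ Suc b)"

definition bound :: "nat \<Rightarrow> nat" where
  "bound n = 2 ^ log_bound n"

lemma log_bound_less: "n < 4 ^ Suc (log_bound n)"
  unfolding log_bound_def
proof (rule LeastI)
  have "n < 4 ^ n" by (induction n) auto
  then show "n < 4 ^ Suc n" by simp
qed

lemma le_log_bound: "b \<le> log_bound n \<Longrightarrow> 1 \<le> n \<Longrightarrow> 4 ^ b \<le> n"
  using not_less_Least[of "b - 1" "\<lambda>b. n < 4 ^ Suc b"] unfolding log_bound_def
  by (cases b) auto

lemma log_bound_le: "log_bound n \<le> n"
proof (cases n)
  case 0
  then show ?thesis unfolding log_bound_def by (intro Least_le) simp
next
  case (Suc m)
  have "m < 4 ^ m" for m :: nat by (induction m) auto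
  from this[of "log_bound n"] le_log_bound[OF order_refl, of n] Suc show ?thesis by linarith
qed

lemma bound_pos: "1 \<le> bound n"
  by (simp add: bound_def)

lemma bound_squared_le: "1 \<le> n \<Longrightarrow> bound n * bound n \<le> n"
  using le_log_bound[OF order_refl, of n] by (simp add: bound_def power_mult_distrib[symmetric])

lemma less_bound_squared: "n < 4 * bound n * bound n"
  using log_bound_less[of n] by (simp add: bound_def mult.assoc power_mult_distrib[symmetric])

text \<open>\<open>sq\<close> carries the square of \<open>K\<close>. Doubling one and quadrupling
  the other needs only additions, as the machine cannot multiply variables.\<close>

definition root_com :: com where
  "root_com = (''K'' ::= NConst 1 ;; ''sq'' ::= NConst 1 ;;
     While (Not (NLess (N ''n'') (NPlus (NPlus (N ''sq'') (N ''sq'')) (NPlus (N ''sq'') (N ''sq'')))))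
       (''K'' ::= NPlus (N ''K'') (N ''K'') ;;
        ''sq'' ::= NPlus (NPlus (N ''sq'') (N ''sq'')) (NPlus (N ''sq'') (N ''sq''))))"

lemma root_com:
  assumes "natv s ''n'' 0 = n" "1 \<le> n"
  shows "halts root_com s (3 * n + 3)
    (\<lambda>s'. agree {''K'', ''sq''} s s' \<and> natv s' ''K'' 0 = bound n)"
proof -
  let ?X = "{''K'', ''sq''}"
  let ?I = "\<lambda>m s'. m \<le> log_bound n \<and> agree ?X s s' \<and>
    natv s' ''K'' 0 = 2 ^ (log_bound n - m) \<and> natv s' ''sq'' 0 = 4 ^ (log_bound n - m)"
  have n: "natv s' ''n'' 0 = n" if "agree ?X s s'" for s'
    using agree_natv[OF that, of "''n''"] assms by simp
  show ?thesis
    unfolding root_com_def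
  proof (rule halts_Seq[where B = 1 and C = "3 * n + 2"])
    show "halts (''K'' ::= NConst 1) s 1 (\<lambda>s'. agree ?X s s' \<and> natv s' ''K'' 0 = 1)"
      by (rule halts_NAssign) (auto intro: agree_nat_update agree_refl)
    fix s1 assume s1: "agree ?X s s1 \<and> natv s1 ''K'' 0 = 1"
    show "halts (''sq'' ::= NConst 1 ;;
     While (Not (NLess (N ''n'') (NPlus (NPlus (N ''sq'') (N ''sq'')) (NPlus (N ''sq'') (N ''sq'')))))
       (''K'' ::= NPlus (N ''K'') (N ''K'') ;;
        ''sq'' ::= NPlus (NPlus (N ''sq'') (N ''sq'')) (NPlus (N ''sq'') (N ''sq'')))) s1 (3 * n + 2)
     (\<lambda>s'. agree {''K'', ''sq''} s s' \<and> natv s' ''K'' 0 = bound n)"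
    proof (rule halts_Seq[where B = 1 and C = "3 * n + 1" and R = "?I (log_bound n)"])
      show "halts (''sq'' ::= NConst 1) s1 1 (?I (log_bound n))"
        by (rule halts_NAssign) (use s1 in \<open>auto intro: agree_nat_update\<close>)
      fix s2 assume s2: "?I (log_bound n) s2"
      show "halts (While (Not (NLess (N ''n'') (NPlus (NPlus (N ''sq'') (N ''sq'')) (NPlus (N ''sq'') (N ''sq'')))))
       (''K'' ::= NPlus (N ''K'') (N ''K'') ;;
        ''sq'' ::= NPlus (NPlus (N ''sq'') (N ''sq'')) (NPlus (N ''sq'') (N ''sq'')))) s2 (3 * n + 1)
        (\<lambda>s'. agree {''K'', ''sq''} s s' \<and> natv s' ''K'' 0 = bound n)"
      proof (rule halts_While[where I = ?I and N = "log_bound n" and B = 2, OF s2])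
        fix m s' assume I: "?I m s'"
          and "bval s' (Not (NLess (N ''n'') (NPlus (NPlus (N ''sq'') (N ''sq'')) (NPlus (N ''sq'') (N ''sq'')))))"
        then have le: "4 ^ Suc (log_bound n - m) \<le> n" using n[of s'] by simp
        have "m \<noteq> 0"
        proof
          assume "m = 0"
          then show False using le log_bound_less[of n] by simp
        qed
        then have e: "log_bound n - (m - 1) = Suc (log_bound n - m)" using I by auto
        have "halts (''K'' ::= NPlus (N ''K'') (N ''K'') ;;
          ''sq'' ::= NPlus (NPlus (N ''sq'') (N ''sq'')) (NPlus (N ''sq'') (N ''sq''))) s' 2 (?I (m - 1))"
          unfolding e
        proof (rule halts_Seq[where B = 1 and C = 1])
          show "halts (''K'' ::= NPlus (N ''K'') (N ''K'')) s' 1 (\<lambda>s''. agree ?X s s'' \<and>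
              natv s'' ''K'' 0 = 2 ^ Suc (log_bound n - m) \<and> natv s'' ''sq'' 0 = 4 ^ (log_bound n - m))"
            by (rule halts_NAssign) (use I in \<open>auto intro: agree_nat_update\<close>)
        qed (use I in \<open>auto intro!: halts_NAssign agree_nat_update\<close>)
        then show "0 < m \<and> halts (''K'' ::= NPlus (N ''K'') (N ''K'') ;;
          ''sq'' ::= NPlus (NPlus (N ''sq'') (N ''sq'')) (NPlus (N ''sq'') (N ''sq''))) s' 2 (?I (m - 1))"
          using \<open>m \<noteq> 0\<close> by simp
      next
        fix m s' assume I: "?I m s'"
          and "\<not> bval s' (Not (NLess (N ''n'') (NPlus (NPlus (N ''sq'') (N ''sq'')) (NPlus (N ''sq'') (N ''sq'')))))"
        then have lt: "n < 4 ^ Suc (log_bound n - m)" using n[of s'] by simp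
        then have "log_bound n \<le> log_bound n - m" unfolding log_bound_def[of n] by (intro Least_le)
        then have "log_bound n - m = log_bound n" by simp
        then show "agree {''K'', ''sq''} s s' \<and> natv s' ''K'' 0 = bound n"
          using I by (simp add: bound_def)
      qed (use log_bound_le[of n] in simp)
    qed simp
  qed simp
qed

text \<open>The coins form \<open>n\<close> rows of length \<open>n\<close>, and job
  \<open>j\<close> reads the beginning of row \<open>j\<close>; so different jobs use disjoint
  coins. The value 0 beyond \<open>n\<close> keeps all thresholds below \<open>bound n\<close> and
  makes \<open>thresholds_recode\<close> an equation between functions.\<close>

definition thresholds :: "nat \<Rightarrow> bool list \<Rightarrow> nat \<Rightarrow> nat" where
  "thresholds n \<omega> j = (if j < n then \<Sum>l<log_bound n. of_bool (\<omega> ! (j * n + l)) * 2 ^ l else 0)"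

definition idle_com :: com where
  "idle_com = (''idl'' :== RMinus (R ''now'') (RVar ''rel'' (N ''j'')) ;;
     for_loop ''i'' ''n''
       (If (NLess (NConst 0) (NVar ''started'' (N ''i'')))
         (If (RLess (RVar ''rel'' (N ''j'')) (RVar ''start'' (N ''i'')))
           (''idl'' :== RMinus (R ''idl'') (RVar ''proc'' (N ''i'')))
           (If (RLess (RVar ''rel'' (N ''j'')) (RPlus (RVar ''start'' (N ''i'')) (RVar ''proc'' (N ''i''))))
             (''idl'' :== RMinus (R ''idl'')
               (RMinus (RPlus (RVar ''start'' (N ''i'')) (RVar ''proc'' (N ''i''))) (RVar ''rel'' (N ''j''))))
             Skip))
         Skip))"

text \<open>The product of threshold and size is accumulated from doubled copies of the size, one
  for each coin. \<open>w\<close> runs through the powers of two up to \<open>K\<close>, so the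
  exponent \<open>log_bound n\<close> is never computed.\<close>

definition threshold_step :: com where
  "threshold_step = (If (NLess (NConst 0) (NVar ''coin'' (N ''i'')))
       (''thr'' :== RPlus (R ''thr'') (R ''unit'')) Skip ;;
     ''unit'' :== RPlus (R ''unit'') (R ''unit'') ;;
     ''w'' ::= NPlus (N ''w'') (N ''w'') ;;
     ''i'' ::= NPlus (N ''i'') (NConst 1))"

definition threshold_com :: com where
  "threshold_com = (''thr'' :== RConst 0 ;; ''unit'' :== RVar ''proc'' (N ''j'') ;;
     ''w'' ::= NConst 1 ;; ''i'' ::= N ''base'' ;;
     While (NLess (N ''w'') (N ''K'')) threshold_step)"

text \<open>\<open>found\<close> equal to \<open>n\<close> encodes that no ripe job has been seen,
  and \<open>best\<close> is meaningful only for positive \<open>cnt\<close>. \<open>base\<close>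
  tracks the row offset \<open>j * n\<close> by addition.\<close>

definition select_com :: com where
  "select_com =
    (If (And (NLess (NConst 0) (NVar ''known'' (N ''j''))) (NLess (NVar ''started'' (N ''j'')) (NConst 1)))
      (If (And (NLess (NConst 0) (N ''cnt''))
            (Not (RLess (RVar ''proc'' (N ''j'')) (RVar ''proc'' (N ''best'')))))
          Skip (''best'' ::= N ''j'') ;;
       ''cnt'' ::= NPlus (N ''cnt'') (NConst 1) ;;
       idle_com ;; threshold_com ;;
       If (And (Not (NLess (N ''found'') (N ''n''))) (Not (RLess (R ''idl'') (R ''thr''))))
          (''found'' ::= N ''j'') Skip)
      Skip ;;
     ''base'' ::= NPlus (N ''base'') (N ''n''))"

definition output_com :: com where
  "output_com =
    If (NLess (N ''K'') (N ''cnt'')) (''act'' ::= NConst 0 ;; ''job'' ::= N ''best'')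
     (If (NLess (N ''found'') (N ''n'')) (''act'' ::= NConst 0 ;; ''job'' ::= N ''found'')
      (If (NLess (NConst 0) (N ''cnt''))
        (''act'' ::= NConst 2 ;; ''until'' :== RPlus (R ''now'') (RVar ''proc'' (N ''best'')))
        (''act'' ::= NConst 1)))"

definition decide_com :: com where
  "decide_com = (root_com ;; ''cnt'' ::= NConst 0 ;; ''base'' ::= NConst 0 ;; ''found'' ::= N ''n'' ;;
     for_loop ''j'' ''n'' select_com ;; output_com)"

section \<open>Least ripe and shortest pending job of growing initial segments\<close>

lemma Least_initial:
  fixes A :: "nat set"
  shows "A \<inter> {..<k} \<noteq> {} \<Longrightarrow> (LEAST j. j \<in> A \<inter> {..<Suc k}) = (LEAST j. j \<in> A \<inter> {..<k})"
    and "A \<inter> {..<k} = {} \<Longrightarrow> k \<in> A \<Longrightarrow> (LEAST j. j \<in> A \<inter> {..<Suc k}) = k"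
proof -
  assume ne: "A \<inter> {..<k} \<noteq> {}"
  let ?l = "LEAST j. j \<in> A \<inter> {..<k}"
  have l: "?l \<in> A \<inter> {..<k}" by (rule LeastI_ex) (use ne in blast)
  show "(LEAST j. j \<in> A \<inter> {..<Suc k}) = ?l"
  proof (rule Least_equality)
    show "?l \<in> A \<inter> {..<Suc k}" using l by auto
    fix y assume y: "y \<in> A \<inter> {..<Suc k}"
    show "?l \<le> y"
    proof (cases "y < k")
      case True
      then show ?thesis using y by (intro Least_le) auto
    qed (use l in auto)
  qed
next
  assume "A \<inter> {..<k} = {}" "k \<in> A"
  then show "(LEAST j. j \<in> A \<inter> {..<Suc k}) = k"
    by (intro Least_equality) (auto simp: less_Suc_eq)
qed

lemma shortest_eqI:
  assumes "j \<in> A" "\<And>i. i \<in> A \<Longrightarrow> proc J j \<le> proc J i" "\<And>i. i \<in> A \<Longrightarrow> i < j \<Longrightarrow> proc J j < proc J i"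
  shows "shortest J A = j"
  unfolding shortest_def
proof (rule Least_equality)
  show "j \<le> y" if "y \<in> A \<and> (\<forall>i\<in>A. proc J y \<le> proc J i)" for y
    using that assms(1) assms(3)[of y] by (meson leD not_le)
qed (use assms in auto)

lemma shortest_less:
  assumes "finite A" "i \<in> A" "i < shortest J A"
  shows "proc J (shortest J A) < proc J i"
proof (rule ccontr)
  assume n: "\<not> proc J (shortest J A) < proc J i"
  then have "\<forall>k\<in>A. proc J i \<le> proc J k"
  proof (intro ballI)
    fix k assume "k \<in> A"
    then have "proc J (shortest J A) \<le> proc J k" using assms(1) by (intro shortest(2)) auto
    then show "proc J i \<le> proc J k" using n by linarith
  qed
  then have "shortest J A \<le> i" unfolding shortest_def using assms(2) by (intro Least_le) auto
  then show False using assms(3) by simp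
qed

text \<open>The new index is the largest and so loses ties; a scan has to update only on a strict
  improvement.\<close>

lemma shortest_insert:
  assumes "finite A" "A \<noteq> {}" "\<And>i. i \<in> A \<Longrightarrow> i < k"
  shows "shortest J (insert k A) = (if proc J k < proc J (shortest J A) then k else shortest J A)"
proof -
  have l: "shortest J A \<in> A" "\<And>i. i \<in> A \<Longrightarrow> proc J (shortest J A) \<le> proc J i"
    using shortest[OF assms(1,2)] by auto
  have less: "proc J (shortest J A) < proc J i" if "i \<in> A" "i < shortest J A" for i
    by (rule shortest_less[OF assms(1) that])
  show ?thesis
  proof (cases "proc J k < proc J (shortest J A)")
    case True
    have "shortest J (insert k A) = k"
    proof (rule shortest_eqI)
      show "proc J k \<le> proc J i" if "i \<in> insert k A" for i using that l(2)[of i] True by auto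
      show "proc J k < proc J i" if "i \<in> insert k A" "i < k" for i using that l(2)[of i] True by auto
    qed simp
    then show ?thesis using True by simp
  next
    case False
    have "shortest J (insert k A) = shortest J A"
    proof (rule shortest_eqI)
      show "proc J (shortest J A) \<le> proc J i" if "i \<in> insert k A" for i using that l(2)[of i] False by auto
      show "proc J (shortest J A) < proc J i" if "i \<in> insert k A" "i < shortest J A" for i
        using that less[of i] assms(3)[OF l(1)] by auto
    qed (use l in simp)
    then show ?thesis using False by simp
  qed
qed

section \<open>Correctness of the program for a single decision\<close>

locale decision_input =
  fixes J :: jobs and \<omega> :: "bool list" and t :: real and S :: "nat \<rightharpoonup> real"
  assumes valid: "valid_jobs J"
    and started: "i \<in> dom S \<Longrightarrow> i < length J \<and> rel J i \<le> t"
    and coins: "length \<omega> = length J * length J"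
begin

abbreviation "n \<equiv> length J"
abbreviation "r \<equiv> rel J"
abbreviation "p \<equiv> proc J"

text \<open>The part of the input store that the program reads; unlike equality with
  \<open>input_store\<close>, it survives writes to the work variables. The sizes of unreleased jobs
  are left unconstrained.\<close>

definition inputs :: "store \<Rightarrow> bool" where
  "inputs s \<longleftrightarrow> natv s ''n'' 0 = n \<and> realv s ''now'' 0 = t \<and>
    (\<forall>i<n * n. natv s ''coin'' i = of_bool (\<omega> ! i)) \<and>
    (\<forall>i<n. natv s ''known'' i = of_bool (r i \<le> t) \<and> natv s ''started'' i = of_bool (i \<in> dom S) \<and>
      (r i \<le> t \<longrightarrow> realv s ''rel'' i = r i \<and> realv s ''proc'' i = p i) \<and>
      (i \<in> dom S \<longrightarrow> realv s ''start'' i = the (S i)))"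

lemma inputs_input_store: "inputs (input_store n \<omega> t (known_jobs J t) S)"
  unfolding inputs_def input_store_def known_jobs_def using coins by (auto simp: dom_def)

lemma inputs_agree:
  assumes "agree X s s'" "inputs s"
    "X \<subseteq> {''K'', ''sq'', ''cnt'', ''base'', ''found'', ''best'', ''idl'', ''thr'', ''unit'', ''w'', ''i'', ''j''}"
  shows "inputs s'"
proof -
  have "natv s' x = natv s x \<and> realv s' x = realv s x"
    if "x \<in> {''n'', ''now'', ''coin'', ''known'', ''started'', ''rel'', ''proc'', ''start''}" for x
  proof -
    have "x \<notin> X" using that assms(3) by auto
    then show ?thesis using assms(1) unfolding agree_def by blast
  qed
  then show ?thesis using assms(2) unfolding inputs_def by simp
qed

lemma idle_com:
  assumes s: "inputs s" and j: "natv s ''j'' 0 = j" "j < n" "r j \<le> t"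
  shows "halts idle_com s (6 * n + 3) (\<lambda>s'. agree {''i'', ''idl''} s s' \<and> realv s' ''idl'' 0 = idle J t S j)"
proof -
  let ?X = "{''i'', ''idl''}"
  let ?I = "\<lambda>k s'. agree ?X s s' \<and>
    realv s' ''idl'' 0 = t - r j - (\<Sum>i\<in>dom S \<inter> {..<k}. overlap J S j i)"
  have inp: "inputs s'" "natv s' ''j'' 0 = j" if "agree ?X s s'" for s'
    using inputs_agree[OF that s] agree_natv[OF that, of "''j''"] j by auto
  show ?thesis
    unfolding idle_com_def
  proof (rule halts_Seq[where B = 1 and C = "6 * n + 2"])
    show "halts (''idl'' :== RMinus (R ''now'') (RVar ''rel'' (N ''j''))) s 1 (?I 0)"
      by (rule halts_RAssign) (use s j in \<open>auto simp: inputs_def intro: agree_real_update agree_refl\<close>)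
    fix s1 assume s1: "?I 0 s1"
    show "halts (for_loop ''i'' ''n''
       (If (NLess (NConst 0) (NVar ''started'' (N ''i'')))
         (If (RLess (RVar ''rel'' (N ''j'')) (RVar ''start'' (N ''i'')))
           (''idl'' :== RMinus (R ''idl'') (RVar ''proc'' (N ''i'')))
           (If (RLess (RVar ''rel'' (N ''j'')) (RPlus (RVar ''start'' (N ''i'')) (RVar ''proc'' (N ''i''))))
             (''idl'' :== RMinus (R ''idl'')
               (RMinus (RPlus (RVar ''start'' (N ''i'')) (RVar ''proc'' (N ''i''))) (RVar ''rel'' (N ''j''))))
             Skip))
         Skip)) s1 (6 * n + 2) (\<lambda>s'. agree ?X s s' \<and> realv s' ''idl'' 0 = idle J t S j)"
    proof (rule halts_for[where I = ?I and m = n and B = 4])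
      show "?I 0 (nat_update ''i'' 0 0 s1)" using s1 by (auto intro: agree_nat_update)
      show "natv s1 ''n'' 0 = n" using inp s1 unfolding inputs_def by blast
      show "agree ?X s s' \<and> realv s' ''idl'' 0 = idle J t S j" if "?I n s'" for s'
      proof -
        have "dom S \<inter> {..<n} = dom S" using started by auto
        then show ?thesis using that by (simp add: idle_def)
      qed
    next
      fix k s' assume k: "k < n" and I: "?I k s'" and i: "natv s' ''i'' 0 = k" and n: "natv s' ''n'' 0 = n"
      have inp': "inputs s'" "natv s' ''j'' 0 = j" using inp I by blast+
      have relj: "realv s' ''rel'' j = r j" using inp' j unfolding inputs_def by blast
      have st: "natv s' ''started'' k = of_bool (k \<in> dom S)" using inp' k unfolding inputs_def by blast
      have pk: "realv s' ''proc'' k = p k" "realv s' ''start'' k = the (S k)" if "k \<in> dom S"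
        using inp' k started[OF that] that unfolding inputs_def by blast+
      have pos: "0 < p k" using valid k unfolding valid_jobs_def by (metis nth_mem case_prod_beta)
      have Sin: "dom S \<inter> {..<Suc k} = insert k (dom S \<inter> {..<k})" if "k \<in> dom S" using that by auto
      have Sout: "dom S \<inter> {..<Suc k} = dom S \<inter> {..<k}" if "k \<notin> dom S" using that by (auto simp: less_Suc_eq)
      show "halts (If (NLess (NConst 0) (NVar ''started'' (N ''i'')))
         (If (RLess (RVar ''rel'' (N ''j'')) (RVar ''start'' (N ''i'')))
           (''idl'' :== RMinus (R ''idl'') (RVar ''proc'' (N ''i'')))
           (If (RLess (RVar ''rel'' (N ''j'')) (RPlus (RVar ''start'' (N ''i'')) (RVar ''proc'' (N ''i''))))
             (''idl'' :== RMinus (R ''idl'')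
               (RMinus (RPlus (RVar ''start'' (N ''i'')) (RVar ''proc'' (N ''i''))) (RVar ''rel'' (N ''j''))))
             Skip))
         Skip) s' 4 (\<lambda>s'. ?I (Suc k) (nat_update ''i'' 0 (Suc k) s') \<and> natv s' ''i'' 0 = k \<and> natv s' ''n'' 0 = n)"
      proof (rule halts_If[where B = 3])
        assume "bval s' (NLess (NConst 0) (NVar ''started'' (N ''i'')))"
        then have kS: "k \<in> dom S" using i st by simp
        note pk = pk[OF kS] and Sin = Sin[OF kS]
        have sum: "(\<Sum>i\<in>dom S \<inter> {..<Suc k}. overlap J S j i)
            = overlap J S j k + (\<Sum>i\<in>dom S \<inter> {..<k}. overlap J S j i)"
          unfolding Sin by simp
        show "halts (If (RLess (RVar ''rel'' (N ''j'')) (RVar ''start'' (N ''i'')))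
           (''idl'' :== RMinus (R ''idl'') (RVar ''proc'' (N ''i'')))
           (If (RLess (RVar ''rel'' (N ''j'')) (RPlus (RVar ''start'' (N ''i'')) (RVar ''proc'' (N ''i''))))
             (''idl'' :== RMinus (R ''idl'')
               (RMinus (RPlus (RVar ''start'' (N ''i'')) (RVar ''proc'' (N ''i''))) (RVar ''rel'' (N ''j''))))
             Skip)) s' 3
           (\<lambda>s'. ?I (Suc k) (nat_update ''i'' 0 (Suc k) s') \<and> natv s' ''i'' 0 = k \<and> natv s' ''n'' 0 = n)"
        proof (rule halts_If[where B = 2], goal_cases)
          case 1
          then have o: "overlap J S j k = p k" using pos inp'(2) i relj pk by (simp add: overlap_def)
          show ?case
            by (rule halts_RAssign)
              (use I i n pk in \<open>auto simp: sum o intro!: agree_nat_update agree_real_update\<close>)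
        next
          case 2
          then have le: "the (S k) \<le> r j" using inp'(2) i relj pk by simp
          show ?case
          proof (rule halts_If[where B = 1], goal_cases)
            case 1
            then have o: "overlap J S j k = the (S k) + p k - r j"
              using le inp'(2) i relj pk by (simp add: overlap_def)
            show ?case
              by (rule halts_RAssign)
                (use I i n pk inp'(2) relj in \<open>auto simp: sum o intro!: agree_nat_update agree_real_update\<close>)
          next
            case 2
            then have o: "overlap J S j k = 0"
              using le inp'(2) i relj pk by (simp add: overlap_def)
            show ?case
              by (rule halts_Skip) (use I i n in \<open>auto simp: sum o intro!: agree_nat_update\<close>)
          qed simp
        qed simp
      next
        assume "\<not> bval s' (NLess (NConst 0) (NVar ''started'' (N ''i'')))"
        then have kS: "k \<notin> dom S" using i st by simp
        show "halts Skip s' 3 (\<lambda>s'. ?I (Suc k) (nat_update ''i'' 0 (Suc k) s') \<and> natv s' ''i'' 0 = k \<and> natv s' ''n'' 0 = n)"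
          unfolding Sout[OF kS]
          by (rule halts_Skip) (use I i n in \<open>auto intro: agree_nat_update\<close>)
      qed simp
    qed simp_all
  qed simp
qed

lemma threshold_com:
  assumes s: "inputs s" and j: "natv s ''j'' 0 = j" "j < n" "r j \<le> t"
    and base: "natv s ''base'' 0 = j * n" and K: "natv s ''K'' 0 = bound n"
  shows "halts threshold_com s (6 * n + 5)
    (\<lambda>s'. agree {''i'', ''thr'', ''unit'', ''w''} s s' \<and> realv s' ''thr'' 0 = real (thresholds n \<omega> j) * p j)"
proof -
  let ?X = "{''i'', ''thr'', ''unit'', ''w''}"
  let ?b = "log_bound n"
  let ?I = "\<lambda>m s'. m \<le> ?b \<and> agree ?X s s' \<and> natv s' ''w'' 0 = 2 ^ (?b - m) \<and>
    natv s' ''i'' 0 = j * n + (?b - m) \<and> realv s' ''unit'' 0 = 2 ^ (?b - m) * p j \<and>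
    realv s' ''thr'' 0 = real (\<Sum>l<?b - m. of_bool (\<omega> ! (j * n + l)) * 2 ^ l) * p j"
  have inp: "inputs s'" "natv s' ''j'' 0 = j" "natv s' ''base'' 0 = j * n" "natv s' ''K'' 0 = bound n"
    if "agree ?X s s'" for s'
    using inputs_agree[OF that s] agree_natv[OF that, of "''j''"] agree_natv[OF that, of "''base''"]
      agree_natv[OF that, of "''K''"] j base K by auto
  have pj: "realv s ''proc'' j = p j" using s j unfolding inputs_def by blast
  have loop: "halts (While (NLess (N ''w'') (N ''K'')) threshold_step) s4 (6 * n + 1)
    (\<lambda>s'. agree ?X s s' \<and> realv s' ''thr'' 0 = real (thresholds n \<omega> j) * p j)" if s4: "?I ?b s4" for s4
  proof (rule halts_While[where I = ?I and N = ?b and B = 5, OF s4])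
    fix m s' assume I: "?I m s'" and b: "bval s' (NLess (N ''w'') (N ''K''))"
    have inp': "inputs s'" "natv s' ''K'' 0 = bound n" using inp I by blast+
    \<comment> \<open>\<open>m\<close> counts the coins still to be read; the guard compares powers
      of two instead of exponents.\<close>
    then have "2 ^ (?b - m) < (2 :: nat) ^ ?b" using I b by (simp add: bound_def)
    then have m: "0 < m" by (cases m) auto
    then have e: "?b - (m - 1) = Suc (?b - m)" using I by auto
    let ?l = "?b - m"
    have le: "m - Suc 0 \<le> ?b" using I by linarith
    have l: "?l < n" using m I log_bound_le[of n] by linarith
    have "j * n + ?l < n * n"
    proof -
      have "j * n + ?l < Suc j * n" using l by simp
      also have "\<dots> \<le> n * n" using j(2) by (intro mult_le_mono1) simp
      finally show ?thesis .
    qed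
    then have coin: "natv s' ''coin'' (j * n + ?l) = of_bool (\<omega> ! (j * n + ?l))"
      using inp'(1) unfolding inputs_def by blast
    let ?v = "of_bool (\<omega> ! (j * n + ?l)) * 2 ^ ?l :: nat"
    have "halts threshold_step s' 5 (?I (m - 1))"
      unfolding e threshold_step_def
    proof (rule halts_Seq[where B = 2 and C = 3])
      let ?Q = "\<lambda>s'. agree ?X s s' \<and> natv s' ''w'' 0 = 2 ^ ?l \<and>
        natv s' ''i'' 0 = j * n + ?l \<and> realv s' ''unit'' 0 = 2 ^ ?l * p j \<and>
        realv s' ''thr'' 0 = real (\<Sum>l<Suc ?l. of_bool (\<omega> ! (j * n + l)) * 2 ^ l) * p j"
      show "halts (If (NLess (NConst 0) (NVar ''coin'' (N ''i'')))
          (''thr'' :== RPlus (R ''thr'') (R ''unit'')) Skip) s' 2 ?Q"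
        by (rule halts_If[where B = 1])
          (use I coin in \<open>auto intro!: halts_RAssign halts_Skip agree_real_update simp: algebra_simps split: if_splits\<close>)
      fix s1 assume s1: "?Q s1"
      show "halts (''unit'' :== RPlus (R ''unit'') (R ''unit'') ;;
          ''w'' ::= NPlus (N ''w'') (N ''w'') ;; ''i'' ::= NPlus (N ''i'') (NConst 1)) s1 3
        (\<lambda>s'. m - 1 \<le> ?b \<and> agree ?X s s' \<and> natv s' ''w'' 0 = 2 ^ Suc ?l \<and>
          natv s' ''i'' 0 = j * n + Suc ?l \<and> realv s' ''unit'' 0 = 2 ^ Suc ?l * p j \<and>
          realv s' ''thr'' 0 = real (\<Sum>l<Suc ?l. of_bool (\<omega> ! (j * n + l)) * 2 ^ l) * p j)"
      proof (rule halts_Seq[where B = 1 and C = 2])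
        let ?Q1 = "\<lambda>s'. agree ?X s s' \<and> natv s' ''w'' 0 = 2 ^ ?l \<and>
          natv s' ''i'' 0 = j * n + ?l \<and> realv s' ''unit'' 0 = 2 ^ Suc ?l * p j \<and>
          realv s' ''thr'' 0 = real (\<Sum>l<Suc ?l. of_bool (\<omega> ! (j * n + l)) * 2 ^ l) * p j"
        show "halts (''unit'' :== RPlus (R ''unit'') (R ''unit'')) s1 1 ?Q1"
          by (rule halts_RAssign) (use s1 in \<open>auto intro: agree_real_update\<close>)
        fix s2 assume s2: "?Q1 s2"
        show "halts (''w'' ::= NPlus (N ''w'') (N ''w'') ;; ''i'' ::= NPlus (N ''i'') (NConst 1)) s2 2
          (\<lambda>s'. m - 1 \<le> ?b \<and> agree ?X s s' \<and> natv s' ''w'' 0 = 2 ^ Suc ?l \<and>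
          natv s' ''i'' 0 = j * n + Suc ?l \<and> realv s' ''unit'' 0 = 2 ^ Suc ?l * p j \<and>
          realv s' ''thr'' 0 = real (\<Sum>l<Suc ?l. of_bool (\<omega> ! (j * n + l)) * 2 ^ l) * p j)"
        proof (rule halts_Seq[where B = 1 and C = 1])
          let ?Q2 = "\<lambda>s'. agree ?X s s' \<and> natv s' ''w'' 0 = 2 ^ Suc ?l \<and>
            natv s' ''i'' 0 = j * n + ?l \<and> realv s' ''unit'' 0 = 2 ^ Suc ?l * p j \<and>
            realv s' ''thr'' 0 = real (\<Sum>l<Suc ?l. of_bool (\<omega> ! (j * n + l)) * 2 ^ l) * p j"
          show "halts (''w'' ::= NPlus (N ''w'') (N ''w'')) s2 1 ?Q2"
            by (rule halts_NAssign) (use s2 in \<open>auto intro: agree_nat_update\<close>)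
          fix s3 assume s3: "?Q2 s3"
          show "halts (''i'' ::= NPlus (N ''i'') (NConst 1)) s3 1
            (\<lambda>s'. m - 1 \<le> ?b \<and> agree ?X s s' \<and> natv s' ''w'' 0 = 2 ^ Suc ?l \<and>
            natv s' ''i'' 0 = j * n + Suc ?l \<and> realv s' ''unit'' 0 = 2 ^ Suc ?l * p j \<and>
            realv s' ''thr'' 0 = real (\<Sum>l<Suc ?l. of_bool (\<omega> ! (j * n + l)) * 2 ^ l) * p j)"
            by (rule halts_NAssign) (use s3 le in \<open>auto intro: agree_nat_update\<close>)
        qed simp
      qed simp
    qed simp
    then show "0 < m \<and> halts threshold_step s' 5 (?I (m - 1))" using m by blast
  next
    fix m s' assume I: "?I m s'" and b: "\<not> bval s' (NLess (N ''w'') (N ''K''))"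
    have "natv s' ''K'' 0 = bound n" using inp I by blast
    then have "(2 :: nat) ^ ?b \<le> 2 ^ (?b - m)" using I b by (simp add: bound_def)
    then have "?b \<le> ?b - m" by simp
    then have "?b - m = ?b" by linarith
    then show "agree ?X s s' \<and> realv s' ''thr'' 0 = real (thresholds n \<omega> j) * p j"
      using I j(2) by (simp add: thresholds_def)
  qed (use log_bound_le[of n] in simp)
  show ?thesis
    unfolding threshold_com_def
  proof (rule halts_Seq[where B = 1 and C = "6 * n + 4"])
    let ?Q1 = "\<lambda>s'. agree ?X s s' \<and> realv s' ''thr'' 0 = 0"
    show "halts (''thr'' :== RConst 0) s 1 ?Q1"
      by (rule halts_RAssign) (auto intro: agree_real_update agree_refl)
    fix s1 assume s1: "?Q1 s1"
    have p1: "realv s1 ''proc'' j = p j" using agree_realv[of ?X s s1 "''proc''"] s1 pj by simp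
    show "halts (''unit'' :== RVar ''proc'' (N ''j'') ;; ''w'' ::= NConst 1 ;; ''i'' ::= N ''base'' ;;
      While (NLess (N ''w'') (N ''K'')) threshold_step) s1 (6 * n + 4)
      (\<lambda>s'. agree ?X s s' \<and> realv s' ''thr'' 0 = real (thresholds n \<omega> j) * p j)"
    proof (rule halts_Seq[where B = 1 and C = "6 * n + 3"])
      let ?Q2 = "\<lambda>s'. agree ?X s s' \<and> realv s' ''thr'' 0 = 0 \<and> realv s' ''unit'' 0 = p j"
      show "halts (''unit'' :== RVar ''proc'' (N ''j'')) s1 1 ?Q2"
        by (rule halts_RAssign) (use s1 p1 inp(2)[of s1] in \<open>auto intro: agree_real_update\<close>)
      fix s2 assume s2: "?Q2 s2"
      show "halts (''w'' ::= NConst 1 ;; ''i'' ::= N ''base'' ;;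
        While (NLess (N ''w'') (N ''K'')) threshold_step) s2 (6 * n + 3)
        (\<lambda>s'. agree ?X s s' \<and> realv s' ''thr'' 0 = real (thresholds n \<omega> j) * p j)"
      proof (rule halts_Seq[where B = 1 and C = "6 * n + 2"])
        let ?Q3 = "\<lambda>s'. ?Q2 s' \<and> natv s' ''w'' 0 = 1"
        show "halts (''w'' ::= NConst 1) s2 1 ?Q3"
          by (rule halts_NAssign) (use s2 in \<open>auto intro: agree_nat_update\<close>)
        fix s3 assume s3: "?Q3 s3"
        show "halts (''i'' ::= N ''base'' ;;
          While (NLess (N ''w'') (N ''K'')) threshold_step) s3 (6 * n + 2)
          (\<lambda>s'. agree ?X s s' \<and> realv s' ''thr'' 0 = real (thresholds n \<omega> j) * p j)"
        proof (rule halts_Seq[where B = 1 and C = "6 * n + 1" and R = "?I ?b", OF _ loop])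
          show "halts (''i'' ::= N ''base'') s3 1 (?I ?b)"
            by (rule halts_NAssign) (use s3 inp(3)[of s3] in \<open>auto intro: agree_nat_update\<close>)
        qed auto
      qed simp
    qed simp
  qed simp
qed

end

context decision_input
begin

abbreviation "U \<equiv> thresholds n \<omega>"

definition scanned :: "nat \<Rightarrow> store \<Rightarrow> bool" where
  "scanned k s \<longleftrightarrow> inputs s \<and> natv s ''K'' 0 = bound n \<and> natv s ''base'' 0 = k * n \<and>
    natv s ''cnt'' 0 = card (pend J t S \<inter> {..<k}) \<and>
    (pend J t S \<inter> {..<k} \<noteq> {} \<longrightarrow> natv s ''best'' 0 = shortest J (pend J t S \<inter> {..<k})) \<and>
    natv s ''found'' 0 = (if ripe J U t S \<inter> {..<k} = {} then n else LEAST j. j \<in> ripe J U t S \<inter> {..<k})"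

lemma inputs_nat_update:
  "inputs s \<Longrightarrow> x \<in> {''K'', ''sq'', ''cnt'', ''base'', ''found'', ''best'', ''w'', ''i'', ''j''} \<Longrightarrow>
    inputs (nat_update x i v s)"
  by (rule inputs_agree[OF agree_nat_update[OF agree_refl, of x "{x}"]]) auto

lemma scanned_nat_update_j: "scanned k s \<Longrightarrow> scanned k (nat_update ''j'' i v s)"
  unfolding scanned_def by (auto intro: inputs_nat_update)

lemma select_com:
  assumes k: "k < n" and s: "scanned k s" and j: "natv s ''j'' 0 = k"
  shows "halts select_com s (12 * n + 16) (\<lambda>s'. scanned (Suc k) (nat_update ''j'' 0 (Suc k) s') \<and>
    natv s' ''j'' 0 = k \<and> natv s' ''n'' 0 = n)"
  unfolding select_com_def
proof (rule halts_Seq[where B = "12 * n + 15" and C = 1])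
  let ?A = "\<lambda>k. pend J t S \<inter> {..<k}" and ?R = "\<lambda>k. ripe J U t S \<inter> {..<k}"
  let ?f = "\<lambda>k. if ?R k = {} then n else LEAST j. j \<in> ?R k"
  let ?core = "\<lambda>s'. inputs s' \<and> natv s' ''K'' 0 = bound n \<and> natv s' ''base'' 0 = k * n \<and> natv s' ''j'' 0 = k"
  let ?next = "\<lambda>s'. ?core s' \<and> natv s' ''cnt'' 0 = card (?A (Suc k)) \<and>
    (?A (Suc k) \<noteq> {} \<longrightarrow> natv s' ''best'' 0 = shortest J (?A (Suc k))) \<and> natv s' ''found'' 0 = ?f (Suc k)"
  have core: "?core s" and cnt: "natv s ''cnt'' 0 = card (?A k)"
    and best: "?A k \<noteq> {} \<Longrightarrow> natv s ''best'' 0 = shortest J (?A k)" and found: "natv s ''found'' 0 = ?f k"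
    using s j unfolding scanned_def by auto
  have fin: "finite (?A k)" by simp
  have kn: "natv s ''known'' k = of_bool (r k \<le> t)" "natv s ''started'' k = of_bool (k \<in> dom S)"
    using core k unfolding inputs_def by auto
  have Rsub: "?R k \<subseteq> ?A k" for k using ripe_subset[of J U t S] by auto
  show "halts (If (And (NLess (NConst 0) (NVar ''known'' (N ''j''))) (NLess (NVar ''started'' (N ''j'')) (NConst 1)))
      (If (And (NLess (NConst 0) (N ''cnt''))
            (Not (RLess (RVar ''proc'' (N ''j'')) (RVar ''proc'' (N ''best'')))))
          Skip (''best'' ::= N ''j'') ;;
       ''cnt'' ::= NPlus (N ''cnt'') (NConst 1) ;;
       idle_com ;; threshold_com ;;
       If (And (Not (NLess (N ''found'') (N ''n''))) (Not (RLess (R ''idl'') (R ''thr''))))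
          (''found'' ::= N ''j'') Skip)
      Skip) s (12 * n + 15) ?next"
  proof (rule halts_If[where B = "12 * n + 14"])
    assume "bval s (And (NLess (NConst 0) (NVar ''known'' (N ''j''))) (NLess (NVar ''started'' (N ''j'')) (NConst 1)))"
    then have rk: "r k \<le> t" "k \<notin> dom S" using j kn by (auto split: if_splits)
    then have kA: "k \<in> pend J t S" using k by (simp add: pend_def)
    then have AS: "?A (Suc k) = insert k (?A k)" by auto
    have pk: "realv s ''proc'' k = p k" using core k rk unfolding inputs_def by blast
    have cntS: "card (?A (Suc k)) = Suc (card (?A k))" unfolding AS by simp
    have short: "shortest J (?A (Suc k)) = (if ?A k = {} \<or> p k < p (shortest J (?A k)) then k else shortest J (?A k))"
    proof (cases "?A k = {}")
      case True
      then show ?thesis unfolding AS by (auto intro: shortest_eqI)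
    next
      case False
      then show ?thesis unfolding AS using shortest_insert[OF fin False, of k J] by auto
    qed
    have pb: "realv s ''proc'' (natv s ''best'' 0) = p (shortest J (?A k))" if "?A k \<noteq> {}"
    proof -
      have "shortest J (?A k) \<in> pend J t S" using shortest(1)[OF fin that] by blast
      then show ?thesis using best[OF that] core unfolding pend_def inputs_def by auto
    qed
    let ?Q1 = "\<lambda>s'. ?core s' \<and> natv s' ''cnt'' 0 = card (?A k) \<and>
      natv s' ''best'' 0 = shortest J (?A (Suc k)) \<and> natv s' ''found'' 0 = ?f k"
    show "halts (If (And (NLess (NConst 0) (N ''cnt''))
            (Not (RLess (RVar ''proc'' (N ''j'')) (RVar ''proc'' (N ''best'')))))
          Skip (''best'' ::= N ''j'') ;;
       ''cnt'' ::= NPlus (N ''cnt'') (NConst 1) ;;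
       idle_com ;; threshold_com ;;
       If (And (Not (NLess (N ''found'') (N ''n''))) (Not (RLess (R ''idl'') (R ''thr''))))
          (''found'' ::= N ''j'') Skip) s (12 * n + 14) ?next"
    proof (rule halts_Seq[where B = 2 and C = "12 * n + 12" and R = ?Q1])
      show "halts (If (And (NLess (NConst 0) (N ''cnt''))
            (Not (RLess (RVar ''proc'' (N ''j'')) (RVar ''proc'' (N ''best'')))))
          Skip (''best'' ::= N ''j'')) s 2 ?Q1"
      proof (rule halts_If[where B = 1])
        assume b: "bval s (And (NLess (NConst 0) (N ''cnt''))
            (Not (RLess (RVar ''proc'' (N ''j'')) (RVar ''proc'' (N ''best'')))))"
        then have ne: "?A k \<noteq> {}" using cnt by auto
        then have "\<not> p k < p (shortest J (?A k))" using b pb[OF ne] pk j by simp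
        then have "shortest J (?A (Suc k)) = shortest J (?A k)" using short ne by simp
        then show "halts Skip s 1 ?Q1"
          using core cnt best[OF ne] found by (intro halts_Skip) auto
      next
        assume b: "\<not> bval s (And (NLess (NConst 0) (N ''cnt''))
            (Not (RLess (RVar ''proc'' (N ''j'')) (RVar ''proc'' (N ''best'')))))"
        have "?A k = {} \<or> p k < p (shortest J (?A k))"
        proof (cases "?A k = {}")
          case ne: False
          then have "0 < card (?A k)" using fin by (simp add: card_gt_0_iff)
          then show ?thesis using b cnt pb[OF ne] pk j by simp
        qed simp
        then have "shortest J (?A (Suc k)) = k" using short by simp
        then show "halts (''best'' ::= N ''j'') s 1 ?Q1"
          using core cnt found by (intro halts_NAssign) (auto intro: inputs_nat_update)
      qed simp
      fix s1 assume s1: "?Q1 s1"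
      let ?Q2 = "\<lambda>s'. ?core s' \<and> natv s' ''cnt'' 0 = card (?A (Suc k)) \<and>
        natv s' ''best'' 0 = shortest J (?A (Suc k)) \<and> natv s' ''found'' 0 = ?f k"
      show "halts (''cnt'' ::= NPlus (N ''cnt'') (NConst 1) ;;
       idle_com ;; threshold_com ;;
       If (And (Not (NLess (N ''found'') (N ''n''))) (Not (RLess (R ''idl'') (R ''thr''))))
          (''found'' ::= N ''j'') Skip) s1 (12 * n + 12) ?next"
      proof (rule halts_Seq[where B = 1 and C = "12 * n + 11" and R = ?Q2])
        show "halts (''cnt'' ::= NPlus (N ''cnt'') (NConst 1)) s1 1 ?Q2"
          by (rule halts_NAssign) (use s1 cntS in \<open>auto intro: inputs_nat_update\<close>)
        fix s2 assume s2: "?Q2 s2"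
        let ?Q3 = "\<lambda>s'. ?Q2 s' \<and> realv s' ''idl'' 0 = idle J t S k"
        show "halts (idle_com ;; threshold_com ;;
          If (And (Not (NLess (N ''found'') (N ''n''))) (Not (RLess (R ''idl'') (R ''thr''))))
          (''found'' ::= N ''j'') Skip) s2 (12 * n + 11) ?next"
        proof (rule halts_Seq[where B = "6 * n + 3" and C = "6 * n + 8" and R = ?Q3])
          have i2: "inputs s2" "natv s2 ''j'' 0 = k" using s2 by blast+
          show "halts idle_com s2 (6 * n + 3) ?Q3"
          proof (rule halts_mono[OF idle_com[OF i2 k rk(1)]])
            fix s' assume a: "agree {''i'', ''idl''} s2 s' \<and> realv s' ''idl'' 0 = idle J t S k"
            then have "natv s' x = natv s2 x" if "x \<in> {''K'', ''base'', ''cnt'', ''best'', ''found'', ''j''}" for x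
              by (intro agree_natv[of "{''i'', ''idl''}" s2 s' x]) (use that in auto)
            moreover have "inputs s'" by (rule inputs_agree[of "{''i'', ''idl''}" s2]) (use a i2 in auto)
            ultimately show "?Q3 s'" using a s2 by simp
          qed simp
          fix s3 assume s3: "?Q3 s3"
          let ?Q4 = "\<lambda>s'. ?Q3 s' \<and> realv s' ''thr'' 0 = real (U k) * p k"
          show "halts (threshold_com ;;
            If (And (Not (NLess (N ''found'') (N ''n''))) (Not (RLess (R ''idl'') (R ''thr''))))
            (''found'' ::= N ''j'') Skip) s3 (6 * n + 8) ?next"
          proof (rule halts_Seq[where B = "6 * n + 5" and C = 2 and R = ?Q4])
            have i3: "inputs s3" "natv s3 ''j'' 0 = k" "natv s3 ''base'' 0 = k * n" "natv s3 ''K'' 0 = bound n"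
              using s3 by blast+
            let ?X = "{''i'', ''thr'', ''unit'', ''w''}"
            show "halts threshold_com s3 (6 * n + 5) ?Q4"
            proof (rule halts_mono[OF threshold_com[OF i3(1,2) k rk(1) i3(3,4)]])
              fix s' assume a: "agree ?X s3 s' \<and> realv s' ''thr'' 0 = real (U k) * p k"
              then have "natv s' x = natv s3 x" if "x \<in> {''K'', ''base'', ''cnt'', ''best'', ''found'', ''j''}" for x
                by (intro agree_natv[of ?X s3 s' x]) (use that in auto)
              moreover have "realv s' ''idl'' = realv s3 ''idl''"
                by (rule agree_realv[of ?X]) (use a in auto)
              moreover have "inputs s'" by (rule inputs_agree[of ?X s3]) (use a i3 in auto)
              ultimately show "?Q4 s'" using a s3 by simp
            qed simp
            fix s4 assume s4: "?Q4 s4"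
            have n4: "natv s4 ''n'' 0 = n" using s4 unfolding inputs_def by blast
            have lt: "(LEAST j. j \<in> ?R k) < n" if "?R k \<noteq> {}"
            proof -
              have "(LEAST j. j \<in> ?R k) \<in> ?R k" by (rule LeastI_ex) (use that in blast)
              then show ?thesis using k by auto
            qed
            have ripe: "k \<in> ripe J U t S \<longleftrightarrow> real (U k) * p k \<le> idle J t S k"
              using kA by (simp add: ripe_def)
            show "halts (If (And (Not (NLess (N ''found'') (N ''n''))) (Not (RLess (R ''idl'') (R ''thr''))))
              (''found'' ::= N ''j'') Skip) s4 2 ?next"
            proof (rule halts_If[where B = 1])
              assume b: "bval s4 (And (Not (NLess (N ''found'') (N ''n''))) (Not (RLess (R ''idl'') (R ''thr''))))"
              then have "k \<in> ripe J U t S" using s4 ripe by simp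
              moreover have e: "?R k = {}" using b s4 n4 lt by (auto split: if_splits)
              ultimately have "?f (Suc k) = k" using Least_initial(2)[of "ripe J U t S" k] by auto
              then show "halts (''found'' ::= N ''j'') s4 1 ?next"
                by (intro halts_NAssign) (use s4 in \<open>auto intro: inputs_nat_update\<close>)
            next
              assume b: "\<not> bval s4 (And (Not (NLess (N ''found'') (N ''n''))) (Not (RLess (R ''idl'') (R ''thr''))))"
              have "?f (Suc k) = ?f k"
              proof (cases "?R k = {}")
                case True
                then have "k \<notin> ripe J U t S" using b s4 n4 ripe by simp
                then have "?R (Suc k) = ?R k" by (auto simp: less_Suc_eq)
                then show ?thesis by (simp only:)
              next
                case False
                then have "?R (Suc k) \<noteq> {}" by (auto simp: less_Suc_eq)
                then show ?thesis using False Least_initial(1)[OF False] by simp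
              qed
              then show "halts Skip s4 1 ?next" by (intro halts_Skip) (use s4 in auto)
            qed simp
          qed simp
        qed simp
      qed simp
    qed simp
  next
    assume "\<not> bval s (And (NLess (NConst 0) (NVar ''known'' (N ''j''))) (NLess (NVar ''started'' (N ''j'')) (NConst 1)))"
    then have "k \<notin> pend J t S" using j kn by (auto simp: pend_def split: if_splits)
    then have nk: "k \<notin> pend J t S" "k \<notin> ripe J U t S" using ripe_subset[of J U t S] by auto
    have A: "?A (Suc k) = ?A k" using nk(1) by (auto simp: less_Suc_eq)
    have R: "?R (Suc k) = ?R k" using nk(2) by (auto simp: less_Suc_eq)
    show "halts Skip s (12 * n + 14) ?next"
      unfolding A R by (rule halts_Skip) (use core cnt best found in auto)
  qed simp
  fix s1 assume s1: "?next s1"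
  have "natv s1 ''n'' 0 = n" using s1 unfolding inputs_def by blast
  with s1 show "halts (''base'' ::= NPlus (N ''base'') (N ''n'')) s1 1
    (\<lambda>s'. scanned (Suc k) (nat_update ''j'' 0 (Suc k) s') \<and> natv s' ''j'' 0 = k \<and> natv s' ''n'' 0 = n)"
    by (intro halts_NAssign) (auto simp: scanned_def intro!: inputs_nat_update)
qed simp

lemma output_com:
  assumes "scanned n s"
  shows "halts output_com s 5 (\<lambda>s'. decision_of s' = decide J (bound n) U t S)"
proof -
  have A: "pend J t S \<inter> {..<n} = pend J t S" by (auto simp: pend_def)
  have R: "ripe J U t S \<inter> {..<n} = ripe J U t S" using ripe_subset[of J U t S] A by blast
  have s: "inputs s" "natv s ''K'' 0 = bound n" "natv s ''cnt'' 0 = card (pend J t S)"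
    "pend J t S \<noteq> {} \<Longrightarrow> natv s ''best'' 0 = shortest J (pend J t S)"
    "natv s ''found'' 0 = (if ripe J U t S = {} then n else LEAST j. j \<in> ripe J U t S)"
    using assms unfolding scanned_def A R by auto
  have sn: "natv s ''n'' 0 = n" "realv s ''now'' 0 = t" using s(1) unfolding inputs_def by blast+
  have ripe_lt: "ripe J U t S \<noteq> {} \<longleftrightarrow> natv s ''found'' 0 < n"
  proof -
    have "(LEAST j. j \<in> ripe J U t S) < n" if "ripe J U t S \<noteq> {}"
      using Least_ripe[OF that] R by blast
    then show ?thesis using s(5) by simp
  qed
  have card0: "0 < card (pend J t S) \<longleftrightarrow> pend J t S \<noteq> {}" by (simp add: card_gt_0_iff)
  show ?thesis
    unfolding output_com_def
  proof (rule halts_If[where B = 4])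
    assume "bval s (NLess (N ''K'') (N ''cnt''))"
    then have c: "bound n < card (pend J t S)" using s by simp
    then have "pend J t S \<noteq> {}" by auto
    then show "halts (''act'' ::= NConst 0 ;; ''job'' ::= N ''best'') s 4
      (\<lambda>s'. decision_of s' = decide J (bound n) U t S)"
      using c s by (intro halts_Seq[where B = 1 and C = 1 and R = "\<lambda>s'. s' = nat_update ''act'' 0 0 s"]
        halts_NAssign) (auto simp: decision_of_def decide_def intro!: halts_NAssign)
  next
    assume "\<not> bval s (NLess (N ''K'') (N ''cnt''))"
    then have c: "\<not> bound n < card (pend J t S)" using s by simp
    show "halts (If (NLess (N ''found'') (N ''n'')) (''act'' ::= NConst 0 ;; ''job'' ::= N ''found'')
      (If (NLess (NConst 0) (N ''cnt''))
        (''act'' ::= NConst 2 ;; ''until'' :== RPlus (R ''now'') (RVar ''proc'' (N ''best'')))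
        (''act'' ::= NConst 1))) s 4 (\<lambda>s'. decision_of s' = decide J (bound n) U t S)"
    proof (rule halts_If[where B = 3])
      assume "bval s (NLess (N ''found'') (N ''n''))"
      then have r: "ripe J U t S \<noteq> {}" using ripe_lt sn by simp
      then show "halts (''act'' ::= NConst 0 ;; ''job'' ::= N ''found'') s 3
        (\<lambda>s'. decision_of s' = decide J (bound n) U t S)"
        using c s by (intro halts_Seq[where B = 1 and C = 1 and R = "\<lambda>s'. s' = nat_update ''act'' 0 0 s"]
          halts_NAssign) (auto simp: decision_of_def decide_def intro!: halts_NAssign)
    next
      assume "\<not> bval s (NLess (N ''found'') (N ''n''))"
      then have r: "ripe J U t S = {}" using ripe_lt sn by simp
      show "halts (If (NLess (NConst 0) (N ''cnt''))
        (''act'' ::= NConst 2 ;; ''until'' :== RPlus (R ''now'') (RVar ''proc'' (N ''best'')))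
        (''act'' ::= NConst 1)) s 3 (\<lambda>s'. decision_of s' = decide J (bound n) U t S)"
      proof (rule halts_If[where B = 2])
        assume "bval s (NLess (NConst 0) (N ''cnt''))"
        then have ne: "pend J t S \<noteq> {}" using s card0 by simp
        have "shortest J (pend J t S) \<in> pend J t S" by (rule shortest(1)[OF finite_pend ne])
        then have "realv s ''proc'' (shortest J (pend J t S)) = p (shortest J (pend J t S))"
          using s(1) unfolding pend_def inputs_def by blast
        then show "halts (''act'' ::= NConst 2 ;; ''until'' :== RPlus (R ''now'') (RVar ''proc'' (N ''best''))) s 2
          (\<lambda>s'. decision_of s' = decide J (bound n) U t S)"
          using c r ne s sn by (intro halts_Seq[where B = 1 and C = 1 and R = "\<lambda>s'. s' = nat_update ''act'' 0 2 s"]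
            halts_NAssign) (auto simp: decision_of_def decide_def intro!: halts_RAssign)
      next
        assume "\<not> bval s (NLess (NConst 0) (N ''cnt''))"
        then have "pend J t S = {}" using s card0 by simp
        then show "halts (''act'' ::= NConst 1) s 2 (\<lambda>s'. decision_of s' = decide J (bound n) U t S)"
          using c r by (intro halts_NAssign) (auto simp: decision_of_def decide_def)
      qed simp
    qed simp
  qed simp
qed

lemma decide_com:
  assumes "1 \<le> n"
  shows "\<exists>k s. exec decide_com (input_store n \<omega> t (known_jobs J t) S) k s \<and> k \<le> 40 * n * n + 40 \<and>
    decision_of s = decide J (bound n) U t S"
proof -
  let ?s = "input_store n \<omega> t (known_jobs J t) S"
  let ?Q = "\<lambda>s'. decision_of s' = decide J (bound n) U t S"
  have inp: "inputs ?s" by (rule inputs_input_store)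
  have "halts decide_com ?s (40 * n * n + 40) ?Q"
    unfolding decide_com_def
  proof (rule halts_Seq[where B = "3 * n + 3" and C = "12 * n * n + 18 * n + 10" and
      R = "\<lambda>s'. inputs s' \<and> natv s' ''K'' 0 = bound n"])
    have "natv ?s ''n'' 0 = n" using inp unfolding inputs_def by blast
    from root_com[OF this assms]
    show "halts root_com ?s (3 * n + 3) (\<lambda>s'. inputs s' \<and> natv s' ''K'' 0 = bound n)"
    proof (rule halts_mono)
      fix s' assume s': "agree {''K'', ''sq''} ?s s' \<and> natv s' ''K'' 0 = bound n"
      have "inputs s'" by (rule inputs_agree[of "{''K'', ''sq''}" ?s]) (use s' inp in auto)
      then show "inputs s' \<and> natv s' ''K'' 0 = bound n" using s' by blast
    qed simp
    fix s1 assume s1: "inputs s1 \<and> natv s1 ''K'' 0 = bound n"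
    show "halts (''cnt'' ::= NConst 0 ;; ''base'' ::= NConst 0 ;; ''found'' ::= N ''n'' ;;
      for_loop ''j'' ''n'' select_com ;; output_com) s1 (12 * n * n + 18 * n + 10) ?Q"
    proof (rule halts_Seq[where B = 1 and C = "12 * n * n + 18 * n + 9" and
        R = "\<lambda>s'. inputs s' \<and> natv s' ''K'' 0 = bound n \<and> natv s' ''cnt'' 0 = 0"])
      show "halts (''cnt'' ::= NConst 0) s1 1
          (\<lambda>s'. inputs s' \<and> natv s' ''K'' 0 = bound n \<and> natv s' ''cnt'' 0 = 0)"
        by (rule halts_NAssign) (use s1 in \<open>auto intro: inputs_nat_update\<close>)
      fix s2 assume s2: "inputs s2 \<and> natv s2 ''K'' 0 = bound n \<and> natv s2 ''cnt'' 0 = 0"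
      show "halts (''base'' ::= NConst 0 ;; ''found'' ::= N ''n'' ;;
        for_loop ''j'' ''n'' select_com ;; output_com) s2 (12 * n * n + 18 * n + 9) ?Q"
      proof (rule halts_Seq[where B = 1 and C = "12 * n * n + 18 * n + 8" and
          R = "\<lambda>s'. inputs s' \<and> natv s' ''K'' 0 = bound n \<and> natv s' ''cnt'' 0 = 0 \<and> natv s' ''base'' 0 = 0"])
        show "halts (''base'' ::= NConst 0) s2 1 (\<lambda>s'. inputs s' \<and> natv s' ''K'' 0 = bound n \<and>
            natv s' ''cnt'' 0 = 0 \<and> natv s' ''base'' 0 = 0)"
          by (rule halts_NAssign) (use s2 in \<open>auto intro: inputs_nat_update\<close>)
        fix s3 assume s3: "inputs s3 \<and> natv s3 ''K'' 0 = bound n \<and>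
            natv s3 ''cnt'' 0 = 0 \<and> natv s3 ''base'' 0 = 0"
        have n3: "natv s3 ''n'' 0 = n" using s3 unfolding inputs_def by blast
        show "halts (''found'' ::= N ''n'' ;; for_loop ''j'' ''n'' select_com ;; output_com) s3
          (12 * n * n + 18 * n + 8) ?Q"
        proof (rule halts_Seq[where B = 1 and C = "12 * n * n + 18 * n + 7" and R = "scanned 0"])
          show "halts (''found'' ::= N ''n'') s3 1 (scanned 0)"
            by (rule halts_NAssign) (use s3 n3 in \<open>auto simp: scanned_def intro: inputs_nat_update\<close>)
          fix s4 assume s4: "scanned 0 s4"
          show "halts (for_loop ''j'' ''n'' select_com ;; output_com) s4 (12 * n * n + 18 * n + 7) ?Q"
          proof (rule halts_Seq[where B = "12 * n * n + 18 * n + 2" and C = 5 and R = "scanned n"])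
            show "halts (for_loop ''j'' ''n'' select_com) s4 (12 * n * n + 18 * n + 2) (scanned n)"
            proof (rule halts_for[where I = scanned and m = n and B = "12 * n + 16"])
              show "scanned 0 (nat_update ''j'' 0 0 s4)" using s4 by (rule scanned_nat_update_j)
              show "natv s4 ''n'' 0 = n" using s4 unfolding scanned_def inputs_def by blast
            qed (use select_com in \<open>simp_all add: algebra_simps\<close>)
          qed (use output_com in simp_all)
        qed simp
      qed simp
    qed simp
  next
    \<comment> \<open>The exact sum is \<open>12 * n * n + 21 * n + 13\<close>; this absorbs its
      linear term.\<close>
    have "n \<le> n * n" by (rule le_square)
    then show "3 * n + 3 + (12 * n * n + 18 * n + 10) \<le> 40 * n * n + 40" by linarith
  qed
  then show ?thesis unfolding halts_def by blast
qed

end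

section \<open>Random thresholds\<close>

text \<open>The rules of \<open>online_run\<close> build a run from its end, so the induction
  descends from \<open>horizon\<close>, where all jobs are started. At finished states the iterated
  map makes no decision and costs nothing.\<close>

lemma (in algorithm) online_run_begun:
  assumes U_less: "\<And>j. U j < K"
    and prog: "\<And>t S. dom S \<subseteq> {i. i < n \<and> r i \<le> t} \<Longrightarrow> 1 \<le> n \<Longrightarrow>
      \<exists>k s. exec c (input_store n \<omega> t (known_jobs J t) S) k s \<and> k \<le> B \<and> decision_of s = decide J K U t S"
  shows "\<exists>k. online_run c \<omega> J 0 Map.empty k (begun U horizon) \<and> k \<le> horizon * B"
proof -
  have "\<exists>k. online_run c \<omega> J (T U m) (begun U m) k (begun U horizon) \<and> k \<le> (horizon - m) * B"
    if "m \<le> horizon" for m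
    using that
  proof (induction m rule: inc_induct)
    case base
    then show ?case using run_done finished_horizon[OF U_less] by (fastforce simp: finished_def)
  next
    case (step m)
    then obtain l where l: "online_run c \<omega> J (T U (Suc m)) (begun U (Suc m)) l (begun U horizon)"
      "l \<le> (horizon - Suc m) * B" by blast
    have "horizon - m = Suc (horizon - Suc m)" using step.hyps by simp
    then have bound: "k + l \<le> (horizon - m) * B" if "k \<le> B" for k using that l(2) by simp
    show ?case
    proof (cases "finished U m")
      case True
      then show ?thesis using l bound[of 0] by (auto simp: finished_Suc)
    next
      case nf: False
      have "n \<noteq> 0"
      proof
        assume "n = 0"
        then have "dom (begun U m) = {..<n}" using dom_begun[of U m] by (metis lessThan_0 subset_empty)
        then have "finished U m" unfolding finished_def .
        then show False using nf by simp
      qed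
      then have one: "1 \<le> n" by linarith
      have sub: "dom (begun U m) \<subseteq> {i. i < n \<and> r i \<le> T U m}"
        using dom_begun started_released by blast
      obtain k s where ex: "exec c (input_store n \<omega> (T U m) (known_jobs J (T U m)) (begun U m)) k s"
        "k \<le> B" "decision_of s = decide J K U (T U m) (begun U m)"
        using prog[OF sub one] by blast
      have nd: "dom (begun U m) \<noteq> {..<n}" using nf by (simp add: finished_def)
      have "online_run c \<omega> J (T U m) (begun U m) (k + l) (begun U horizon)"
      proof (cases "decide J K U (T U m) (begun U m)")
        case (Start j)
        then have j: "starts U m j" using nf by (simp add: starts_def)
        have "j \<in> dom (known_jobs J (T U m)) - dom (begun U m)"
          using starts_pendingD[OF j] by (auto simp: known_jobs_def)
        then show ?thesis
          using run_start[OF nd ex(1) ex(3)[unfolded Start] _ l(1)[unfolded starts_Suc[OF j]]] by blast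
      next
        case Wait
        then have "pending U m = {}" by (auto simp: decide_def split: if_splits)
        note empty = this
        from nf have "later_releases J (T U m) \<noteq> {}"
        proof (cases rule: transition)
          case (start j)
          then show ?thesis using starts_pending empty by blast
        next
          case (wait j)
          then show ?thesis using empty by blast
        qed
        moreover have "state U (Suc m) = (Min (later_releases J (T U m)), begun U m)"
          using nd Wait by (simp add: state_Suc advance_def case_prod_beta)
        ultimately show ?thesis using run_wait[OF nd ex(1) ex(3)[unfolded Wait]] l(1) by simp
      next
        case (WaitUntil u)
        then have ne: "pending U m \<noteq> {}" and u: "u = T U m + p (shortest J (pending U m))"
          by (auto simp: decide_def split: if_splits)
        have "T U m < u" using shortest(1)[OF finite_pend ne, of J] pendD p_pos unfolding u by force
        moreover have "state U (Suc m) = (Min (insert u (later_releases J (T U m))), begun U m)"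
          using nd WaitUntil by (simp add: state_Suc advance_def case_prod_beta)
        ultimately show ?thesis using run_wait_until[OF nd ex(1) ex(3)[unfolded WaitUntil]] l(1) by simp
      qed
      then show ?thesis using bound[OF ex(2)] by blast
    qed
  qed
  from this[of 0] show ?thesis by simp
qed

section \<open>Thresholds as blocks of independent bits\<close>

lemma thresholds_eq_horner_sum:
  "j < n \<Longrightarrow> thresholds n \<omega> j = horner_sum of_bool 2 (map (\<lambda>l. \<omega> ! (j * n + l)) [0..<log_bound n])"
  by (simp add: thresholds_def horner_sum_eq_sum lessThan_atLeast0)

lemma thresholds_less: "thresholds n \<omega> j < bound n"
proof -
  have "(\<Sum>l<b. of_bool (\<omega> ! (j * n + l)) * 2 ^ l) < (2 :: nat) ^ b" for b
  proof (induction b)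
    case (Suc b)
    have "of_bool (\<omega> ! (j * n + b)) * 2 ^ b \<le> (2 :: nat) ^ b" by simp
    then show ?case using Suc by (simp del: of_bool_eq_iff)
  qed simp
  then show ?thesis by (simp add: thresholds_def bound_def)
qed

lemma bit_thresholds: "j < n \<Longrightarrow> l < log_bound n \<Longrightarrow> bit (thresholds n \<omega> j) l = \<omega> ! (j * n + l)"
  by (simp add: thresholds_eq_horner_sum bit_horner_sum_bit_iff)

definition recode :: "nat \<Rightarrow> nat \<Rightarrow> bool list \<Rightarrow> nat \<Rightarrow> bool list" where
  "recode n j \<omega> v = map (\<lambda>q. if j * n \<le> q \<and> q < j * n + log_bound n then bit v (q - j * n) else \<omega> ! q) [0..<n * n]"

lemma nth_recode:
  "q < n * n \<Longrightarrow> recode n j \<omega> v ! q =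
    (if j * n \<le> q \<and> q < j * n + log_bound n then bit v (q - j * n) else \<omega> ! q)"
  by (simp add: recode_def)

lemma coin_index_less:
  fixes n :: nat
  assumes "j < n" "l < n"
  shows "j * n + l < n * n"
proof -
  have "j * n + l < Suc j * n" using assms by simp
  also have "\<dots> \<le> n * n" using assms by (intro mult_le_mono1) simp
  finally show ?thesis .
qed

lemma thresholds_recode:
  assumes "j < n" "v < bound n"
  shows "thresholds n (recode n j \<omega> v) = (thresholds n \<omega>)(j := v)"
proof
  fix i
  show "thresholds n (recode n j \<omega> v) i = ((thresholds n \<omega>)(j := v)) i"
  proof (cases "i < n")
    case True
    have nth: "recode n j \<omega> v ! (i * n + l) = (if i = j then bit v l else \<omega> ! (i * n + l))"
      if l: "l < log_bound n" for l
    proof -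
      have ln: "l < n" using l log_bound_le[of n] by simp
      have lt: "i * n + l < n * n" by (rule coin_index_less[OF True ln])
      \<comment> \<open>Both positions lie in blocks of length at most \<open>n\<close> at the
        beginning of rows of length \<open>n\<close>, so a position in the block of \<open>j\<close>
        determines the row.\<close>
      have cond: "(j * n \<le> i * n + l \<and> i * n + l < j * n + log_bound n) = (i = j)"
      proof
        assume a: "j * n \<le> i * n + l \<and> i * n + l < j * n + log_bound n"
        then have "i * n + l < Suc j * n" "j * n < Suc i * n" using log_bound_le[of n] ln by simp_all
        then have "i * n < Suc j * n" "j * n < Suc i * n" by linarith+
        then have "i < Suc j" "j < Suc i" by (metis mult_less_cancel2)+
        then show "i = j" by simp
      qed (use l in auto)
      show ?thesis unfolding nth_recode[OF lt] cond by simp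
    qed
    show ?thesis
    proof (cases "i = j")
      case False
      then show ?thesis using True nth by (auto simp: thresholds_def intro!: sum.cong)
    next
      case eq: True
      have "thresholds n (recode n j \<omega> v) j = v"
      proof (rule bit_eqI)
        fix l
        show "bit (thresholds n (recode n j \<omega> v) j) l = bit v l"
        proof (cases "l < log_bound n")
          case True
          then show ?thesis using nth[OF True] assms(1) eq by (simp add: bit_thresholds)
        next
          case False
          \<comment> \<open>Beyond the block both numbers have only zero bits, being smaller than
            \<open>bound n\<close>.\<close>
          then have "bound n \<le> 2 ^ l" unfolding bound_def by (intro power_increasing) auto
          then have "v < 2 ^ l" "thresholds n (recode n j \<omega> v) j < 2 ^ l"
            using assms(2) thresholds_less[of n "recode n j \<omega> v" j] by linarith+
          then show ?thesis by (simp add: bit_iff_odd)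
        qed
      qed
      then show ?thesis using eq by simp
    qed
  next
    case False
    then show ?thesis using assms(1) by (simp add: thresholds_def)
  qed
qed

lemma recode_recode:
  assumes "j < n" "length \<omega> = n * n"
  shows "recode n j (recode n j \<omega> v) (thresholds n \<omega> j) = \<omega>"
proof (rule nth_equalityI)
  fix q assume "q < length (recode n j (recode n j \<omega> v) (thresholds n \<omega> j))"
  then have q: "q < n * n" by (simp add: recode_def)
  show "recode n j (recode n j \<omega> v) (thresholds n \<omega> j) ! q = \<omega> ! q"
  proof (cases "j * n \<le> q \<and> q < j * n + log_bound n")
    case True
    then have "q - j * n < log_bound n" by linarith
    from bit_thresholds[OF assms(1) this, of \<omega>] True q show ?thesis by (simp add: nth_recode)
  next
    case False
    then show ?thesis using q by (auto simp: nth_recode)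
  qed
qed (use assms in \<open>simp add: recode_def\<close>)

text \<open>Exchanging \<open>v\<close> with the threshold of \<open>j\<close> is an involution on pairs of coin sequences and
  values \<open>v\<close>, so the threshold of \<open>j\<close> is uniform and independent of the others.\<close>

lemma sum_thresholds_update:
  fixes f :: "(nat \<Rightarrow> nat) \<Rightarrow> real"
  assumes "j < n"
  shows "real (bound n) * (\<Sum>\<omega> | length \<omega> = n * n. f (thresholds n \<omega>))
    = (\<Sum>\<omega> | length \<omega> = n * n. \<Sum>v<bound n. f ((thresholds n \<omega>)(j := v)))"
proof -
  let ?\<Omega> = "{\<omega> :: bool list. length \<omega> = n * n}"
  let ?\<psi> = "\<lambda>(\<omega>, v). (recode n j \<omega> v, thresholds n \<omega> j)"
  have "real (bound n) * (\<Sum>\<omega>\<in>?\<Omega>. f (thresholds n \<omega>)) = (\<Sum>\<omega>\<in>?\<Omega>. \<Sum>v<bound n. f (thresholds n \<omega>))"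
    by (simp add: sum_distrib_left)
  also have "\<dots> = (\<Sum>(\<omega>, v)\<in>?\<Omega> \<times> {..<bound n}. f (thresholds n \<omega>))"
    by (rule sum.cartesian_product)
  also have "\<dots> = (\<Sum>(\<omega>, v)\<in>?\<Omega> \<times> {..<bound n}. f ((thresholds n \<omega>)(j := v)))"
  proof (rule sum.reindex_bij_witness[where i = ?\<psi> and j = ?\<psi>])
    fix x assume x: "x \<in> ?\<Omega> \<times> {..<bound n}"
    then obtain \<omega> v where [simp]: "x = (\<omega>, v)" and v: "length \<omega> = n * n" "v < bound n" by auto
    show "?\<psi> (?\<psi> x) = x" "?\<psi> (?\<psi> x) = x"
      using recode_recode[OF assms v(1)] thresholds_recode[OF assms v(2)] by simp_all
    show "?\<psi> x \<in> ?\<Omega> \<times> {..<bound n}" "?\<psi> x \<in> ?\<Omega> \<times> {..<bound n}"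
      using thresholds_less by (simp_all add: recode_def)
    show "(case ?\<psi> x of (\<omega>, v) \<Rightarrow> f ((thresholds n \<omega>)(j := v))) = (case x of (\<omega>, v) \<Rightarrow> f (thresholds n \<omega>))"
      using thresholds_recode[OF assms v(2)] by simp
  qed
  also have "\<dots> = (\<Sum>\<omega>\<in>?\<Omega>. \<Sum>v<bound n. f ((thresholds n \<omega>)(j := v)))"
    by (rule sum.cartesian_product[symmetric])
  finally show ?thesis .
qed

text \<open>No two elements differ by two or more, so only the least one and its successor can
  satisfy \<open>Q\<close>.\<close>

lemma sum_of_bool_le_2:
  fixes Q :: "nat \<Rightarrow> bool"
  assumes "\<And>v w. Q v \<Longrightarrow> Q w \<Longrightarrow> \<not> v + 2 \<le> w"
  shows "(\<Sum>v<m. of_bool (Q v)) \<le> (2 :: real)"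
proof (cases "\<exists>v. Q v")
  case True
  define v where "v = (LEAST v. Q v)"
  have v: "Q v" "\<And>w. Q w \<Longrightarrow> v \<le> w" unfolding v_def using True by (auto intro: LeastI_ex Least_le)
  have "{w. w < m \<and> Q w} \<subseteq> {v, Suc v}"
  proof
    fix w assume "w \<in> {w. w < m \<and> Q w}"
    then show "w \<in> {v, Suc v}" using v(2)[of w] assms[OF v(1), of w] by auto
  qed
  then have "card {w. w < m \<and> Q w} \<le> card {v, Suc v}" by (intro card_mono) auto
  then show ?thesis by (simp add: of_bool_def sum.If_cases Int_def)
qed simp

section \<open>The algorithm, its running time and its competitive ratio\<close>

definition delay_alg :: online_alg where
  "delay_alg = \<lparr>program = decide_com, coins = monom 1 2\<rparr>"

lemma coins_delay_alg: "poly (coins delay_alg) n = n * n"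
  by (simp add: delay_alg_def poly_monom power2_eq_square)

lemma delay_alg_run:
  assumes "valid_jobs J" "length \<omega> = length J * length J"
  defines "n \<equiv> length J"
  shows "\<exists>k. online_run (program delay_alg) \<omega> J 0 Map.empty k
      (algorithm.begun J (bound n) (thresholds n \<omega>) (n * bound n + n + 1)) \<and>
    k \<le> (n * bound n + n + 1) * (40 * n * n + 40)"
proof -
  interpret algorithm J "bound n" by unfold_locales (use assms bound_pos in auto)
  show ?thesis
    unfolding n_def[symmetric]
  proof (rule online_run_begun[folded n_def])
    show "thresholds n \<omega> j < bound n" for j by (rule thresholds_less)
    fix t :: real and S :: "nat \<rightharpoonup> real" assume S: "dom S \<subseteq> {i. i < n \<and> r i \<le> t}" "1 \<le> n"
    interpret prg: decision_input J \<omega> t S by unfold_locales (use assms S in \<open>auto simp: n_def\<close>)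
    show "\<exists>k s. exec (program delay_alg) (input_store n \<omega> t (known_jobs J t) S) k s \<and>
        k \<le> 40 * n * n + 40 \<and> decision_of s = decide J (bound n) (thresholds n \<omega>) t S"
      using prg.decide_com S(2) by (simp add: delay_alg_def n_def)
  qed
qed

lemma polynomial_time_delay_alg: "polynomial_time delay_alg"
proof -
  define q :: "nat poly" where
    "q = (monom 1 2 + [:1, 1:]) * (smult 40 (monom 1 2) + [:40:])"
  have "(n * bound n + n + 1) * (40 * n * n + 40) \<le> poly q n" for n
  proof -
    have "n * bound n \<le> n * n"
    proof (cases "n = 0")
      case False
      have "bound n \<le> bound n * bound n" by simp
      also have "\<dots> \<le> n" using False by (intro bound_squared_le) simp
      finally show ?thesis by simp
    qed simp
    then have "(n * bound n + n + 1) * (40 * n * n + 40) \<le> (n * n + n + 1) * (40 * n * n + 40)"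
      by (intro mult_le_mono1) simp
    also have "\<dots> = poly q n" by (simp add: q_def poly_monom power2_eq_square algebra_simps)
    finally show ?thesis .
  qed
  then show ?thesis
    unfolding polynomial_time_def coins_delay_alg using delay_alg_run by (meson order_trans)
qed

text \<open>With the other thresholds fixed, at most two of the \<open>K\<close> values for
  \<open>j\<close> make a given pair bad. The mean of the bad sum, doubled in
  \<open>flow_le\<close>, is thus at most \<open>4 * n * V / K \<le> 16 * K * V\<close>, and 17 plus
  16 gives 33.\<close>

lemma (in comparison) sum_flow_le:
  assumes K: "K = bound n" and n: "1 \<le> n"
  shows "(\<Sum>\<omega> | length \<omega> = n * n. nonpreemptive_flow J (begun (thresholds n \<omega>) horizon))
    \<le> card {\<omega> :: bool list. length \<omega> = n * n} * (33 * real K * total_flow J compl)"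
proof -
  let ?\<Omega> = "{\<omega> :: bool list. length \<omega> = n * n}" and ?F = "total_flow J compl"
  let ?b = "\<lambda>U j k. of_bool (bad U j k) :: real"
  have U_less: "thresholds n \<omega> j < K" for \<omega> j unfolding K by (rule thresholds_less)
  have n_le: "n \<le> 4 * K * K" using less_bound_squared[of n] K by simp
  have bad: "(\<Sum>\<omega>\<in>?\<Omega>. ?b (thresholds n \<omega>) j k) \<le> 2 * card ?\<Omega> / K" if j: "j < n" for j k
  proof -
    have "real K * (\<Sum>\<omega>\<in>?\<Omega>. ?b (thresholds n \<omega>) j k)
        = (\<Sum>\<omega>\<in>?\<Omega>. \<Sum>v<bound n. ?b ((thresholds n \<omega>)(j := v)) j k)"
      unfolding K by (rule sum_thresholds_update[OF j])
    also have "\<dots> \<le> (\<Sum>\<omega>\<in>?\<Omega>. 2)"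
    proof (intro sum_mono sum_of_bool_le_2)
      fix \<omega> v w assume b: "bad ((thresholds n \<omega>)(j := v)) j k" "bad ((thresholds n \<omega>)(j := w)) j k"
      show "\<not> v + 2 \<le> w"
      proof
        assume "v + 2 \<le> w"
        then show False
          using bad_coupled[where U = "(thresholds n \<omega>)(j := v)" and U' = "(thresholds n \<omega>)(j := w)" and j = j, OF _ _ b(1)] b(2)
          by simp
      qed
    qed
    finally show ?thesis using K_pos by (simp add: field_simps)
  qed
  have V: "(\<Sum>j<n. p j) \<le> ?F"
    unfolding total_flow_def by (intro sum_mono proc_le_completion[OF valid sched]) auto
  have "(\<Sum>\<omega>\<in>?\<Omega>. nonpreemptive_flow J (begun (thresholds n \<omega>) horizon))
      \<le> (\<Sum>\<omega>\<in>?\<Omega>. 17 * real K * ?F + 2 * (\<Sum>j<n. \<Sum>k<n. p j * ?b (thresholds n \<omega>) j k))"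
    by (intro sum_mono flow_le[OF U_less n_le])
  also have "\<dots> = card ?\<Omega> * (17 * real K * ?F)
      + 2 * (\<Sum>j<n. \<Sum>k<n. p j * (\<Sum>\<omega>\<in>?\<Omega>. ?b (thresholds n \<omega>) j k))"
    unfolding sum.distrib sum_distrib_left[symmetric] sum.swap[where A = ?\<Omega>] by simp
  also have "(\<Sum>j<n. \<Sum>k<n. p j * (\<Sum>\<omega>\<in>?\<Omega>. ?b (thresholds n \<omega>) j k))
      \<le> (\<Sum>j<n. \<Sum>k<n. p j * (2 * card ?\<Omega> / K))"
    by (intro sum_mono mult_left_mono bad) (use p_pos in \<open>auto intro: less_imp_le\<close>)
  also have "\<dots> = real n * ((\<Sum>j<n. p j) * (2 * card ?\<Omega> / K))"
    by (simp only: sum_constant card_lessThan sum_distrib_left[symmetric] sum_distrib_right[symmetric])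
  also have "\<dots> = 2 * real (card ?\<Omega>) * (n / K) * (\<Sum>j<n. p j)" by simp
  also have "\<dots> \<le> 2 * real (card ?\<Omega>) * (4 * real K) * (\<Sum>j<n. p j)"
  proof (rule mult_right_mono[OF mult_left_mono])
    have "real n \<le> real (4 * K * K)" using n_le of_nat_mono by blast
    then show "real n / K \<le> 4 * real K" using K_pos by (simp add: divide_le_eq)
    show "0 \<le> (\<Sum>j<n. p j)" by (rule sum_p_nonneg) simp
  qed simp
  also have "\<dots> \<le> 2 * real (card ?\<Omega>) * (4 * real K) * ?F" by (rule mult_left_mono[OF V]) simp
  finally show ?thesis by (simp add: algebra_simps)
qed

lemma bound_le_sqrt: "1 \<le> n \<Longrightarrow> real (bound n) \<le> sqrt (real n)"
  by (rule real_le_rsqrt) (use bound_squared_le[of n] in \<open>simp add: power2_eq_square flip: of_nat_mult\<close>)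

lemma expected_flow_delay_alg:
  assumes J: "valid_jobs J" and P: "preemptive_schedule J P"
  shows "expected_flow delay_alg J \<le> 33 * sqrt (length J) * total_flow J (completion P)"
proof -
  define n where "n = length J"
  let ?\<Omega> = "{\<omega> :: bool list. length \<omega> = n * n}"
  interpret comparison J "bound n" P by unfold_locales (use J P bound_pos in auto)
  have fin: "finite ?\<Omega>" using finite_lists_length_eq[of "UNIV :: bool set" "n * n"] by simp
  have "replicate (n * n) True \<in> ?\<Omega>" by simp
  then have ne: "?\<Omega> \<noteq> {}" by blast
  have card: "0 < card ?\<Omega>" using fin ne by (simp add: card_gt_0_iff)
  have sch: "schedule_of (program delay_alg) \<omega> J = begun (thresholds n \<omega>) (n * bound n + n + 1)"
    if "\<omega> \<in> ?\<Omega>" for \<omega>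
    using delay_alg_run[OF J, of \<omega>] that schedule_of_eq unfolding n_def by auto
  have "expected_flow delay_alg J
      = (\<Sum>\<omega>\<in>?\<Omega>. nonpreemptive_flow J (schedule_of (program delay_alg) \<omega> J)) / card ?\<Omega>"
    unfolding expected_flow_def coins_delay_alg n_def[symmetric]
    by (rule integral_pmf_of_set[OF ne fin])
  also have "\<dots> = (\<Sum>\<omega>\<in>?\<Omega>. nonpreemptive_flow J (begun (thresholds n \<omega>) (n * bound n + n + 1))) / card ?\<Omega>"
    using sch by (intro arg_cong2[where f = "(/)"] sum.cong refl) auto
  finally have E: "expected_flow delay_alg J
      = (\<Sum>\<omega>\<in>?\<Omega>. nonpreemptive_flow J (begun (thresholds n \<omega>) (n * bound n + n + 1))) / card ?\<Omega>" .
  show ?thesis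
  \<comment> \<open>\<open>bound 0\<close> is 1 and exceeds \<open>sqrt 0\<close>, but the empty
    instance has flow 0.\<close>
  proof (cases "n = 0")
    case True
    then have "J = []" by (simp add: n_def)
    then show ?thesis unfolding E by (simp add: nonpreemptive_flow_def total_flow_def)
  next
    case False
    have F: "0 \<le> total_flow J compl" by (rule total_flow_completion_nonneg[OF P J])
    have "expected_flow delay_alg J \<le> card ?\<Omega> * (33 * real (bound n) * total_flow J compl) / card ?\<Omega>"
      unfolding E using sum_flow_le[folded n_def, OF refl] False
      by (intro divide_right_mono) auto
    also have "\<dots> = 33 * real (bound n) * total_flow J compl" using card by simp
    also have "\<dots> \<le> 33 * sqrt n * total_flow J compl"
      using F bound_le_sqrt[of n] False by (intro mult_right_mono mult_left_mono) auto
    finally show ?thesis unfolding n_def .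
  qed
qed

lemma competitive_delay_alg: "competitive delay_alg (\<lambda>n. 33 * sqrt (real n))"
  unfolding competitive_def
proof (intro allI impI)
  fix J assume J: "valid_jobs J"
  obtain P0 where P0: "preemptive_schedule J P0" using preemptive_schedule_exists[OF J] by blast
  let ?F = "{total_flow J (completion P) | P. preemptive_schedule J P}"
  let ?c = "33 * sqrt (real (length J))" and ?E = "expected_flow delay_alg J"
  have E: "?E \<le> ?c * x" if "x \<in> ?F" for x using that expected_flow_delay_alg[OF J] by auto
  show "?E \<le> ?c * OPT J"
  proof (cases "J = []")
    case True
    then show ?thesis using expected_flow_delay_alg[OF J P0] by simp
  next
    case False
    then have c: "0 < ?c" by simp
    \<comment> \<open>\<open>OPT\<close> is defined as an infimum, so the factor is moved to the
      left to obtain a lower bound on all flows; this division is why the empty instance, with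
      factor 0, is separate.\<close>
    have "?E / ?c \<le> OPT J"
      unfolding OPT_def
    proof (rule cInf_greatest)
      show "?F \<noteq> {}" using P0 by blast
      show "?E / ?c \<le> x" if "x \<in> ?F" for x
        using E[OF that] c by (simp add: divide_le_eq mult.commute)
    qed
    then show ?thesis using c by (simp add: divide_le_eq mult.commute)
  qed
qed

theorem mainTheorem1:
  shows "\<exists>(A :: online_alg) (\<Gamma> :: nat \<Rightarrow> real).
    polynomial_time A \<and> competitive A \<Gamma> \<and> \<Gamma> \<in> O(\<lambda>n. sqrt (real n))"
proof -
  have "(\<lambda>n. 33 * sqrt (real n)) \<in> O(\<lambda>n. sqrt (real n))" by simp
  then show ?thesis using polynomial_time_delay_alg competitive_delay_alg by blast
qed

end
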